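(* Let $d=3$, and for real numbers $s_1<s_2<\cdots<s_8$ and $t_1<t_2<\cdots<t_8$ let $\mathscr T=\mathscr T(s_\bullet,t_\bullet)$ be the T-mesh on the rectangle $[s_1,s_8]\times[t_1,t_8]$ whose interior $l$-edges are: the horizontal cross-cuts $y=t_2,\ y=t_3,\ y=t_6,\ y=t_7$; the vertical cross-cuts $x=s_2,\ x=s_3,\ x=s_7$; and the five T $l$-edges $\{s_4\}\times[t_3,t_7]$, $[s_2,s_6]\times\{t_5\}$, $[s_3,s_7]\times\{t_4\}$, $\{s_5\}\times[t_2,t_6]$, $\{s_6\}\times[t_2,t_7]$. All these meshes have the same topology, and the completely non-diagonalizable component (CNDC) consists of the first four of these T $l$-edges. Then $U_K(\mathscr T)=L_K(\mathscr T)+1$, where $L_K(\mathscr T)$ and $U_K(\mathscr T)$ are the bounds defined in the context. Put $$D=\frac{(t_4-t_7)(t_4-t_3)(t_4-t_6)}{(t_5-t_7)(t_5-t_3)(t_5-t_6)}-\frac{(s_5-s_2)(s_5-s_3)(s_5-s_6)}{(s_4-s_2)(s_4-s_3)(s_4-s_6)}\cdot\frac{(t_4-t_2)(t_4-t_3)(t_4-t_6)}{(t_5-t_2)(t_5-t_3)(t_5-t_6)}\cdot\frac{(s_4-s_3)(s_4-s_6)(s_4-s_7)}{(s_5-s_3)(s_5-s_6)(s_5-s_7)} .$$ If $D\neq0$ then $\dim S_3(\mathscr T)=L_K(\mathscr T)$, and if $D=0$ then $\dim S_3(\mathscr T)=U_K(\mathscr T)$. Both cases occur for admissible choices of $s_\bullet,t_\bullet$;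 thus different geometric realizations of the same T-mesh topology attain the lower bound $L_K$ and the upper bound $U_K$, respectively.
   Context: Let $d\ge1$ (here $d=3$). A T-mesh is a partition of a simply connected planar domain $\Phi$ into finitely many axis-aligned rectangles (cells), with T-junctions (interior vertices of valence 3) allowed. An $l$-edge is a maximal straight segment composed of collinear contiguous mesh edges whose endpoints are T-junctions or boundary vertices. An interior $l$-edge is a cross-cut if both endpoints lie on the domain boundary, a T $l$-edge if both endpoints are T-junctions, and a ray otherwise. $T(\mathscr T)$ is the set of all T $l$-edges with the vertices on them. $S_d(\mathscr T)$ is the space of functions on $\Phi$ that are $d-1$ times continuously differentiable in $x$ and $d-1$ times continuously differentiable in $y$ and whose restriction to every cell is a polynomial of bi-degree at most $(d,d)$. CNDC. A reasonable order on a set of T $l$-edges is an ordering $l_1\succ l_2\succ\cdots$ such that for each $i$ the number of vertices remaining on $l_i$ after deleting its intersections with the preceding edges is at least $d+1$. $\mathscr T$ is diagonalizable if $T(\mathscr T)$ has a reasonable order. For non-diagonalizable $\mathscr T$, a partition $\{T_1,T_2\}$ of the T $l$-edges, with $T_2=T(\mathscr T)\setminus T_1$ (vertices lying on edges of $T_1$ are deleted from the edges of $T_2$), is regular if $T_1$ has no reasonable order and $T_2$ has one; it is complete if no other regular partition $\{T_1',T_2'\}$ has $T_1'$ a proper subset of $T_1$. The complete partition is unique and $T_1=\{l_1,\dots,l_s\}$ is the CNDC. $n_{\textit{CNDC}}$ is the number of vertices on edges of $T_1$. A multi-vertex of the CNDC is a vertex that is the intersection of two edges of $T_1$. For $l\in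 T_1$, $n(l)$ is the number of vertices of $\mathscr T$ on $l$ (endpoints included) and $m(l)$ the number of multi-vertices of the CNDC on $l$. With $c$ the number of cross-cuts, $t$ the number of T $l$-edges, and $n_v$ the number of interior vertices of $\mathscr T$, $$L_K(\mathscr{T}) = (d+1)^2 + (c-t)(d+1) + n_v + \max\{s(d+1) - n_{\textit{CNDC}},0\},$$ $$U_K(\mathscr{T})=(d+1)^2 + (c-t)(d+1) + n_v + \min_{\pi} \sum_{i=1}^s \max\{ m(l_i) - n(l_i) + d + 1 - u_\pi^-(l_i),0\},$$ where $\pi$ ranges over all orderings of $T_1$ and $u_\pi^-(l_i)$ is the number of multi-vertices on $l_i$ shared with CNDC edges preceding $l_i$ in $\pi$. *)

theory Defs
  imports
    "HOL-Analysis.Analysis"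
    "HOL-Library.Function_Algebras"
    "HOL-Combinatorics.Multiset_Permutations"
begin

section \<open>T-meshes\<close>

text \<open>
  A mesh is given by its set of closed cells \<open>\<T>\<close>; the (closed) domain is \<open>\<Union>\<T>\<close>.
  Asking for both the domain and its interior to be simply connected excludes domains that
  are pinched at a corner.
\<close>

definition t_mesh :: "(real \<times> real) set set \<Rightarrow> bool" where
  "t_mesh \<T> \<longleftrightarrow> \<T> \<noteq> {} \<and> \<T> division_of \<Union>\<T> \<and> (\<forall>K\<in>\<T>. interior K \<noteq> {}) \<and>
     simply_connected (\<Union>\<T>) \<and> simply_connected (interior (\<Union>\<T>))"

definition vertices :: "(real \<times> real) set set \<Rightarrow> (real \<times> real) set" where
  "vertices \<T> = (\<Union>K\<in>\<T>. {v. v extreme_point_of K})"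

definition interior_vertices :: "(real \<times> real) set set \<Rightarrow> (real \<times> real) set" where
  "interior_vertices \<T> = vertices \<T> \<inter> interior (\<Union>\<T>)"

definition boundary_vertices :: "(real \<times> real) set set \<Rightarrow> (real \<times> real) set" where
  "boundary_vertices \<T> = vertices \<T> \<inter> frontier (\<Union>\<T>)"

definition axis_parallel :: "real \<times> real \<Rightarrow> real \<times> real \<Rightarrow> bool" where
  "axis_parallel p q \<longleftrightarrow> p \<noteq> q \<and> (fst p = fst q \<or> snd p = snd q)"

definition mesh_edges :: "(real \<times> real) set set \<Rightarrow> (real \<times> real) set set" where
  "mesh_edges \<T> = {closed_segment p q | p q.
     p \<in> vertices \<T> \<and> q \<in> vertices \<T> \<and> axis_parallel p q \<and>
     closed_segment p q \<subseteq> (\<Union>K\<in>\<T>. frontier K) \<and> open_segment p q \<inter> vertices \<T> = {}}"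

definition interior_edges :: "(real \<times> real) set set \<Rightarrow> (real \<times> real) set set" where
  "interior_edges \<T> = {E \<in> mesh_edges \<T>. \<not> E \<subseteq> frontier (\<Union>\<T>)}"

definition valence :: "(real \<times> real) set set \<Rightarrow> real \<times> real \<Rightarrow> nat" where
  "valence \<T> v = card {E \<in> mesh_edges \<T>. v \<in> E}"

definition T_junctions :: "(real \<times> real) set set \<Rightarrow> (real \<times> real) set" where
  "T_junctions \<T> = {v \<in> interior_vertices \<T>. valence \<T> v = 3}"

text \<open>
  Axis-parallel segments composed of contiguous interior mesh edges.  Boundary edges are left
  out, so at a reentrant corner of the domain an interior $l$-edge ends instead of being
  continued along the boundary.
\<close>

definition interior_chains :: "(real \<times> real) set set \<Rightarrow> (real \<times> real) set set" where
  "interior_chains \<T> = {closed_segment p q | p q.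
     axis_parallel p q \<and> (\<exists>E \<subseteq> interior_edges \<T>. closed_segment p q = \<Union>E)}"

definition interior_l_edges :: "(real \<times> real) set set \<Rightarrow> (real \<times> real) set set" where
  "interior_l_edges \<T> = {L \<in> interior_chains \<T>.
     (\<forall>L'\<in>interior_chains \<T>. L \<subseteq> L' \<longrightarrow> L' = L) \<and>
     (\<exists>p q. L = closed_segment p q \<and>
        p \<in> T_junctions \<T> \<union> boundary_vertices \<T> \<and> q \<in> T_junctions \<T> \<union> boundary_vertices \<T>)}"

definition cross_cuts :: "(real \<times> real) set set \<Rightarrow> (real \<times> real) set set" where
  "cross_cuts \<T> = {L \<in> interior_l_edges \<T>.
     \<exists>p q. L = closed_segment p q \<and> p \<in> boundary_vertices \<T> \<and> q \<in> boundary_vertices \<T>}"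

definition T_l_edges :: "(real \<times> real) set set \<Rightarrow> (real \<times> real) set set" where
  "T_l_edges \<T> = {L \<in> interior_l_edges \<T>.
     \<exists>p q. L = closed_segment p q \<and> p \<in> T_junctions \<T> \<and> q \<in> T_junctions \<T>}"

text \<open>
  Two realizations of one topology: the homeomorphism has to respect the $l$-edges as well,
  since cells, edges and vertices alone do not determine which two of the three edges at a
  T-junction are collinear.
\<close>

definition same_topology :: "(real \<times> real) set set \<Rightarrow> (real \<times> real) set set \<Rightarrow> bool" where
  "same_topology \<T> \<T>' \<longleftrightarrow> (\<exists>f g. homeomorphism (\<Union>\<T>) (\<Union>\<T>') f g \<and>
     (`) f ` \<T> = \<T>' \<and> f ` vertices \<T> = vertices \<T>' \<and>
     (`) f ` mesh_edges \<T> = mesh_edges \<T>' \<and>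
     (`) f ` interior_l_edges \<T> = interior_l_edges \<T>')"


section \<open>Spline spaces\<close>

text \<open>
  \<open>Ck_along v k \<Phi> f\<close>: on \<open>\<Phi>\<close> the iterated derivatives of \<open>f\<close> in direction \<open>v\<close> up to order
  \<open>k\<close> exist (one-sided at the boundary) and are jointly continuous.
\<close>

primrec Ck_along ::
  "real \<times> real \<Rightarrow> nat \<Rightarrow> (real \<times> real) set \<Rightarrow> (real \<times> real \<Rightarrow> real) \<Rightarrow> bool" where
  "Ck_along v 0 \<Phi> f \<longleftrightarrow> continuous_on \<Phi> f"
| "Ck_along v (Suc k) \<Phi> f \<longleftrightarrow> continuous_on \<Phi> f \<and>
     (\<exists>g. (\<forall>p\<in>\<Phi>. ((\<lambda>h. f (p + h *\<^sub>R v)) has_real_derivative g p)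
                    (at 0 within {h. p + h *\<^sub>R v \<in> \<Phi>})) \<and>
          Ck_along v k \<Phi> g)"

definition bidegree_poly_on :: "nat \<Rightarrow> (real \<times> real) set \<Rightarrow> (real \<times> real \<Rightarrow> real) \<Rightarrow> bool" where
  "bidegree_poly_on d K f \<longleftrightarrow>
     (\<exists>a :: nat \<Rightarrow> nat \<Rightarrow> real. \<forall>(x, y)\<in>K. f (x, y) = (\<Sum>i\<le>d. \<Sum>j\<le>d. a i j * x ^ i * y ^ j))"

text \<open>Functions on the domain are represented by their extensions by zero to the plane.\<close>

definition spline_space :: "nat \<Rightarrow> (real \<times> real) set set \<Rightarrow> (real \<times> real \<Rightarrow> real) set" where
  "spline_space d \<T> = {f.
     (\<forall>p. p \<notin> \<Union>\<T> \<longrightarrow> f p = 0) \<and>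
     Ck_along (1, 0) (d - 1) (\<Union>\<T>) f \<and> Ck_along (0, 1) (d - 1) (\<Union>\<T>) f \<and>
     (\<forall>K\<in>\<T>. bidegree_poly_on d K f)}"

interpretation fun_vs: vector_space "\<lambda>(c::real) (f :: real \<times> real \<Rightarrow> real) x. c * f x"
  by unfold_locales (auto simp: fun_eq_iff algebra_simps)

definition spline_dim :: "nat \<Rightarrow> (real \<times> real) set set \<Rightarrow> nat" where
  "spline_dim d \<T> = fun_vs.dim (spline_space d \<T>)"


section \<open>The completely non-diagonalizable component\<close>

text \<open>\<open>W\<close> is the set of vertices that have not been deleted.\<close>

definition has_reasonable_order ::
  "nat \<Rightarrow> (real \<times> real) set \<Rightarrow> (real \<times> real) set set \<Rightarrow> bool" where
  "has_reasonable_order d W T \<longleftrightarrow> (\<exists>ls \<in> permutations_of_set T.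
     \<forall>i < length ls. d + 1 \<le> card ((W \<inter> ls ! i) - (\<Union>j<i. ls ! j)))"

definition diagonalizable :: "nat \<Rightarrow> (real \<times> real) set set \<Rightarrow> bool" where
  "diagonalizable d \<T> \<longleftrightarrow> has_reasonable_order d (vertices \<T>) (T_l_edges \<T>)"

text \<open>A partition \<open>{T1, T2}\<close> is given by \<open>T1\<close>; \<open>T2\<close> may be empty.\<close>

definition regular_partition ::
  "nat \<Rightarrow> (real \<times> real) set set \<Rightarrow> (real \<times> real) set set \<Rightarrow> bool" where
  "regular_partition d \<T> T1 \<longleftrightarrow> T1 \<subseteq> T_l_edges \<T> \<and>
     \<not> has_reasonable_order d (vertices \<T>) T1 \<and>
     has_reasonable_order d (vertices \<T> - \<Union>T1) (T_l_edges \<T> - T1)"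

definition complete_partition ::
  "nat \<Rightarrow> (real \<times> real) set set \<Rightarrow> (real \<times> real) set set \<Rightarrow> bool" where
  "complete_partition d \<T> T1 \<longleftrightarrow> regular_partition d \<T> T1 \<and>
     \<not> (\<exists>T1'. regular_partition d \<T> T1' \<and> T1' \<subset> T1)"

definition cndc :: "nat \<Rightarrow> (real \<times> real) set set \<Rightarrow> (real \<times> real) set set" where
  "cndc d \<T> = (if diagonalizable d \<T> then {} else (THE T1. complete_partition d \<T> T1))"

definition multi_vertices :: "nat \<Rightarrow> (real \<times> real) set set \<Rightarrow> (real \<times> real) set" where
  "multi_vertices d \<T> = {v \<in> vertices \<T>. \<exists>l\<in>cndc d \<T>. \<exists>l'\<in>cndc d \<T>. l \<noteq> l' \<and> v \<in> l \<inter> l'}"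


section \<open>The bounds\<close>

text \<open>The part common to both bounds; \<open>c - t\<close> may be negative, hence integers.\<close>

definition K_base :: "nat \<Rightarrow> (real \<times> real) set set \<Rightarrow> int" where
  "K_base d \<T> = (int d + 1)\<^sup>2
     + (int (card (cross_cuts \<T>)) - int (card (T_l_edges \<T>))) * (int d + 1)
     + int (card (interior_vertices \<T>))"

definition L_K :: "nat \<Rightarrow> (real \<times> real) set set \<Rightarrow> int" where
  "L_K d \<T> = K_base d \<T> +
     max (int (card (cndc d \<T>)) * (int d + 1) - int (card (vertices \<T> \<inter> \<Union>(cndc d \<T>)))) 0"

definition U_K :: "nat \<Rightarrow> (real \<times> real) set set \<Rightarrow> int" where
  "U_K d \<T> = K_base d \<T> + Min {\<Sum>i<length ls.
       max (int (card (multi_vertices d \<T> \<inter> ls ! i)) - int (card (vertices \<T> \<inter> ls ! i))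
             + int d + 1 - int (card (multi_vertices d \<T> \<inter> ls ! i \<inter> (\<Union>j<i. ls ! j)))) 0
     | ls. ls \<in> permutations_of_set (cndc d \<T>)}"


section \<open>The example\<close>

definition example_cndc :: "(nat \<Rightarrow> real) \<Rightarrow> (nat \<Rightarrow> real) \<Rightarrow> (real \<times> real) set set" where
  "example_cndc s t =
     {{s 4} \<times> {t 3..t 7}, {s 2..s 6} \<times> {t 5}, {s 3..s 7} \<times> {t 4}, {s 5} \<times> {t 2..t 6}}"

definition example_T_l_edges :: "(nat \<Rightarrow> real) \<Rightarrow> (nat \<Rightarrow> real) \<Rightarrow> (real \<times> real) set set" where
  "example_T_l_edges s t = example_cndc s t \<union> {{s 6} \<times> {t 2..t 7}}"

definition example_cross_cuts :: "(nat \<Rightarrow> real) \<Rightarrow> (nat \<Rightarrow> real) \<Rightarrow> (real \<times> real) set set" where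
  "example_cross_cuts s t =
     {{s 1..s 8} \<times> {t j} | j. j \<in> {2, 3, 6, 7}} \<union> {{s i} \<times> {t 1..t 8} | i. i \<in> {2, 3, 7}}"

definition example_mesh ::
  "(nat \<Rightarrow> real) \<Rightarrow> (nat \<Rightarrow> real) \<Rightarrow> (real \<times> real) set set \<Rightarrow> bool" where
  "example_mesh s t \<T> \<longleftrightarrow> t_mesh \<T> \<and> \<Union>\<T> = {s 1..s 8} \<times> {t 1..t 8} \<and>
     interior_l_edges \<T> = example_cross_cuts s t \<union> example_T_l_edges s t"

definition admissible :: "(nat \<Rightarrow> real) \<Rightarrow> (nat \<Rightarrow> real) \<Rightarrow> bool" where
  "admissible s t \<longleftrightarrow> strict_mono_on {1..8} s \<and> strict_mono_on {1..8} t"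

definition example_D :: "(nat \<Rightarrow> real) \<Rightarrow> (nat \<Rightarrow> real) \<Rightarrow> real" where
  "example_D s t =
     ((t 4 - t 7) * (t 4 - t 3) * (t 4 - t 6)) / ((t 5 - t 7) * (t 5 - t 3) * (t 5 - t 6))
     - ((s 5 - s 2) * (s 5 - s 3) * (s 5 - s 6)) / ((s 4 - s 2) * (s 4 - s 3) * (s 4 - s 6))
     * (((t 4 - t 2) * (t 4 - t 3) * (t 4 - t 6)) / ((t 5 - t 2) * (t 5 - t 3) * (t 5 - t 6)))
     * (((s 4 - s 3) * (s 4 - s 6) * (s 4 - s 7)) / ((s 5 - s 3) * (s 5 - s 6) * (s 5 - s 7)))"

end

theory Submission
  imports Defs "HOL-Computational_Algebra.Polynomial"
begin

text \<open>
  On a grid with eight lines in each direction, the bicubic \<open>C\<^sup>2\<close> splines are the combinations of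
  the \<open>10 \<times> 10\<close> products of univariate basis functions: four cubic polynomials and the
  truncated powers of the six interior knots.  A spline on the T-mesh is one whose jumps vanish
  along the missing grid segments, and such a jump across \<open>x = s k\<close> is \<open>(x - s k)\<^sup>3\<close> times a
  univariate spline in \<open>y\<close> formed by the coefficients belonging to that line
  (\<open>spline_space_iff\<close>).  Hence on each T $l$-edge only the coefficients of its vertices survive,
  and they have to annihilate all cubics (\<open>edge_coefficients\<close>).

  The products that use none of the five T lines are unconstrained and span a space of dimension
  \<open>7 \<cdot> 8 = 56\<close>.  On the T lines, four weights that annihilate all cubics are zero, and five
  weights are determined up to a factor.  The four edges of the CNDC carry five vertices each and
  form a cycle through four multi-vertices, so that walking round the cycle multiplies the weight at
  a multi-vertex by a cross-ratio-like factor.  That factor is 1 exactly if \<open>D = 0\<close>.  So for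
  \<open>D \<noteq> 0\<close> all weights on the T lines vanish (\<open>coefficient_times_D\<close>, \<open>T_coefficients_zero\<close>)
  and the dimension is \<open>56\<close>, while for \<open>D = 0\<close> there is exactly one more spline
  (\<open>kernel_coefficients\<close>).  The combinatorial bounds are \<open>L_K = 56\<close> and \<open>U_K = 57\<close>.

  That the $l$-edges determine the mesh rests on a local fact: at an interior vertex at most
  one of the four axis directions leaves the union of the edges (\<open>at_most_one_missing_ray\<close>), so
  a maximal chain of edges can only end at a T-junction or on the boundary.  Consequently
  the $l$-edges cover all interior edges, and the open cells are the components of their
  complement (\<open>mesh_determined_by_l_edges\<close>).  The mesh itself and the conditions on orders of its
  T $l$-edges are handled through the indices of the grid lines.
\<close>

section \<open>Meshes of a rectangle: local structure at a vertex\<close>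

definition skeleton :: "(real \<times> real) set set \<Rightarrow> (real \<times> real) set" where
  "skeleton \<T> = (\<Union>K\<in>\<T>. frontier K)"

definition axis_directions :: "(real \<times> real) set" where
  "axis_directions = {(1, 0), (-1, 0), (0, 1), (0, -1)}"

definition ray_in_skeleton :: "(real \<times> real) set set \<Rightarrow> real \<times> real \<Rightarrow> real \<times> real \<Rightarrow> bool" where
  "ray_in_skeleton \<T> v u \<longleftrightarrow>
     (\<exists>e>0. \<forall>a. 0 < a \<and> a < e \<longrightarrow> v + a *\<^sub>R u \<in> skeleton \<T>)"

lemma extreme_point_rectangle:
  fixes a b c d :: real
  assumes "a \<le> b" "c \<le> d"
  shows "v extreme_point_of ({a..b} \<times> {c..d}) \<longleftrightarrow> v \<in> {a, b} \<times> {c, d}"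
proof (cases v)
  case (Pair x y)
  have "v extreme_point_of ({a..b} \<times> {c..d}) \<longleftrightarrow> ({x} \<times> {y}) face_of ({a..b} \<times> {c..d})"
    by (simp add: face_of_singleton Pair)
  also have "\<dots> \<longleftrightarrow> x extreme_point_of {a..b} \<and> y extreme_point_of {c..d}"
    by (subst face_of_Times_eq) (simp add: face_of_singleton)
  also have "\<dots> \<longleftrightarrow> v \<in> {a, b} \<times> {c, d}"
    using assms extreme_point_of_segment[of x a b] extreme_point_of_segment[of y c d]
    by (auto simp: closed_segment_eq_real_ivl Pair)
  finally show ?thesis .
qed

lemma interior_rectangle:
  fixes a b c d :: real
  shows "interior ({a..b} \<times> {c..d}) = {a<..<b} \<times> {c<..<d}"
  by (simp add: interior_Times)

lemma frontier_rectangle: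
  fixes a b c d :: real
  shows "frontier ({a..b} \<times> {c..d}) = {a..b} \<times> {c..d} - {a<..<b} \<times> {c<..<d}"
  by (simp add: frontier_def interior_rectangle closed_Times closure_closed)

lemma axis_direction_nonzero: "u \<in> axis_directions \<Longrightarrow> u \<noteq> 0"
  by (auto simp: axis_directions_def zero_prod_def)

lemma uminus_axis_direction: "u \<in> axis_directions \<Longrightarrow> - u \<in> axis_directions"
  by (auto simp: axis_directions_def)

lemma axis_parallel_iff:
  "axis_parallel p q \<longleftrightarrow> (\<exists>u\<in>axis_directions. \<exists>a>0. q = p + a *\<^sub>R u)"
proof
  assume pq: "axis_parallel p q"
  show "\<exists>u\<in>axis_directions. \<exists>a>0. q = p + a *\<^sub>R u"
  proof (cases "fst p = fst q")
    case True
    then have "snd p \<noteq> snd q"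
      using pq by (auto simp: axis_parallel_def prod_eq_iff)
    then consider "snd p < snd q" | "snd q < snd p" by linarith
    then show ?thesis
    proof cases
      case 1
      then have "q = p + (snd q - snd p) *\<^sub>R (0, 1)" using True by (simp add: prod_eq_iff)
      then show ?thesis using 1 unfolding axis_directions_def by (metis diff_gt_0_iff_gt insertCI)
    next
      case 2
      then have "q = p + (snd p - snd q) *\<^sub>R (0, -1)" using True by (simp add: prod_eq_iff)
      then show ?thesis using 2 unfolding axis_directions_def by (metis diff_gt_0_iff_gt insertCI)
    qed
  next
    case False
    then have eq: "snd p = snd q"
      using pq by (auto simp: axis_parallel_def prod_eq_iff)
    from False consider "fst p < fst q" | "fst q < fst p" by linarith
    then show ?thesis
    proof cases
      case 1
      then have "q = p + (fst q - fst p) *\<^sub>R (1, 0)" using eq by (simp add: prod_eq_iff)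
      then show ?thesis using 1 unfolding axis_directions_def by (metis diff_gt_0_iff_gt insertCI)
    next
      case 2
      then have "q = p + (fst p - fst q) *\<^sub>R (-1, 0)" using eq by (simp add: prod_eq_iff)
      then show ?thesis using 2 unfolding axis_directions_def by (metis diff_gt_0_iff_gt insertCI)
    qed
  qed
next
  assume "\<exists>u\<in>axis_directions. \<exists>a>0. q = p + a *\<^sub>R u"
  then show "axis_parallel p q"
    by (auto simp: axis_directions_def axis_parallel_def prod_eq_iff)
qed

lemma closed_segment_along:
  fixes v u :: "'a::real_vector"
  assumes "a > 0"
  shows "closed_segment v (v + a *\<^sub>R u) = (\<lambda>b. v + b *\<^sub>R u) ` {0..a}"
proof -
  have *: "(\<exists>b. x = v + b *\<^sub>R u \<and> 0 \<le> b \<and> b \<le> a)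
      \<longleftrightarrow> (\<exists>t. x = (1 - t) *\<^sub>R v + t *\<^sub>R (v + a *\<^sub>R u) \<and> 0 \<le> t \<and> t \<le> 1)" for x
  proof (safe)
    fix b assume b: "0 \<le> b" "b \<le> a"
    show "\<exists>t. v + b *\<^sub>R u = (1 - t) *\<^sub>R v + t *\<^sub>R (v + a *\<^sub>R u) \<and> 0 \<le> t \<and> t \<le> 1"
      by (rule exI[of _ "b / a"]) (use assms b in \<open>simp add: algebra_simps\<close>)
  next
    fix t :: real assume t: "0 \<le> t" "t \<le> 1"
    show "\<exists>b. (1 - t) *\<^sub>R v + t *\<^sub>R (v + a *\<^sub>R u) = v + b *\<^sub>R u \<and> 0 \<le> b \<and> b \<le> a"
      by (rule exI[of _ "t * a"]) (use assms t mult_left_le_one_le[of a t] in \<open>simp add: algebra_simps\<close>)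
  qed
  show ?thesis
    by (rule set_eqI)
      (unfold closed_segment_def mem_Collect_eq image_iff Bex_def atLeastAtMost_iff *[symmetric], blast)
qed

lemma open_segment_along:
  fixes v u :: "'a::real_vector"
  assumes "a > 0" "u \<noteq> 0"
  shows "open_segment v (v + a *\<^sub>R u) = (\<lambda>b. v + b *\<^sub>R u) ` {0<..<a}"
proof -
  have "inj (\<lambda>b. v + b *\<^sub>R u)" using assms(2) by (auto intro!: injI)
  then have "(\<lambda>b. v + b *\<^sub>R u) ` ({0..a} - {0, a})
      = (\<lambda>b. v + b *\<^sub>R u) ` {0..a} - (\<lambda>b. v + b *\<^sub>R u) ` {0, a}"
    by (rule image_set_diff)
  then have "(\<lambda>b. v + b *\<^sub>R u) ` {0..a} - {v, v + a *\<^sub>R u} = (\<lambda>b. v + b *\<^sub>R u) ` ({0..a} - {0, a})"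
    by simp
  also have "{0..a} - {0, a} = {0<..<a}" by auto
  finally show ?thesis
    unfolding open_segment_def closed_segment_along[OF assms(1)] .
qed

locale rectangle_mesh =
  fixes \<T> :: "(real \<times> real) set set" and \<alpha> \<beta> \<gamma> \<delta> :: real
  assumes division: "\<T> division_of ({\<alpha>..\<beta>} \<times> {\<gamma>..\<delta>})"
    and interior_nonempty: "K \<in> \<T> \<Longrightarrow> interior K \<noteq> {}"
begin

abbreviation "\<Phi> \<equiv> {\<alpha>..\<beta>} \<times> {\<gamma>..\<delta>}"

lemma finite_cells: "finite \<T>"
  using division by (rule division_of_finite)

lemma Union_cells: "\<Union>\<T> = \<Phi>"
  using division by (simp add: division_of_def)

lemma cell_rectangle:
  assumes "K \<in> \<T>"
  obtains a b c d where "a < b" "c < d" "K = {a..b} \<times> {c..d}"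
proof -
  obtain p q where K: "K = cbox p q"
    using division_ofD(4)[OF division assms] by blast
  obtain a c b d where pq: "p = (a, c)" "q = (b, d)"
    by (metis surj_pair)
  have K': "K = {a..b} \<times> {c..d}"
    using K pq by (simp add: cbox_Pair_eq)
  then have "a < b" "c < d"
    using interior_nonempty[OF assms] by (auto simp: interior_rectangle)
  with K' that show thesis by blast
qed

lemma cells_separated:
  assumes "{a..b} \<times> {c..d} \<in> \<T>" "{a'..b'} \<times> {c'..d'} \<in> \<T>" "a < b" "c < d" "a' < b'" "c' < d'"
  shows "(a = a' \<and> b = b' \<and> c = c' \<and> d = d') \<or> b \<le> a' \<or> b' \<le> a \<or> d \<le> c' \<or> d' \<le> c"
proof (rule ccontr)
  assume neg: "\<not> ?thesis"
  have "{a..b} \<times> {c..d} \<noteq> {a'..b'} \<times> {c'..d'}"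
  proof
    assume eq: "{a..b} \<times> {c..d} = {a'..b'} \<times> {c'..d'}"
    have "{a..b} = {a'..b'} \<and> {c..d} = {c'..d'}"
      using eq assms(3-6) by (subst (asm) times_eq_iff) auto
    then show False using neg assms(3-6) by (auto simp: Icc_eq_Icc)
  qed
  then have "interior ({a..b} \<times> {c..d}) \<inter> interior ({a'..b'} \<times> {c'..d'}) = {}"
    using division assms(1,2) by (auto simp: division_of_def)
  moreover have "((max a a' + min b b') / 2, (max c c' + min d d') / 2)
      \<in> interior ({a..b} \<times> {c..d}) \<inter> interior ({a'..b'} \<times> {c'..d'})"
    using neg assms(3-6) unfolding interior_rectangle by (auto simp: max_def min_def)
  ultimately show False by blast
qed

lemma interior_disjoint_skeleton:
  assumes "K \<in> \<T>"
  shows "interior K \<inter> skeleton \<T> = {}"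
proof -
  have False if x: "x \<in> interior K" and K'T: "K' \<in> \<T>" and x': "x \<in> frontier K'" for x K'
  proof -
    obtain a b c d where K: "a < b" "c < d" "K = {a..b} \<times> {c..d}"
      using cell_rectangle[OF assms] by blast
    obtain a' b' c' d' where K': "a' < b'" "c' < d'" "K' = {a'..b'} \<times> {c'..d'}"
      using cell_rectangle[OF K'T] by blast
    show False
      using cells_separated[of a b c d a' b' c' d'] x x' K'T assms K K'
      by (auto simp: interior_rectangle frontier_rectangle)
  qed
  then show ?thesis unfolding skeleton_def by blast
qed

lemma not_skeleton_in_interior:
  assumes "x \<in> \<Phi>" "x \<notin> skeleton \<T>"
  obtains K where "K \<in> \<T>" "x \<in> interior K"
proof -
  have "x \<in> \<Union>\<T>" using assms(1) Union_cells by simp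
  then obtain K where K: "K \<in> \<T>" "x \<in> K" by blast
  then have "x \<in> interior K"
    using assms(2) closure_subset[of K] unfolding skeleton_def frontier_def by blast
  with K that show thesis by blast
qed

lemma closed_cell: "K \<in> \<T> \<Longrightarrow> closed K"
proof (erule cell_rectangle)
  fix a b c d assume "K = {a..b} \<times> {c..d}"
  then show "closed K" by (simp add: closed_Times)
qed

lemma cell_subset: "K \<in> \<T> \<Longrightarrow> K \<subseteq> \<Phi>"
  using Union_cells by (metis Union_upper)

lemma skeleton_subset: "skeleton \<T> \<subseteq> \<Phi>"
  unfolding skeleton_def
proof (rule UN_least)
  fix K assume "K \<in> \<T>"
  then show "frontier K \<subseteq> \<Phi>"
    using frontier_subset_closed[OF closed_cell, of K] cell_subset[of K] by (meson order_trans)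
qed

lemma vertices_subset_skeleton: "vertices \<T> \<subseteq> skeleton \<T>"
proof
  fix v assume "v \<in> vertices \<T>"
  then obtain K where K: "K \<in> \<T>" "v extreme_point_of K" by (auto simp: vertices_def)
  obtain a b c d where K': "a < b" "c < d" "K = {a..b} \<times> {c..d}"
    using cell_rectangle[OF K(1)] by blast
  have "v \<in> frontier K"
    using K(2) K'(1,2) unfolding K'(3)
    by (subst (asm) extreme_point_rectangle) (auto simp: frontier_rectangle)
  then show "v \<in> skeleton \<T>" using K by (auto simp: skeleton_def)
qed

lemma finite_vertices: "finite (vertices \<T>)"
proof -
  have "finite {v. v extreme_point_of K}" if K: "K \<in> \<T>" for K
  proof -
    obtain a b c d where "a < b" "c < d" "K = {a..b} \<times> {c..d}"
      using cell_rectangle[OF K] by blast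
    then have "{v. v extreme_point_of K} = {a, b} \<times> {c, d}"
      using extreme_point_rectangle[of a b c d] by auto
    then show ?thesis by simp
  qed
  then show ?thesis using finite_cells by (auto simp: vertices_def)
qed

lemma mesh_edge_eq:
  "mesh_edges \<T> = {closed_segment p q | p q.
     p \<in> vertices \<T> \<and> q \<in> vertices \<T> \<and> axis_parallel p q \<and>
     closed_segment p q \<subseteq> skeleton \<T> \<and> open_segment p q \<inter> vertices \<T> = {}}"
  by (simp add: mesh_edges_def skeleton_def)

lemma nearby_cells: "\<exists>r>0. \<forall>K\<in>\<T>. \<forall>x\<in>K. dist v x < r \<longrightarrow> v \<in> K"
proof -
  let ?C = "\<Union>{K \<in> \<T>. v \<notin> K}"
  have "open (- ?C)" using finite_cells closed_cell by (auto intro!: closed_Union)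
  moreover have "v \<in> - ?C" by auto
  ultimately obtain r where "r > 0" "ball v r \<subseteq> - ?C"
    by (meson openE)
  then show ?thesis by (intro exI[of _ r]) (auto simp: subset_iff)
qed

lemma norm_axis_direction: "u \<in> axis_directions \<Longrightarrow> norm u = 1"
  by (auto simp: axis_directions_def norm_Pair)

text \<open>
  A cell that contains points of the ray on its frontier has a side along the ray, whose far corner
  is a vertex; the first vertex on the way to it ends the edge.
\<close>

lemma edge_along_ray:
  assumes ray: "ray_in_skeleton \<T> v u" and v: "v \<in> vertices \<T>" and u: "u \<in> axis_directions"
  obtains a where "a > 0" "v + a *\<^sub>R u \<in> vertices \<T>"
    "closed_segment v (v + a *\<^sub>R u) \<subseteq> skeleton \<T>"
    "open_segment v (v + a *\<^sub>R u) \<inter> vertices \<T> = {}"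
proof -
  obtain e where e: "e > 0" "\<And>a. 0 < a \<Longrightarrow> a < e \<Longrightarrow> v + a *\<^sub>R u \<in> skeleton \<T>"
    using ray by (auto simp: ray_in_skeleton_def)
  obtain r where r: "r > 0" "\<forall>K\<in>\<T>. \<forall>x\<in>K. dist v x < r \<longrightarrow> v \<in> K"
    using nearby_cells[of v] by (elim exE conjE) (rule that)
  define a0 where "a0 = min e r / 2"
  have a0: "0 < a0" "a0 < e" "a0 < r" using e(1) r(1) by (auto simp: a0_def)
  obtain K where K: "K \<in> \<T>" "v + a0 *\<^sub>R u \<in> frontier K"
    using e(2)[OF a0(1,2)] by (auto simp: skeleton_def)
  obtain a b c d where abcd: "a < b" "c < d" "K = {a..b} \<times> {c..d}"
    using cell_rectangle[OF K(1)] by blast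
  have "v + a0 *\<^sub>R u \<in> K" using K frontier_subset_closed[OF closed_cell] by blast
  moreover have "dist v (v + a0 *\<^sub>R u) < r"
    using a0 norm_axis_direction[OF u] by (simp add: dist_norm)
  ultimately have vK: "v \<in> K" using r(2) K(1) by blast
  have half: "v + (a0 / 2) *\<^sub>R u \<notin> interior K"
    using e(2)[of "a0/2"] a0 interior_disjoint_skeleton[OF K(1)] by auto
  obtain x y where xy: "v = (x, y)" by fastforce
  have "\<exists>m>0. v + m *\<^sub>R u extreme_point_of K \<and> (\<lambda>b. v + b *\<^sub>R u) ` {0..m} \<subseteq> frontier K"
  proof -
    consider "u = (1, 0)" | "u = (-1, 0)" | "u = (0, 1)" | "u = (0, -1)"
      using u by (auto simp: axis_directions_def)
    then show ?thesis
    proof cases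
      case 1
      then have "x + a0 \<le> b" "a \<le> x" "c \<le> y" "y \<le> d" "y = c \<or> y = d"
        using abcd vK half \<open>v + a0 *\<^sub>R u \<in> K\<close> xy a0 by (auto simp: interior_rectangle)
      then show ?thesis using abcd 1 xy a0
        by (intro exI[of _ "b - x"]) (auto simp: extreme_point_rectangle frontier_rectangle)
    next
      case 2
      then have "a \<le> x - a0" "x \<le> b" "c \<le> y" "y \<le> d" "y = c \<or> y = d"
        using abcd vK half \<open>v + a0 *\<^sub>R u \<in> K\<close> xy a0 by (auto simp: interior_rectangle)
      then show ?thesis using abcd 2 xy a0
        by (intro exI[of _ "x - a"]) (auto simp: extreme_point_rectangle frontier_rectangle)
    next
      case 3
      then have "y + a0 \<le> d" "c \<le> y" "a \<le> x" "x \<le> b" "x = a \<or> x = b"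
        using abcd vK half \<open>v + a0 *\<^sub>R u \<in> K\<close> xy a0 by (auto simp: interior_rectangle)
      then show ?thesis using abcd 3 xy a0
        by (intro exI[of _ "d - y"]) (auto simp: extreme_point_rectangle frontier_rectangle)
    next
      case 4
      then have "c \<le> y - a0" "y \<le> d" "a \<le> x" "x \<le> b" "x = a \<or> x = b"
        using abcd vK half \<open>v + a0 *\<^sub>R u \<in> K\<close> xy a0 by (auto simp: interior_rectangle)
      then show ?thesis using abcd 4 xy a0
        by (intro exI[of _ "y - c"]) (auto simp: extreme_point_rectangle frontier_rectangle)
    qed
  qed
  then obtain m where m: "m > 0" "v + m *\<^sub>R u \<in> vertices \<T>"
      "(\<lambda>b. v + b *\<^sub>R u) ` {0..m} \<subseteq> skeleton \<T>"
    using K(1) by (fastforce simp: vertices_def skeleton_def)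
  define M where "M = {b. 0 < b \<and> b \<le> m \<and> v + b *\<^sub>R u \<in> vertices \<T>}"
  have M_iff: "b \<in> M \<longleftrightarrow> 0 < b \<and> b \<le> m \<and> v + b *\<^sub>R u \<in> vertices \<T>" for b
    by (simp add: M_def)
  have inj: "inj_on (\<lambda>b. v + b *\<^sub>R u) M"
    using axis_direction_nonzero[OF u] by (auto intro!: inj_onI)
  have "finite M"
    by (rule finite_imageD[OF finite_subset[OF _ finite_vertices] inj]) (auto simp: M_iff)
  moreover have "m \<in> M" using m by (simp add: M_iff)
  ultimately have M: "Min M \<in> M" "\<And>b. b \<in> M \<Longrightarrow> Min M \<le> b"
    by (auto intro: Min_in)
  show thesis
  proof
    show M0: "Min M > 0" "v + Min M *\<^sub>R u \<in> vertices \<T>" using M(1)[unfolded M_iff] by blast+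
    show "closed_segment v (v + Min M *\<^sub>R u) \<subseteq> skeleton \<T>"
    proof -
      have "Min M \<le> m" using M(1)[unfolded M_iff] by blast
      then have "(\<lambda>b. v + b *\<^sub>R u) ` {0..Min M} \<subseteq> (\<lambda>b. v + b *\<^sub>R u) ` {0..m}"
        by (intro image_mono) auto
      then show ?thesis using m(3) unfolding closed_segment_along[OF M0(1)] by (rule order_trans)
    qed
    show "open_segment v (v + Min M *\<^sub>R u) \<inter> vertices \<T> = {}"
    proof -
      have first: "v + b *\<^sub>R u \<notin> vertices \<T>" if "0 < b" "b < Min M" for b
      proof
        assume "v + b *\<^sub>R u \<in> vertices \<T>"
        then have "b \<in> M" using that M(1)[unfolded M_iff] by (simp add: M_iff)
        then show False using M(2)[of b] that(2) by simp
      qed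
      show ?thesis
        unfolding open_segment_along[OF M0(1) axis_direction_nonzero[OF u]]
      proof (rule equals0I, elim IntE imageE)
        fix x b assume "x \<in> vertices \<T>" "x = v + b *\<^sub>R u" "b \<in> {0<..<Min M}"
        then show False using first[of b] by simp
      qed
    qed
  qed
qed

text \<open>
  Cells are closed, so the cell containing points of the ray arbitrarily near \<open>v\<close> contains \<open>v\<close>.
\<close>

lemma cell_beyond_missing_ray:
  assumes v: "v \<in> interior \<Phi>" and u: "u \<in> axis_directions" and ray: "\<not> ray_in_skeleton \<T> v u"
  obtains K a where "K \<in> \<T>" "v \<in> K" "a > 0" "v + a *\<^sub>R u \<in> interior K"
proof -
  obtain r where r: "r > 0" "\<forall>K\<in>\<T>. \<forall>x\<in>K. dist v x < r \<longrightarrow> v \<in> K"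
    using nearby_cells[of v] by (elim exE conjE) (rule that)
  obtain r' where r': "r' > 0" "ball v r' \<subseteq> \<Phi>"
    using v unfolding mem_interior by (elim exE conjE) (rule that)
  obtain a where a: "0 < a" "a < min r r'" "v + a *\<^sub>R u \<notin> skeleton \<T>"
    using ray r(1) r'(1) unfolding ray_in_skeleton_def by (metis min_less_iff_conj)
  have d: "dist v (v + a *\<^sub>R u) < min r r'"
    using a norm_axis_direction[OF u] by (simp add: dist_norm)
  then have inside: "v + a *\<^sub>R u \<in> \<Phi>" using r'(2) by (meson mem_ball min_less_iff_conj subsetD)
  obtain K where K: "K \<in> \<T>" "v + a *\<^sub>R u \<in> interior K"
    by (rule not_skeleton_in_interior[OF inside a(3)])
  moreover have "v \<in> K"
    using r(2)[rule_format, OF K(1), of "v + a *\<^sub>R u"] interior_subset[of K] K(2) d by auto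
  ultimately show thesis using that a(1) by blast
qed

text \<open>
  If a direction is missing, one cell covers both quadrants next to it.  Two opposite missing
  directions leave no quadrant for a cell with corner \<open>v\<close>; two perpendicular ones make the two
  covering cells coincide, and then this cell is a neighbourhood of \<open>v\<close>.
\<close>

lemma at_most_one_missing_ray:
  assumes v: "v \<in> vertices \<T>" "v \<in> interior \<Phi>"
    and u1: "u1 \<in> axis_directions" "\<not> ray_in_skeleton \<T> v u1"
    and u2: "u2 \<in> axis_directions" "\<not> ray_in_skeleton \<T> v u2"
  shows "u1 = u2"
proof (rule ccontr)
  assume ne: "u1 \<noteq> u2"
  obtain x y where xy: "v = (x, y)" by fastforce
  obtain K where K: "K \<in> \<T>" "v extreme_point_of K" using v(1) by (auto simp: vertices_def)
  obtain a b c d where abcd: "a < b" "c < d" "K = {a..b} \<times> {c..d}"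
    using cell_rectangle[OF K(1)] by blast
  have corner: "x = a \<or> x = b" "y = c \<or> y = d"
    using K(2) abcd xy by (auto simp: extreme_point_rectangle)
  obtain K1 m1 where K1: "K1 \<in> \<T>" "v \<in> K1" "m1 > 0" "v + m1 *\<^sub>R u1 \<in> interior K1"
    using cell_beyond_missing_ray[OF v(2) u1] by blast
  obtain a1 b1 c1 d1 where abcd1: "a1 < b1" "c1 < d1" "K1 = {a1..b1} \<times> {c1..d1}"
    using cell_rectangle[OF K1(1)] by blast
  obtain K2 m2 where K2: "K2 \<in> \<T>" "v \<in> K2" "m2 > 0" "v + m2 *\<^sub>R u2 \<in> interior K2"
    using cell_beyond_missing_ray[OF v(2) u2] by blast
  obtain a2 b2 c2 d2 where abcd2: "a2 < b2" "c2 < d2" "K2 = {a2..b2} \<times> {c2..d2}"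
    using cell_rectangle[OF K2(1)] by blast
  have in1: "a1 \<le> x" "x \<le> b1" "c1 \<le> y" "y \<le> d1" using K1(2) abcd1(3) xy by auto
  have in2: "a2 \<le> x" "x \<le> b2" "c2 \<le> y" "y \<le> d2" using K2(2) abcd2(3) xy by auto
  have s1: "(a = a1 \<and> b = b1 \<and> c = c1 \<and> d = d1) \<or> b \<le> a1 \<or> b1 \<le> a \<or> d \<le> c1 \<or> d1 \<le> c"
    using cells_separated K(1) K1(1) abcd abcd1 by metis
  have s2: "(a = a2 \<and> b = b2 \<and> c = c2 \<and> d = d2) \<or> b \<le> a2 \<or> b2 \<le> a \<or> d \<le> c2 \<or> d2 \<le> c"
    using cells_separated K(1) K2(1) abcd abcd2 by metis
  have s12: "(a1 = a2 \<and> b1 = b2 \<and> c1 = c2 \<and> d1 = d2) \<or> b1 \<le> a2 \<or> b2 \<le> a1 \<or> d1 \<le> c2 \<or> d2 \<le> c1"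
    using cells_separated K1(1) K2(1) abcd1 abcd2 by metis
  have i1: "x + m1 * fst u1 \<in> {a1<..<b1}" "y + m1 * snd u1 \<in> {c1<..<d1}"
    using K1(4) abcd1 xy by (auto simp: interior_rectangle mem_Times_iff)
  have i2: "x + m2 * fst u2 \<in> {a2<..<b2}" "y + m2 * snd u2 \<in> {c2<..<d2}"
    using K2(4) abcd2 xy by (auto simp: interior_rectangle mem_Times_iff)
  have j1: "(u1 = (1, 0) \<and> x < b1 \<and> c1 < y \<and> y < d1) \<or> (u1 = (-1, 0) \<and> a1 < x \<and> c1 < y \<and> y < d1) \<or>
      (u1 = (0, 1) \<and> y < d1 \<and> a1 < x \<and> x < b1) \<or> (u1 = (0, -1) \<and> c1 < y \<and> a1 < x \<and> x < b1)"
    using u1(1)[unfolded axis_directions_def insert_iff empty_iff] i1 K1(3)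
    by (elim disjE) simp_all
  have j2: "(u2 = (1, 0) \<and> x < b2 \<and> c2 < y \<and> y < d2) \<or> (u2 = (-1, 0) \<and> a2 < x \<and> c2 < y \<and> y < d2) \<or>
      (u2 = (0, 1) \<and> y < d2 \<and> a2 < x \<and> x < b2) \<or> (u2 = (0, -1) \<and> c2 < y \<and> a2 < x \<and> x < b2)"
    using u2(1)[unfolded axis_directions_def insert_iff empty_iff] i2 K2(3)
    by (elim disjE) simp_all
  \<comment> \<open>From here on only the order of the coordinates of the three cells matters.\<close>
  note lin = corner in1 in2 s1 s2 s12 abcd(1,2) abcd1(1,2) abcd2(1,2)
  from j1 show False
  proof (elim disjE conjE)
    assume "u1 = (1, 0)" "x < b1" "c1 < y" "y < d1"
    with j2 ne lin show False by (smt (verit))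
  next
    assume "u1 = (-1, 0)" "a1 < x" "c1 < y" "y < d1"
    with j2 ne lin show False by (smt (verit))
  next
    assume "u1 = (0, 1)" "y < d1" "a1 < x" "x < b1"
    with j2 ne lin show False by (smt (verit))
  next
    assume "u1 = (0, -1)" "c1 < y" "a1 < x" "x < b1"
    with j2 ne lin show False by (smt (verit))
  qed
qed

lemma edge_at_vertex:
  assumes "E \<in> mesh_edges \<T>" "v \<in> E" "v \<in> vertices \<T>"
  obtains u a where "u \<in> axis_directions" "a > 0" "E = closed_segment v (v + a *\<^sub>R u)"
    "v + a *\<^sub>R u \<in> vertices \<T>" "closed_segment v (v + a *\<^sub>R u) \<subseteq> skeleton \<T>"
    "open_segment v (v + a *\<^sub>R u) \<inter> vertices \<T> = {}"
proof -
  obtain p q where pq: "E = closed_segment p q" "p \<in> vertices \<T>" "q \<in> vertices \<T>"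
      "axis_parallel p q" "closed_segment p q \<subseteq> skeleton \<T>" "open_segment p q \<inter> vertices \<T> = {}"
    using assms(1) unfolding mesh_edge_eq mem_Collect_eq by (elim exE conjE) (rule that)
  have "v = p \<or> v = q" using assms(2,3) pq(1,6) unfolding open_segment_def by blast
  moreover have "axis_parallel q p" using pq(4) by (auto simp: axis_parallel_def)
  ultimately obtain w where w: "E = closed_segment v w" "w \<in> vertices \<T>" "axis_parallel v w"
      "closed_segment v w \<subseteq> skeleton \<T>" "open_segment v w \<inter> vertices \<T> = {}"
    using pq by (metis closed_segment_commute open_segment_commute)
  obtain u a where ua: "u \<in> axis_directions" "a > 0" "w = v + a *\<^sub>R u"
    using w(3) unfolding axis_parallel_iff by blast
  show thesis by (rule that[OF ua(1,2)]) (use w ua in simp_all)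
qed

lemma ray_from_segment:
  assumes "a > 0" "closed_segment v (v + a *\<^sub>R u) \<subseteq> skeleton \<T>"
  shows "ray_in_skeleton \<T> v u"
  unfolding ray_in_skeleton_def
proof (intro exI conjI allI impI)
  fix b assume "0 < b \<and> b < a"
  then have "v + b *\<^sub>R u \<in> (\<lambda>b. v + b *\<^sub>R u) ` {0..a}" by auto
  then show "v + b *\<^sub>R u \<in> skeleton \<T>"
    using assms(2) unfolding closed_segment_along[OF assms(1)] by blast
qed (rule assms(1))

lemma axis_direction_unique:
  assumes "u \<in> axis_directions" "u' \<in> axis_directions" "a > 0" "a *\<^sub>R u = b *\<^sub>R u'" "b \<ge> 0"
  shows "u = u'"
proof -
  have "norm (a *\<^sub>R u) = norm (b *\<^sub>R u')" using assms(4) by simp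
  then have "a = b"
    using assms(3,5) norm_axis_direction[OF assms(1)] norm_axis_direction[OF assms(2)] by simp
  then show ?thesis using assms(3,4) by simp
qed

text \<open>
  Mesh edges have no vertices in their interior, so each edge at \<open>v\<close> starts in \<open>v\<close>, and two edges
  in the same direction end at the same next vertex.
\<close>

lemma valence_eq_card_rays:
  assumes v: "v \<in> vertices \<T>"
  shows "valence \<T> v = card {u \<in> axis_directions. ray_in_skeleton \<T> v u}"
proof -
  let ?R = "{u \<in> axis_directions. ray_in_skeleton \<T> v u}"
  have "\<forall>u\<in>?R. \<exists>a>0. v + a *\<^sub>R u \<in> vertices \<T> \<and> closed_segment v (v + a *\<^sub>R u) \<subseteq> skeleton \<T> \<and>
      open_segment v (v + a *\<^sub>R u) \<inter> vertices \<T> = {}"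
  proof
    fix u assume "u \<in> ?R"
    then have u: "ray_in_skeleton \<T> v u" "u \<in> axis_directions" by simp_all
    show "\<exists>a>0. v + a *\<^sub>R u \<in> vertices \<T> \<and> closed_segment v (v + a *\<^sub>R u) \<subseteq> skeleton \<T> \<and>
        open_segment v (v + a *\<^sub>R u) \<inter> vertices \<T> = {}"
      by (rule edge_along_ray[OF u(1) v u(2)]) blast
  qed
  then obtain len where len: "\<And>u. u \<in> ?R \<Longrightarrow> len u > 0 \<and> v + len u *\<^sub>R u \<in> vertices \<T> \<and>
      closed_segment v (v + len u *\<^sub>R u) \<subseteq> skeleton \<T> \<and>
      open_segment v (v + len u *\<^sub>R u) \<inter> vertices \<T> = {}"
    by metis
  define E where "E u = closed_segment v (v + len u *\<^sub>R u)" for u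
  have "inj_on E ?R"
  proof
    fix u u' assume u: "u \<in> ?R" "u' \<in> ?R" "E u = E u'"
    have "v + len u *\<^sub>R u \<in> E u" by (simp add: E_def)
    then have "v + len u *\<^sub>R u \<in> closed_segment v (v + len u' *\<^sub>R u')"
      unfolding u(3) by (simp add: E_def)
    then obtain b where "b \<ge> 0" "v + len u *\<^sub>R u = v + b *\<^sub>R u'"
      using len[OF u(2)] closed_segment_along[of "len u'" v u'] by auto
    then show "u = u'"
      using axis_direction_unique[of u u' "len u" b] len[OF u(1)] u(1,2) by simp
  qed
  moreover have "E ` ?R = {E \<in> mesh_edges \<T>. v \<in> E}"
  proof (intro subset_antisym subsetI)
    fix F assume "F \<in> E ` ?R"
    then obtain u where u: "u \<in> ?R" "F = E u" by blast
    have "axis_parallel v (v + len u *\<^sub>R u)"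
      unfolding axis_parallel_iff using u(1) len[OF u(1)] by blast
    then have "F \<in> mesh_edges \<T>"
      unfolding u(2) E_def mesh_edge_eq mem_Collect_eq using len[OF u(1)] v by blast
    moreover have "v \<in> F" unfolding u(2) E_def by simp
    ultimately show "F \<in> {E \<in> mesh_edges \<T>. v \<in> E}" by blast
  next
    fix F assume F: "F \<in> {E \<in> mesh_edges \<T>. v \<in> E}"
    obtain u a where u: "u \<in> axis_directions" "a > 0" "F = closed_segment v (v + a *\<^sub>R u)"
        "v + a *\<^sub>R u \<in> vertices \<T>" "closed_segment v (v + a *\<^sub>R u) \<subseteq> skeleton \<T>"
        "open_segment v (v + a *\<^sub>R u) \<inter> vertices \<T> = {}"
      by (rule edge_at_vertex[of F v]) (use F v in blast)+
    have R: "u \<in> ?R" using u(1) ray_from_segment[OF u(2,5)] by simp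
    have between: "\<not> b < c" if "b > 0" "v + b *\<^sub>R u \<in> vertices \<T>" "c > 0"
        "open_segment v (v + c *\<^sub>R u) \<inter> vertices \<T> = {}" for b c
    proof
      assume "b < c"
      then have "v + b *\<^sub>R u \<in> open_segment v (v + c *\<^sub>R u)"
        unfolding open_segment_along[OF that(3) axis_direction_nonzero[OF u(1)]] using that(1)
        by (intro imageI) simp
      then show False using that(2,4) by blast
    qed
    have l: "len u > 0" "v + len u *\<^sub>R u \<in> vertices \<T>"
        "open_segment v (v + len u *\<^sub>R u) \<inter> vertices \<T> = {}"
      using len[OF R] by blast+
    have "\<not> a < len u" by (rule between[OF u(2,4) l(1,3)])
    moreover have "\<not> len u < a" by (rule between[OF l(1,2) u(2,6)])
    ultimately have a: "a = len u" by linarith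
    show "F \<in> E ` ?R" by (rule image_eqI[OF _ R]) (simp only: E_def u(3) a)
  qed
  ultimately have "bij_betw E ?R {E \<in> mesh_edges \<T>. v \<in> E}"
    unfolding bij_betw_def by (rule conjI)
  then have "card ?R = card {E \<in> mesh_edges \<T>. v \<in> E}" by (rule bij_betw_same_card)
  then show ?thesis by (simp only: valence_def)
qed

end

context rectangle_mesh begin
section \<open>Maximal chains determine the mesh\<close>

lemma interior_chain_vertices:
  assumes "closed_segment p q = \<Union>E" "E \<subseteq> interior_edges \<T>"
  shows "p \<in> vertices \<T>" "q \<in> vertices \<T>"
proof -
  have "x \<in> vertices \<T>" if x: "x extreme_point_of closed_segment p q" for x
  proof -
    have "x \<in> \<Union>E" using x assms(1) by (auto simp: extreme_point_of_def)
    then obtain F where F: "F \<in> E" "x \<in> F" by blast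
    then have "F \<in> mesh_edges \<T>" using assms(2) by (auto simp: interior_edges_def)
    then obtain a b where ab: "F = closed_segment a b" "a \<in> vertices \<T>" "b \<in> vertices \<T>"
      unfolding mesh_edge_eq by blast
    have "F \<subseteq> closed_segment p q" using F assms(1) by blast
    then have "x extreme_point_of F" using x F(2) by (auto simp: extreme_point_of_def)
    then show ?thesis using ab by (auto simp: extreme_point_of_segment)
  qed
  then show "p \<in> vertices \<T>" "q \<in> vertices \<T>" by (auto simp: extreme_point_of_segment)
qed

lemma interior_chain_subset_skeleton:
  assumes "C \<in> interior_chains \<T>"
  shows "C \<subseteq> skeleton \<T>"
  using assms by (auto simp: interior_chains_def interior_edges_def mesh_edge_eq)

lemma finite_interior_chains: "finite (interior_chains \<T>)"
proof (rule finite_subset)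
  show "interior_chains \<T> \<subseteq> (\<lambda>(p, q). closed_segment p q) ` (vertices \<T> \<times> vertices \<T>)"
  proof
    fix C assume "C \<in> interior_chains \<T>"
    then obtain p q E where C: "C = closed_segment p q" "C = \<Union>E" "E \<subseteq> interior_edges \<T>"
      unfolding interior_chains_def by blast
    then have "(p, q) \<in> vertices \<T> \<times> vertices \<T>"
      using interior_chain_vertices[of p q E] by simp
    then show "C \<in> (\<lambda>(p, q). closed_segment p q) ` (vertices \<T> \<times> vertices \<T>)"
      using C(1) by (intro image_eqI[of _ _ "(p, q)"]) simp_all
  qed
qed (simp add: finite_vertices)

lemma interior_edge_is_chain: "interior_edges \<T> \<subseteq> interior_chains \<T>"
proof
  fix E assume E: "E \<in> interior_edges \<T>"
  then obtain p q where "E = closed_segment p q" "axis_parallel p q"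
    by (auto simp: interior_edges_def mesh_edges_def)
  moreover have "E = \<Union>{E}" "{E} \<subseteq> interior_edges \<T>" using E by auto
  ultimately show "E \<in> interior_chains \<T>" unfolding interior_chains_def by blast
qed

text \<open>
  By maximality the chain cannot be prolonged beyond \<open>p\<close>, so that direction is missing at \<open>p\<close>;
  it is the only one, which leaves valence three.
\<close>

lemma T_junction_at_chain_end:
  assumes chain: "axis_parallel p q" "closed_segment p q = \<Union>E" "E \<subseteq> interior_edges \<T>"
    and maximal: "\<And>L. L \<in> interior_chains \<T> \<Longrightarrow> closed_segment p q \<subseteq> L \<Longrightarrow> L = closed_segment p q"
    and p: "p \<in> interior \<Phi>"
  shows "p \<in> T_junctions \<T>"
proof -
  obtain u b where ub: "u \<in> axis_directions" "b > 0" "q = p + b *\<^sub>R u"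
    using chain(1) unfolding axis_parallel_iff by blast
  have pv: "p \<in> vertices \<T>" using interior_chain_vertices[OF chain(2,3)] by simp
  have "\<not> ray_in_skeleton \<T> p (- u)"
  proof
    assume "ray_in_skeleton \<T> p (- u)"
    then obtain a where a: "a > 0" "p + a *\<^sub>R - u \<in> vertices \<T>"
      "closed_segment p (p + a *\<^sub>R - u) \<subseteq> skeleton \<T>"
      "open_segment p (p + a *\<^sub>R - u) \<inter> vertices \<T> = {}"
      using edge_along_ray[OF _ pv uminus_axis_direction[OF ub(1)]] by metis
    let ?w = "p + a *\<^sub>R - u"
    let ?F = "closed_segment p ?w"
    have "axis_parallel p ?w"
      unfolding axis_parallel_iff using a(1) uminus_axis_direction[OF ub(1)] by blast
    then have "?F \<in> mesh_edges \<T>"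
      unfolding mesh_edge_eq using a pv by blast
    moreover have "\<not> ?F \<subseteq> frontier (\<Union>\<T>)"
      using p unfolding Union_cells frontier_def by auto
    ultimately have F: "?F \<in> interior_edges \<T>" by (simp add: interior_edges_def)
    have q: "q = ?w + (a + b) *\<^sub>R u" using ub(3) by (simp add: algebra_simps)
    have "p = ?w + a *\<^sub>R u" by simp
    then have "p \<in> (\<lambda>c. ?w + c *\<^sub>R u) ` {0..a + b}"
      using a(1) ub(2) by (intro image_eqI[of _ _ a]) auto
    then have "p \<in> closed_segment ?w q"
      using closed_segment_along[of "a + b" ?w u] a(1) ub(2) unfolding q[symmetric] by simp
    from Un_closed_segment[OF this]
    have wq: "closed_segment ?w q = \<Union>(insert ?F E)"
      using chain(2) by (simp add: closed_segment_commute)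
    have "insert ?F E \<subseteq> interior_edges \<T>" using F chain(3) by simp
    moreover have "axis_parallel ?w q"
      unfolding axis_parallel_iff using q a(1) ub(1,2) by (metis add_pos_pos)
    ultimately have "closed_segment ?w q \<in> interior_chains \<T>"
      using wq unfolding interior_chains_def by blast
    moreover have "closed_segment p q \<subseteq> closed_segment ?w q" using wq chain(2) by blast
    ultimately have "?w \<in> closed_segment p q" using maximal by (metis ends_in_segment(1))
    then obtain c where c: "0 \<le> c" "p + a *\<^sub>R - u = p + c *\<^sub>R u"
      using closed_segment_along[of b p u] ub by auto
    then have "(a + c) *\<^sub>R u = 0" by (simp add: algebra_simps)
    then show False using a(1) c(1) axis_direction_nonzero[OF ub(1)] by simp
  qed
  then have "{u \<in> axis_directions. ray_in_skeleton \<T> p u} = axis_directions - {- u}"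
    using at_most_one_missing_ray[OF pv p] uminus_axis_direction[OF ub(1)] by blast
  moreover have "card axis_directions = 4" by (simp add: axis_directions_def)
  ultimately have "valence \<T> p = 3"
    using valence_eq_card_rays[OF pv] uminus_axis_direction[OF ub(1)] by simp
  then show ?thesis
    using pv p by (simp add: T_junctions_def interior_vertices_def Union_cells)
qed

lemma interior_l_edge_iff_maximal_chain:
  "interior_l_edges \<T> = {L \<in> interior_chains \<T>. \<forall>L'\<in>interior_chains \<T>. L \<subseteq> L' \<longrightarrow> L' = L}"
proof -
  have "\<exists>p q. L = closed_segment p q \<and> p \<in> T_junctions \<T> \<union> boundary_vertices \<T> \<and>
      q \<in> T_junctions \<T> \<union> boundary_vertices \<T>"
    if L: "L \<in> interior_chains \<T>" "\<forall>L'\<in>interior_chains \<T>. L \<subseteq> L' \<longrightarrow> L' = L" for L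
  proof -
    obtain p q E where pq: "L = closed_segment p q" "axis_parallel p q"
        "closed_segment p q = \<Union>E" "E \<subseteq> interior_edges \<T>"
      using L(1) unfolding interior_chains_def by blast
    have split: "x \<in> interior \<Phi> \<or> x \<in> boundary_vertices \<T>" if "x \<in> vertices \<T>" for x
    proof -
      have "x \<in> \<Phi>" using that vertices_subset_skeleton skeleton_subset by blast
      then show ?thesis using that closure_subset[of \<Phi>]
        unfolding boundary_vertices_def frontier_def Union_cells by blast
    qed
    have "p \<in> T_junctions \<T>" if "p \<in> interior \<Phi>"
      by (rule T_junction_at_chain_end[OF pq(2-4) _ that]) (use L(2) pq(1) in blast)
    moreover have "q \<in> T_junctions \<T>" if "q \<in> interior \<Phi>"
      by (rule T_junction_at_chain_end[OF _ _ pq(4) _ that, of p])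
        (use L(2) pq in \<open>auto simp: closed_segment_commute[of q p] axis_parallel_def\<close>)
    ultimately show ?thesis
      using pq(1) split interior_chain_vertices[OF pq(3,4)] by blast
  qed
  then show ?thesis unfolding interior_l_edges_def by blast
qed

text \<open>
  Induction on the number of vertices inside the segment: any of them splits it into two segments
  with fewer vertices.
\<close>

lemma segment_is_union_of_edges:
  assumes "p \<in> vertices \<T>" "q \<in> vertices \<T>" "axis_parallel p q" "closed_segment p q \<subseteq> skeleton \<T>"
  shows "\<exists>E \<subseteq> mesh_edges \<T>. closed_segment p q = \<Union>E"
  using assms
proof (induction "card (open_segment p q \<inter> vertices \<T>)" arbitrary: p q rule: less_induct)
  case less
  show ?case
  proof (cases "open_segment p q \<inter> vertices \<T> = {}")
    case True
    then have "closed_segment p q \<in> mesh_edges \<T>" unfolding mesh_edge_eq using less.prems by blast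
    then show ?thesis by (intro exI[of _ "{closed_segment p q}"]) auto
  next
    case False
    then obtain w where w: "w \<in> open_segment p q" "w \<in> vertices \<T>" by blast
    then have wc: "w \<in> closed_segment p q" "w \<noteq> p" "w \<noteq> q"
      by (auto simp: open_segment_def)
    have Un: "closed_segment p q = closed_segment p w \<union> closed_segment w q"
      using Un_closed_segment[OF wc(1)] by simp
    obtain t where "w = (1 - t) *\<^sub>R p + t *\<^sub>R q" using wc(1) unfolding closed_segment_def by blast
    then have "fst w = (1 - t) * fst p + t * fst q" "snd w = (1 - t) * snd p + t * snd q" by simp_all
    then have same: "(fst p = fst q \<longrightarrow> fst w = fst p) \<and> (snd p = snd q \<longrightarrow> snd w = snd p)"
      by (auto simp: algebra_simps)
    have par: "axis_parallel p w" "axis_parallel w q"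
      using less.prems(3) same wc by (auto simp: axis_parallel_def)
    have lt: "card (open_segment a b \<inter> vertices \<T>) < card (open_segment p q \<inter> vertices \<T>)"
      if ab: "a \<in> closed_segment p q" "b \<in> closed_segment p q" "w = a \<or> w = b" for a b
    proof (rule psubset_card_mono)
      have "p extreme_point_of closed_segment p q" "q extreme_point_of closed_segment p q"
        by (simp_all add: extreme_point_of_segment)
      then have "p \<notin> open_segment a b" "q \<notin> open_segment a b"
        using ab(1,2) unfolding extreme_point_of_def by blast+
      moreover have "open_segment a b \<subseteq> closed_segment p q"
        using ab(1,2) segment_open_subset_closed[of a b] closed_segment_subset[OF ab(1,2)] by auto
      ultimately have "open_segment a b \<subseteq> open_segment p q" unfolding open_segment_def[of p q] by blast
      moreover have "w \<notin> open_segment a b" using ab(3) unfolding open_segment_def by blast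
      ultimately show "open_segment a b \<inter> vertices \<T> \<subset> open_segment p q \<inter> vertices \<T>"
        using w by blast
    qed (simp add: finite_vertices)
    have sub: "closed_segment p w \<subseteq> skeleton \<T>" "closed_segment w q \<subseteq> skeleton \<T>"
      using less.prems(4) Un by blast+
    have 1: "\<exists>E \<subseteq> mesh_edges \<T>. closed_segment p w = \<Union>E"
      by (rule less.hyps[OF lt less.prems(1) w(2) par(1) sub(1)]) (use wc in simp_all)
    have 2: "\<exists>E \<subseteq> mesh_edges \<T>. closed_segment w q = \<Union>E"
      by (rule less.hyps[OF lt w(2) less.prems(2) par(2) sub(2)]) (use wc in simp_all)
    obtain E1 E2 where "E1 \<subseteq> mesh_edges \<T>" "closed_segment p w = \<Union>E1"
        "E2 \<subseteq> mesh_edges \<T>" "closed_segment w q = \<Union>E2"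
      using 1 2 by blast
    then show ?thesis using Un by (intro exI[of _ "E1 \<union> E2"]) auto
  qed
qed

lemma skeleton_point_on_edge:
  assumes "x \<in> skeleton \<T>"
  obtains E where "E \<in> mesh_edges \<T>" "x \<in> E"
proof -
  obtain K where K: "K \<in> \<T>" "x \<in> frontier K" using assms by (auto simp: skeleton_def)
  obtain a b c d where abcd: "a < b" "c < d" "K = {a..b} \<times> {c..d}"
    using cell_rectangle[OF K(1)] by blast
  obtain p q where pq: "p extreme_point_of K" "q extreme_point_of K" "axis_parallel p q"
      "closed_segment p q \<subseteq> frontier K" "x \<in> closed_segment p q"
  proof -
    have vert: "closed_segment (e, c) (e, d) = {e} \<times> {c..d}" for e
      using abcd(2) by (auto simp: closed_segment_same_fst closed_segment_eq_real_ivl)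
    have hori: "closed_segment (a, e) (b, e) = {a..b} \<times> {e}" for e
      using abcd(1) by (auto simp: closed_segment_same_snd closed_segment_eq_real_ivl)
    from K(2) abcd consider "x \<in> {a} \<times> {c..d}" | "x \<in> {b} \<times> {c..d}" | "x \<in> {a..b} \<times> {c}" | "x \<in> {a..b} \<times> {d}"
      by (auto simp: frontier_rectangle less_le)
    then show thesis
    proof cases
      case 1 then show thesis using abcd
        by (intro that[of "(a, c)" "(a, d)"])
          (auto simp: vert extreme_point_rectangle axis_parallel_def frontier_rectangle)
    next
      case 2 then show thesis using abcd
        by (intro that[of "(b, c)" "(b, d)"])
          (auto simp: vert extreme_point_rectangle axis_parallel_def frontier_rectangle)
    next
      case 3 then show thesis using abcd
        by (intro that[of "(a, c)" "(b, c)"])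
          (auto simp: hori extreme_point_rectangle axis_parallel_def frontier_rectangle)
    next
      case 4 then show thesis using abcd
        by (intro that[of "(a, d)" "(b, d)"])
          (auto simp: hori extreme_point_rectangle axis_parallel_def frontier_rectangle)
    qed
  qed
  have v: "p \<in> vertices \<T>" "q \<in> vertices \<T>"
    using K(1) pq(1,2) unfolding vertices_def by blast+
  have "closed_segment p q \<subseteq> skeleton \<T>" using K(1) pq(4) unfolding skeleton_def by blast
  from segment_is_union_of_edges[OF v pq(3) this]
  obtain E where E: "E \<subseteq> mesh_edges \<T>" "closed_segment p q = \<Union>E" by blast
  then have "x \<in> \<Union>E" using pq(5) by simp
  then obtain F where "F \<in> E" "x \<in> F" by blast
  with E(1) that show thesis by blast
qed

text \<open>
  There are finitely many chains, so the edge through \<open>x\<close> extends to a maximal one, and maximal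
  chains are $l$-edges because their ends are T-junctions or boundary vertices.
\<close>

lemma skeleton_covered_by_l_edges:
  assumes "x \<in> skeleton \<T>" "x \<in> interior \<Phi>"
  shows "x \<in> \<Union>(interior_l_edges \<T>)"
proof -
  obtain E where E: "E \<in> mesh_edges \<T>" "x \<in> E" using skeleton_point_on_edge[OF assms(1)] by blast
  moreover have "x \<notin> frontier (\<Union>\<T>)" using assms(2) by (simp add: frontier_def Union_cells)
  ultimately have "E \<in> interior_edges \<T>" by (auto simp: interior_edges_def)
  then have "E \<in> interior_chains \<T>" using interior_edge_is_chain by blast
  then obtain L where L: "L \<in> interior_chains \<T>" "E \<subseteq> L"
      "\<forall>L'\<in>interior_chains \<T>. L \<subseteq> L' \<longrightarrow> L' = L"
    using finite_has_maximal2[OF finite_interior_chains] by (metis subset_antisym)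
  then have "L \<in> interior_l_edges \<T>" unfolding interior_l_edge_iff_maximal_chain by blast
  then show ?thesis using L(2) E(2) by blast
qed

lemma l_edges_subset_skeleton: "\<Union>(interior_l_edges \<T>) \<subseteq> skeleton \<T>"
  using interior_chain_subset_skeleton unfolding interior_l_edges_def by blast

lemma Union_interior_cells:
  "(\<Union>K\<in>\<T>. interior K) = interior \<Phi> - \<Union>(interior_l_edges \<T>)"
proof (intro subset_antisym subsetI)
  fix x assume "x \<in> (\<Union>K\<in>\<T>. interior K)"
  then obtain K where K: "K \<in> \<T>" "x \<in> interior K" by blast
  then have "x \<in> interior \<Phi>" using interior_mono[OF cell_subset] by blast
  moreover have "x \<notin> skeleton \<T>" using K interior_disjoint_skeleton by blast
  ultimately show "x \<in> interior \<Phi> - \<Union>(interior_l_edges \<T>)"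
    using l_edges_subset_skeleton by blast
next
  fix x assume x: "x \<in> interior \<Phi> - \<Union>(interior_l_edges \<T>)"
  then have "x \<notin> skeleton \<T>" using skeleton_covered_by_l_edges by blast
  moreover have "x \<in> \<Phi>" using x interior_subset by blast
  ultimately show "x \<in> (\<Union>K\<in>\<T>. interior K)" using not_skeleton_in_interior by blast
qed

lemma cell_interior_connected: "K \<in> \<T> \<Longrightarrow> connected (interior K)"
  by (erule cell_rectangle) (simp add: interior_rectangle convex_connected convex_Times)

lemma cell_eq_closure_interior: "K \<in> \<T> \<Longrightarrow> K = closure (interior K)"
  by (erule cell_rectangle) (simp add: interior_rectangle closure_Times)

lemma interior_cell_unique: "K \<in> \<T> \<Longrightarrow> K' \<in> \<T> \<Longrightarrow> x \<in> interior K \<Longrightarrow> x \<in> interior K' \<Longrightarrow> K = K'"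
  using division by (auto simp: division_of_def)

end

lemma connected_in_one_open_set:
  assumes conn: "connected S" and ne: "S \<noteq> {}" and sub: "S \<subseteq> \<Union>\<U>"
    and op: "\<And>U. U \<in> \<U> \<Longrightarrow> open U"
    and disj: "\<And>U V. U \<in> \<U> \<Longrightarrow> V \<in> \<U> \<Longrightarrow> U \<noteq> V \<Longrightarrow> U \<inter> V = {}"
  obtains U where "U \<in> \<U>" "S \<subseteq> U"
proof -
  obtain x U where xU: "x \<in> S" "U \<in> \<U>" "x \<in> U" using ne sub by blast
  have "open (\<Union>(\<U> - {U}))" using op by (intro open_Union) auto
  moreover have "U \<inter> \<Union>(\<U> - {U}) \<inter> S = {}" using disj[OF xU(2)] by auto
  moreover have cover: "S \<subseteq> U \<union> \<Union>(\<U> - {U})" using sub by auto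
  ultimately have "U \<inter> S = {} \<or> \<Union>(\<U> - {U}) \<inter> S = {}"
    by (intro connectedD[OF conn op[OF xU(2)]])
  then have "\<Union>(\<U> - {U}) \<inter> S = {}" using xU by auto
  then have "S \<subseteq> U"
    using subsetD[OF cover] by (intro subsetI) (metis IntI UnE empty_iff)
  then show thesis by (rule that[OF xU(2)])
qed

text \<open>
  The open cells are the connected components of the open rectangle minus the $l$-edges.
\<close>

lemma mesh_determined_by_l_edges:
  assumes T: "rectangle_mesh \<T> \<alpha> \<beta> \<gamma> \<delta>" and T': "rectangle_mesh \<T>' \<alpha> \<beta> \<gamma> \<delta>"
    and eq: "interior_l_edges \<T> = interior_l_edges \<T>'"
  shows "\<T> = \<T>'"
proof -
  have one: "\<exists>K'\<in>\<T>'. interior K \<subseteq> interior K'"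
    if T: "rectangle_mesh \<T> \<alpha> \<beta> \<gamma> \<delta>" and T': "rectangle_mesh \<T>' \<alpha> \<beta> \<gamma> \<delta>"
      and eq: "interior_l_edges \<T> = interior_l_edges \<T>'" and K: "K \<in> \<T>" for \<T> \<T>' K
  proof -
    interpret T: rectangle_mesh \<T> \<alpha> \<beta> \<gamma> \<delta> by (rule T)
    interpret T': rectangle_mesh \<T>' \<alpha> \<beta> \<gamma> \<delta> by (rule T')
    have "interior K \<subseteq> (\<Union>K\<in>\<T>. interior K)" using K by (rule UN_upper)
    then have cover: "interior K \<subseteq> \<Union>(interior ` \<T>')"
      by (simp only: T.Union_interior_cells T'.Union_interior_cells eq)
    have disj: "U \<inter> V = {}" if UV: "U \<in> interior ` \<T>'" "V \<in> interior ` \<T>'" "U \<noteq> V" for U V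
    proof -
      obtain A B where "A \<in> \<T>'" "U = interior A" "B \<in> \<T>'" "V = interior B" using UV(1,2) by blast
      then show ?thesis using T'.interior_cell_unique[of A B] UV(3) by (metis disjoint_iff)
    qed
    have op: "open U" if "U \<in> interior ` \<T>'" for U using that by (elim imageE) simp
    obtain U where "U \<in> interior ` \<T>'" "interior K \<subseteq> U"
      by (rule connected_in_one_open_set[OF T.cell_interior_connected[OF K]
            T.interior_nonempty[OF K] cover op disj])
    then show ?thesis by (metis imageE)
  qed
  have sub: "\<T> \<subseteq> \<T>'"
    if T: "rectangle_mesh \<T> \<alpha> \<beta> \<gamma> \<delta>" and T': "rectangle_mesh \<T>' \<alpha> \<beta> \<gamma> \<delta>"
      and eq: "interior_l_edges \<T> = interior_l_edges \<T>'" for \<T> \<T>'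
  proof
    interpret T: rectangle_mesh \<T> \<alpha> \<beta> \<gamma> \<delta> by (rule T)
    interpret T': rectangle_mesh \<T>' \<alpha> \<beta> \<gamma> \<delta> by (rule T')
    fix K assume K: "K \<in> \<T>"
    obtain K' where K': "K' \<in> \<T>'" "interior K \<subseteq> interior K'" using one[OF T T' eq K] by blast
    obtain K2 where K2: "K2 \<in> \<T>" "interior K' \<subseteq> interior K2"
      using one[OF T' T eq[symmetric] K'(1)] by blast
    obtain x where x: "x \<in> interior K" using T.interior_nonempty[OF K] by (meson ex_in_conv)
    then have "x \<in> interior K2" using K'(2) K2(2) by (meson subsetD)
    then have "K2 = K" using x by (intro T.interior_cell_unique[OF K2(1) K])
    then have "interior K = interior K'" using K'(2) K2(2) by (simp add: subset_antisym)
    then have "K = K'" using T.cell_eq_closure_interior[OF K] T'.cell_eq_closure_interior[OF K'(1)] by simp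
    then show "K \<in> \<T>'" using K' by simp
  qed
  show ?thesis using sub[OF T T' eq] sub[OF T' T eq[symmetric]] by blast
qed

section \<open>The example mesh\<close>

text \<open>
  The index quadruple \<open>(i, i', j, j')\<close> stands for the box \<open>[s i, s i'] \<times> [t j, t j']\<close>, which is a
  cell for \<open>i < i'\<close>, \<open>j < j'\<close> and a segment if one of the two index intervals is a point.
\<close>

definition grid_box :: "(nat \<Rightarrow> real) \<Rightarrow> (nat \<Rightarrow> real) \<Rightarrow> nat \<times> nat \<times> nat \<times> nat \<Rightarrow> (real \<times> real) set" where
  "grid_box s t = (\<lambda>(i, i', j, j'). {s i..s i'} \<times> {t j..t j'})"

definition grid_point :: "(nat \<Rightarrow> real) \<Rightarrow> (nat \<Rightarrow> real) \<Rightarrow> nat \<times> nat \<Rightarrow> real \<times> real" where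
  "grid_point s t = (\<lambda>(i, j). (s i, t j))"

definition cell_indices :: "(nat \<times> nat \<times> nat \<times> nat) list" where
  "cell_indices =
    [(1,2,1,2), (2,3,1,2), (3,7,1,2), (7,8,1,2),
     (1,2,2,3), (2,3,2,3), (3,5,2,3), (5,6,2,3), (6,7,2,3), (7,8,2,3),
     (1,2,3,6), (2,3,3,5), (2,3,5,6),
     (3,4,3,4), (3,4,4,5), (3,4,5,6), (4,5,3,4), (4,5,4,5), (4,5,5,6), (5,6,3,4), (5,6,4,5), (5,6,5,6),
     (6,7,3,4), (6,7,4,6), (7,8,3,6),
     (1,2,6,7), (2,3,6,7), (3,4,6,7), (4,6,6,7), (6,7,6,7), (7,8,6,7),
     (1,2,7,8), (2,3,7,8), (3,7,7,8), (7,8,7,8)]"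

text \<open>The part of the grid line \<open>x = s i\<close>, respectively \<open>y = t j\<close>, that belongs to the mesh.\<close>

definition vspan :: "nat \<Rightarrow> nat \<times> nat" where
  "vspan i = (if i = 4 then (3, 7) else if i = 5 then (2, 6) else if i = 6 then (2, 7) else (1, 8))"

definition hspan :: "nat \<Rightarrow> nat \<times> nat" where
  "hspan j = (if j = 4 then (3, 7) else if j = 5 then (2, 6) else (1, 8))"

definition vline :: "nat \<Rightarrow> nat \<times> nat \<times> nat \<times> nat" where
  "vline i = (i, i, fst (vspan i), snd (vspan i))"

definition hline :: "nat \<Rightarrow> nat \<times> nat \<times> nat \<times> nat" where
  "hline j = (fst (hspan j), snd (hspan j), j, j)"

definition vertex_indices :: "(nat \<times> nat) list" where
  "vertex_indices =
    [(1,1), (1,2), (1,3), (1,6), (1,7), (1,8),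
     (2,1), (2,2), (2,3), (2,5), (2,6), (2,7), (2,8),
     (3,1), (3,2), (3,3), (3,4), (3,5), (3,6), (3,7), (3,8),
     (4,3), (4,4), (4,5), (4,6), (4,7),
     (5,2), (5,3), (5,4), (5,5), (5,6),
     (6,2), (6,3), (6,4), (6,5), (6,6), (6,7),
     (7,1), (7,2), (7,3), (7,4), (7,6), (7,7), (7,8),
     (8,1), (8,2), (8,3), (8,6), (8,7), (8,8)]"

definition example_cells :: "(nat \<Rightarrow> real) \<Rightarrow> (nat \<Rightarrow> real) \<Rightarrow> (real \<times> real) set set" where
  "example_cells s t = grid_box s t ` set cell_indices"

lemma cell_indices_bounds:
  "\<forall>(i, i', j, j')\<in>set cell_indices. 1 \<le> i \<and> i < i' \<and> i' \<le> 8 \<and> 1 \<le> j \<and> j < j' \<and> j' \<le> 8"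
  unfolding cell_indices_def by simp

lemma cell_indices_separated:
  "\<forall>(i, i', j, j')\<in>set cell_indices. \<forall>(k, k', l, l')\<in>set cell_indices.
     (i, i', j, j') = (k, k', l, l') \<or> i' \<le> k \<or> k' \<le> i \<or> j' \<le> l \<or> l' \<le> j"
  unfolding cell_indices_def by simp

lemma unit_square_in_cell:
  "\<forall>i\<in>{1..<8}. \<forall>j\<in>{1..<8}. \<exists>(k, k', l, l')\<in>set cell_indices. k \<le> i \<and> Suc i \<le> k' \<and> l \<le> j \<and> Suc j \<le> l'"
  by code_simp

lemma cell_sides_in_lines:
  "\<forall>(i, i', j, j')\<in>set cell_indices.
     (\<forall>k\<in>{i, i'}. fst (vspan k) \<le> j \<and> j' \<le> snd (vspan k)) \<and>
     (\<forall>l\<in>{j, j'}. fst (hspan l) \<le> i \<and> i' \<le> snd (hspan l))"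
  unfolding cell_indices_def by (simp add: vspan_def hspan_def)

lemma line_pieces_are_cell_sides:
  "\<forall>i\<in>{1..8}. \<forall>j\<in>{fst (vspan i)..<snd (vspan i)}. \<exists>(k, k', l, l')\<in>set cell_indices.
     (i = k \<or> i = k') \<and> l \<le> j \<and> Suc j \<le> l'"
  "\<forall>j\<in>{1..8}. \<forall>i\<in>{fst (hspan j)..<snd (hspan j)}. \<exists>(k, k', l, l')\<in>set cell_indices.
     (j = l \<or> j = l') \<and> k \<le> i \<and> Suc i \<le> k'"
  by code_simp+

lemma span_bounds:
  "1 \<le> fst (vspan i)" "fst (vspan i) < snd (vspan i)" "snd (vspan i) \<le> 8"
  "1 \<le> fst (hspan j)" "fst (hspan j) < snd (hspan j)" "snd (hspan j) \<le> 8"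
  by (auto simp: vspan_def hspan_def)

lemma vertex_indices_eq_corners:
  "set vertex_indices = (\<Union>(i, i', j, j')\<in>set cell_indices. {i, i'} \<times> {j, j'})"
  unfolding cell_indices_def vertex_indices_def by auto

lemma line_ends_are_vertices:
  "i \<in> {1..8} \<Longrightarrow> (i, fst (vspan i)) \<in> set vertex_indices \<and> (i, snd (vspan i)) \<in> set vertex_indices"
  "j \<in> {1..8} \<Longrightarrow> (fst (hspan j), j) \<in> set vertex_indices \<and> (snd (hspan j), j) \<in> set vertex_indices"
  unfolding atLeastAtMost_iff vertex_indices_def vspan_def hspan_def
  by auto

lemma vertex_indices_bounds: "set vertex_indices \<subseteq> {1..8} \<times> {1..8}"
  unfolding vertex_indices_def by simp

lemma distinct_vertex_indices: "distinct vertex_indices"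
  unfolding vertex_indices_def by simp

lemma between_grid_values:
  fixes f :: "nat \<Rightarrow> real"
  assumes "a < b" "f a \<le> x" "x \<le> f b"
  obtains i where "a \<le> i" "i < b" "f i \<le> x" "x \<le> f (Suc i)"
proof -
  have "\<exists>i. a \<le> i \<and> i < b \<and> f i \<le> x \<and> x \<le> f (Suc i)"
    using assms
  proof (induction b)
    case (Suc b)
    show ?case
    proof (cases "a < b \<and> x \<le> f b")
      case True
      then show ?thesis using Suc by (metis less_Suc_eq)
    next
      case False
      then have "f b \<le> x" using Suc.prems by (metis less_Suc_eq linear)
      then show ?thesis using Suc.prems False by (intro exI[of _ b]) auto
    qed
  qed simp
  then show thesis using that by blast
qed

lemma interval_covered_off_finite:
  fixes y1 y2 :: real
  assumes "y1 < y2" "finite F" and *: "\<And>y. y1 < y \<Longrightarrow> y < y2 \<Longrightarrow> y \<notin> F \<Longrightarrow> lo \<le> y \<and> y \<le> hi"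
  shows "{y1..y2} \<subseteq> {lo..hi}"
proof -
  have ex: "\<exists>y\<in>{a<..<b}. y \<notin> F" if "a < b" for a b
    using assms(2) infinite_Ioo[OF that] by (meson finite_subset subsetI)
  have "lo \<le> y1"
  proof (rule ccontr)
    assume "\<not> lo \<le> y1"
    then obtain y where "y \<in> {y1<..<min y2 lo}" "y \<notin> F" using ex[of y1 "min y2 lo"] assms(1) by auto
    then show False using *[of y] by auto
  qed
  moreover have "y2 \<le> hi"
  proof (rule ccontr)
    assume "\<not> y2 \<le> hi"
    then obtain y where "y \<in> {max y1 hi<..<y2}" "y \<notin> F" using ex[of "max y1 hi" y2] assms(1) by auto
    then show False using *[of y] by auto
  qed
  ultimately show ?thesis by auto
qed

locale grid =
  fixes s t :: "nat \<Rightarrow> real"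
  assumes admissible: "admissible s t"
begin

lemma s_less: "i \<in> {1..8} \<Longrightarrow> j \<in> {1..8} \<Longrightarrow> s i < s j \<longleftrightarrow> i < j"
  and t_less: "i \<in> {1..8} \<Longrightarrow> j \<in> {1..8} \<Longrightarrow> t i < t j \<longleftrightarrow> i < j"
  and s_le: "i \<in> {1..8} \<Longrightarrow> j \<in> {1..8} \<Longrightarrow> s i \<le> s j \<longleftrightarrow> i \<le> j"
  and t_le: "i \<in> {1..8} \<Longrightarrow> j \<in> {1..8} \<Longrightarrow> t i \<le> t j \<longleftrightarrow> i \<le> j"
  and s_eq: "i \<in> {1..8} \<Longrightarrow> j \<in> {1..8} \<Longrightarrow> s i = s j \<longleftrightarrow> i = j"
  and t_eq: "i \<in> {1..8} \<Longrightarrow> j \<in> {1..8} \<Longrightarrow> t i = t j \<longleftrightarrow> i = j"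
  using admissible strict_mono_on_less[of "{1..8}" s] strict_mono_on_less[of "{1..8}" t]
    strict_mono_on_less_eq[of "{1..8}" s] strict_mono_on_less_eq[of "{1..8}" t]
    strict_mono_on_eq[of "{1..8}" s] strict_mono_on_eq[of "{1..8}" t]
  by (auto simp: admissible_def)

abbreviation "\<Omega> \<equiv> {s 1..s 8} \<times> {t 1..t 8}"

lemma inj_grid_point: "inj_on (grid_point s t) ({1..8} \<times> {1..8})"
  using s_eq t_eq by (auto intro!: inj_onI simp: grid_point_def)

lemma cell_cases:
  assumes "K \<in> example_cells s t"
  obtains i i' j j' where "(i, i', j, j') \<in> set cell_indices" "K = {s i..s i'} \<times> {t j..t j'}"
    "1 \<le> i" "i < i'" "i' \<le> 8" "1 \<le> j" "j < j'" "j' \<le> 8" "s i < s i'" "t j < t j'"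
proof -
  obtain i i' j j' where c: "(i, i', j, j') \<in> set cell_indices" "K = {s i..s i'} \<times> {t j..t j'}"
    using assms unfolding example_cells_def grid_box_def by auto
  have "1 \<le> i" "i < i'" "i' \<le> 8" "1 \<le> j" "j < j'" "j' \<le> 8"
    using cell_indices_bounds c(1) by fastforce+
  then show thesis using c s_less[of i i'] t_less[of j j'] by (intro that) auto
qed

lemma point_in_unit_square:
  assumes "(x, y) \<in> \<Omega>"
  obtains i j where "i \<in> {1..<8}" "j \<in> {1..<8}" "x \<in> {s i..s (Suc i)}" "y \<in> {t j..t (Suc j)}"
proof -
  have "s 1 \<le> x" "x \<le> s 8" "t 1 \<le> y" "y \<le> t 8" using assms by auto
  then obtain i j where "1 \<le> i" "i < 8" "s i \<le> x" "x \<le> s (Suc i)" "1 \<le> j" "j < 8" "t j \<le> y" "y \<le> t (Suc j)"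
    using between_grid_values[of 1 8 s x] between_grid_values[of 1 8 t y]
    by (metis one_less_numeral_iff semiring_norm(76))
  then show thesis by (intro that) auto
qed

lemma unit_square_subset_cell:
  assumes "i \<in> {1..<8}" "j \<in> {1..<8}"
  obtains K where "K \<in> example_cells s t" "{s i..s (Suc i)} \<times> {t j..t (Suc j)} \<subseteq> K"
proof -
  obtain k k' l l' where c: "(k, k', l, l') \<in> set cell_indices" "k \<le> i" "Suc i \<le> k'" "l \<le> j" "Suc j \<le> l'"
    using unit_square_in_cell assms by fastforce
  have b: "1 \<le> k" "k' \<le> 8" "1 \<le> l" "l' \<le> 8"
    using cell_indices_bounds c(1) by fastforce+
  have "s k \<le> s i" "s (Suc i) \<le> s k'" "t l \<le> t j" "t (Suc j) \<le> t l'"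
    using b c(2-) assms s_le[of k i] s_le[of "Suc i" k'] t_le[of l j] t_le[of "Suc j" l'] by auto
  then have "{s i..s (Suc i)} \<times> {t j..t (Suc j)} \<subseteq> {s k..s k'} \<times> {t l..t l'}" by auto
  moreover have "{s k..s k'} \<times> {t l..t l'} \<in> example_cells s t"
    using c(1) unfolding example_cells_def grid_box_def by force
  ultimately show thesis using that by blast
qed

lemma Union_example_cells: "\<Union>(example_cells s t) = \<Omega>"
proof (rule subset_antisym)
  show "\<Union>(example_cells s t) \<subseteq> \<Omega>"
  proof (rule Union_least)
    fix K assume "K \<in> example_cells s t"
    then obtain i i' j j' where c: "K = {s i..s i'} \<times> {t j..t j'}"
        "1 \<le> i" "i < i'" "i' \<le> 8" "1 \<le> j" "j < j'" "j' \<le> 8"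
      by (rule cell_cases)
    then have "s 1 \<le> s i" "s i' \<le> s 8" "t 1 \<le> t j" "t j' \<le> t 8"
      using s_le[of 1 i] s_le[of i' 8] t_le[of 1 j] t_le[of j' 8] by auto
    then show "K \<subseteq> \<Omega>" unfolding c(1) by auto
  qed
  show "\<Omega> \<subseteq> \<Union>(example_cells s t)"
  proof (rule subrelI)
    fix x y assume "(x, y) \<in> \<Omega>"
    then obtain i j where ij: "i \<in> {1..<8}" "j \<in> {1..<8}" "x \<in> {s i..s (Suc i)}" "y \<in> {t j..t (Suc j)}"
      by (rule point_in_unit_square)
    obtain K where K: "K \<in> example_cells s t" "{s i..s (Suc i)} \<times> {t j..t (Suc j)} \<subseteq> K"
      using unit_square_subset_cell[OF ij(1,2)] .
    then have "(x, y) \<in> K" using ij(3,4) by blast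
    then show "(x, y) \<in> \<Union>(example_cells s t)" using K(1) by blast
  qed
qed

sublocale mesh: rectangle_mesh "example_cells s t" "s 1" "s 8" "t 1" "t 8"
proof
  show "example_cells s t division_of \<Omega>"
  proof (rule division_ofI)
    show "finite (example_cells s t)" by (simp add: example_cells_def)
    show "\<Union>(example_cells s t) = \<Omega>" by (rule Union_example_cells)
    fix K assume K: "K \<in> example_cells s t"
    show "K \<subseteq> \<Omega>" using K Union_example_cells by blast
    obtain i i' j j' where c: "(i, i', j, j') \<in> set cell_indices" "K = {s i..s i'} \<times> {t j..t j'}"
        "1 \<le> i" "i < i'" "i' \<le> 8" "1 \<le> j" "j < j'" "j' \<le> 8" "s i < s i'" "t j < t j'"
      using K by (rule cell_cases)
    show "K \<noteq> {}" unfolding c(2) using c(9,10) by simp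
    show "\<exists>a b. K = cbox a b"
      unfolding c(2) by (rule exI[of _ "(s i, t j)"], rule exI[of _ "(s i', t j')"]) (simp add: cbox_Pair_eq)
    fix K' assume K': "K' \<in> example_cells s t" "K \<noteq> K'"
    obtain k k' l l' where c': "(k, k', l, l') \<in> set cell_indices" "K' = {s k..s k'} \<times> {t l..t l'}"
        "1 \<le> k" "k < k'" "k' \<le> 8" "1 \<le> l" "l < l'" "l' \<le> 8" "s k < s k'" "t l < t l'"
      using K'(1) by (rule cell_cases)
    have "(i, i', j, j') = (k, k', l, l') \<or> i' \<le> k \<or> k' \<le> i \<or> j' \<le> l \<or> l' \<le> j"
      using cell_indices_separated c(1) c'(1) by fast
    then have "i' \<le> k \<or> k' \<le> i \<or> j' \<le> l \<or> l' \<le> j" using c(2) c'(2) K'(2) by blast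
    then have "s i' \<le> s k \<or> s k' \<le> s i \<or> t j' \<le> t l \<or> t l' \<le> t j"
      using c c' s_le[of i' k] s_le[of k' i] t_le[of j' l] t_le[of l' j] by auto
    then show "interior K \<inter> interior K' = {}"
      unfolding c(2) c'(2) interior_rectangle by auto
  qed
  fix K assume "K \<in> example_cells s t"
  then obtain i i' j j' where "K = {s i..s i'} \<times> {t j..t j'}" "s i < s i'" "t j < t j'"
    by (rule cell_cases)
  then show "interior K \<noteq> {}" by (simp add: interior_rectangle)
qed

lemma vertices_example: "vertices (example_cells s t) = grid_point s t ` set vertex_indices"
proof -
  have ext: "{v. v extreme_point_of grid_box s t c}
      = grid_point s t ` (case c of (i, i', j, j') \<Rightarrow> {i, i'} \<times> {j, j'})" if c: "c \<in> set cell_indices" for c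
  proof -
    obtain i i' j j' where ijj: "c = (i, i', j, j')" by (metis surj_pair)
    then have "s i \<le> s i'" "t j \<le> t j'"
      using c cell_indices_bounds s_le[of i i'] t_le[of j j'] by fastforce+
    then show ?thesis
      unfolding ijj grid_box_def by (auto simp: extreme_point_rectangle grid_point_def)
  qed
  have "vertices (example_cells s t) = (\<Union>c\<in>set cell_indices. {v. v extreme_point_of grid_box s t c})"
    unfolding vertices_def example_cells_def by simp
  also have "\<dots> = (\<Union>c\<in>set cell_indices. grid_point s t ` (case c of (i, i', j, j') \<Rightarrow> {i, i'} \<times> {j, j'}))"
    using ext by (rule SUP_cong[OF refl])
  also have "\<dots> = grid_point s t ` set vertex_indices"
    unfolding vertex_indices_eq_corners image_UN ..
  finally show ?thesis .
qed

lemma grid_box_vline: "grid_box s t (vline i) = {s i} \<times> {t (fst (vspan i))..t (snd (vspan i))}"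
  by (simp add: grid_box_def vline_def case_prod_beta)

lemma grid_box_hline: "grid_box s t (hline j) = {s (fst (hspan j))..s (snd (hspan j))} \<times> {t j}"
  by (simp add: grid_box_def hline_def case_prod_beta)

lemma skeleton_example:
  "skeleton (example_cells s t) = (\<Union>i\<in>{1..8}. grid_box s t (vline i)) \<union> (\<Union>j\<in>{1..8}. grid_box s t (hline j))"
proof (intro subset_antisym subrelI)
  fix x y assume "(x, y) \<in> skeleton (example_cells s t)"
  then obtain K where K: "K \<in> example_cells s t" "(x, y) \<in> frontier K" by (auto simp: skeleton_def)
  obtain i i' j j' where c: "(i, i', j, j') \<in> set cell_indices" "K = {s i..s i'} \<times> {t j..t j'}"
      "1 \<le> i" "i < i'" "i' \<le> 8" "1 \<le> j" "j < j'" "j' \<le> 8" "s i < s i'" "t j < t j'"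
    using K(1) by (rule cell_cases)
  have xy: "s i \<le> x" "x \<le> s i'" "t j \<le> y" "y \<le> t j'" and side: "x = s i \<or> x = s i' \<or> y = t j \<or> y = t j'"
    using K(2) unfolding c(2) frontier_rectangle by auto
  have v: "(x, y) \<in> (\<Union>i\<in>{1..8}. grid_box s t (vline i))" if k: "k \<in> {i, i'}" "x = s k" for k
  proof -
    have "fst (vspan k) \<le> j" "j' \<le> snd (vspan k)" using cell_sides_in_lines c(1) k(1) by fastforce+
    then have "t (fst (vspan k)) \<le> t j" "t j' \<le> t (snd (vspan k))"
      using span_bounds(1-3)[of k] c t_le[of "fst (vspan k)" j] t_le[of j' "snd (vspan k)"] by auto
    then have "(x, y) \<in> grid_box s t (vline k)" unfolding grid_box_vline using k(2) xy by auto
    moreover have "k \<in> {1..8}" using k(1) c by auto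
    ultimately show ?thesis by blast
  qed
  have h: "(x, y) \<in> (\<Union>j\<in>{1..8}. grid_box s t (hline j))" if k: "k \<in> {j, j'}" "y = t k" for k
  proof -
    have "fst (hspan k) \<le> i" "i' \<le> snd (hspan k)" using cell_sides_in_lines c(1) k(1) by fastforce+
    then have "s (fst (hspan k)) \<le> s i" "s i' \<le> s (snd (hspan k))"
      using span_bounds(4-6)[of k] c s_le[of "fst (hspan k)" i] s_le[of i' "snd (hspan k)"] by auto
    then have "(x, y) \<in> grid_box s t (hline k)" unfolding grid_box_hline using k(2) xy by auto
    moreover have "k \<in> {1..8}" using k(1) c by auto
    ultimately show ?thesis by blast
  qed
  show "(x, y) \<in> (\<Union>i\<in>{1..8}. grid_box s t (vline i)) \<union> (\<Union>j\<in>{1..8}. grid_box s t (hline j))"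
    using side v h by blast
next
  fix x y
  assume "(x, y) \<in> (\<Union>i\<in>{1..8}. grid_box s t (vline i)) \<union> (\<Union>j\<in>{1..8}. grid_box s t (hline j))"
  then consider i where "i \<in> {1..8}" "(x, y) \<in> grid_box s t (vline i)"
    | j where "j \<in> {1..8}" "(x, y) \<in> grid_box s t (hline j)" by blast
  then show "(x, y) \<in> skeleton (example_cells s t)"
  proof cases
    case 1
    then have x: "x = s i" and "t (fst (vspan i)) \<le> y" "y \<le> t (snd (vspan i))"
      unfolding grid_box_vline by auto
    then obtain j where j: "fst (vspan i) \<le> j" "j < snd (vspan i)" "t j \<le> y" "y \<le> t (Suc j)"
      using between_grid_values[of "fst (vspan i)" "snd (vspan i)" t y] span_bounds(2) by metis
    from j(1,2) have "j \<in> {fst (vspan i)..<snd (vspan i)}" by simp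
    from bspec[OF bspec[OF line_pieces_are_cell_sides(1) 1(1)] this]
    obtain k k' l l' where c: "(k, k', l, l') \<in> set cell_indices" "i = k \<or> i = k'" "l \<le> j" "Suc j \<le> l'"
      by blast
    have b: "1 \<le> k" "k < k'" "k' \<le> 8" "1 \<le> l" "l < l'" "l' \<le> 8"
      using cell_indices_bounds c(1) by fastforce+
    have le: "t l \<le> y" "y \<le> t l'"
      using t_le[of l j] t_le[of "Suc j" l'] b c(3,4) j(3,4) by auto
    have "s k < s k'" using s_less[of k k'] b by auto
    then have "(x, y) \<in> frontier (grid_box s t (k, k', l, l'))"
      using x c(2) le unfolding grid_box_def by (auto simp: frontier_rectangle)
    then show ?thesis using c(1) unfolding skeleton_def example_cells_def by blast
  next
    case 2
    then have y: "y = t j" and "s (fst (hspan j)) \<le> x" "x \<le> s (snd (hspan j))"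
      unfolding grid_box_hline by auto
    then obtain i where i: "fst (hspan j) \<le> i" "i < snd (hspan j)" "s i \<le> x" "x \<le> s (Suc i)"
      using between_grid_values[of "fst (hspan j)" "snd (hspan j)" s x] span_bounds(5) by metis
    from i(1,2) have "i \<in> {fst (hspan j)..<snd (hspan j)}" by simp
    from bspec[OF bspec[OF line_pieces_are_cell_sides(2) 2(1)] this]
    obtain k k' l l' where c: "(k, k', l, l') \<in> set cell_indices" "j = l \<or> j = l'" "k \<le> i" "Suc i \<le> k'"
      by blast
    have b: "1 \<le> k" "k < k'" "k' \<le> 8" "1 \<le> l" "l < l'" "l' \<le> 8"
      using cell_indices_bounds c(1) by fastforce+
    have le: "s k \<le> x" "x \<le> s k'"
      using s_le[of k i] s_le[of "Suc i" k'] b c(3,4) i(3,4) by auto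
    have "t l < t l'" using t_less[of l l'] b by auto
    then have "(x, y) \<in> frontier (grid_box s t (k, k', l, l'))"
      using y c(2) le unfolding grid_box_def by (auto simp: frontier_rectangle)
    then show ?thesis using c(1) unfolding skeleton_def example_cells_def by blast
  qed
qed

end

definition line_indices :: "(nat \<times> nat \<times> nat \<times> nat) set" where
  "line_indices = vline ` {2..7} \<union> hline ` {2..7}"

context rectangle_mesh begin

lemma edge_midpoint:
  assumes "E \<in> mesh_edges \<T>"
  obtains p q where "E = closed_segment p q" "axis_parallel p q" "midpoint p q \<in> E"
  using assms unfolding mesh_edges_def by (auto intro: that)

lemma vertical_edge_interior:
  assumes "E \<in> mesh_edges \<T>" "E \<subseteq> {x} \<times> {\<gamma>..\<delta>}" "\<alpha> < x" "x < \<beta>"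
  shows "E \<in> interior_edges \<T>"
proof -
  obtain p q where pq: "E = closed_segment p q" "axis_parallel p q" "midpoint p q \<in> E"
    using edge_midpoint[OF assms(1)] .
  obtain y y' where y: "p = (x, y)" "q = (x, y')" "y \<in> {\<gamma>..\<delta>}" "y' \<in> {\<gamma>..\<delta>}"
  proof -
    have "p \<in> {x} \<times> {\<gamma>..\<delta>}" "q \<in> {x} \<times> {\<gamma>..\<delta>}"
      by (rule set_mp[OF assms(2)], simp add: pq(1))+
    then show thesis using that by (auto simp only: mem_Sigma_iff singleton_iff elim!: SigmaE)
  qed
  then have "y \<noteq> y'" using pq(2) by (auto simp: axis_parallel_def)
  then have "midpoint p q \<in> interior \<Phi>"
    using y assms(3,4) unfolding interior_rectangle y by (auto simp: midpoint_def)
  then have "midpoint p q \<notin> frontier (\<Union>\<T>)" by (simp add: frontier_def Union_cells)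
  then show ?thesis using pq(3) assms(1) by (auto simp: interior_edges_def)
qed

lemma horizontal_edge_interior:
  assumes "E \<in> mesh_edges \<T>" "E \<subseteq> {\<alpha>..\<beta>} \<times> {y}" "\<gamma> < y" "y < \<delta>"
  shows "E \<in> interior_edges \<T>"
proof -
  obtain p q where pq: "E = closed_segment p q" "axis_parallel p q" "midpoint p q \<in> E"
    using edge_midpoint[OF assms(1)] .
  obtain x x' where x: "p = (x, y)" "q = (x', y)" "x \<in> {\<alpha>..\<beta>}" "x' \<in> {\<alpha>..\<beta>}"
  proof -
    have "p \<in> {\<alpha>..\<beta>} \<times> {y}" "q \<in> {\<alpha>..\<beta>} \<times> {y}"
      by (rule set_mp[OF assms(2)], simp add: pq(1))+
    then show thesis using that by (auto simp only: mem_Sigma_iff singleton_iff elim!: SigmaE)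
  qed
  then have "x \<noteq> x'" using pq(2) by (auto simp: axis_parallel_def)
  then have "midpoint p q \<in> interior \<Phi>"
    using x assms(3,4) unfolding interior_rectangle x by (auto simp: midpoint_def)
  then have "midpoint p q \<notin> frontier (\<Union>\<T>)" by (simp add: frontier_def Union_cells)
  then show ?thesis using pq(3) assms(1) by (auto simp: interior_edges_def)
qed

lemma interior_chain_meets_interior:
  assumes "C \<in> interior_chains \<T>"
  obtains x where "x \<in> C" "x \<in> interior \<Phi>"
proof -
  obtain p q E where C: "C = closed_segment p q" "C = \<Union>E" "E \<subseteq> interior_edges \<T>"
    using assms unfolding interior_chains_def by blast
  have "p \<in> \<Union>E" using C(1,2) by auto
  then obtain F where F: "F \<in> E" by blast
  then have "F \<in> interior_edges \<T>" using C(3) by (rule set_mp[rotated])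
  then have "\<not> F \<subseteq> frontier \<Phi>" by (simp add: interior_edges_def Union_cells)
  then obtain x where x: "x \<in> F" "x \<notin> frontier \<Phi>" by (meson subsetI)
  have xC: "x \<in> C" using C(2) F x(1) by (metis UnionI)
  then have "x \<in> \<Phi>" using interior_chain_subset_skeleton[OF assms] skeleton_subset by (meson subsetD)
  then have "x \<in> closure \<Phi>" by (rule set_mp[OF closure_subset])
  then have "x \<in> interior \<Phi>" using x(2) unfolding frontier_def by (metis DiffI)
  with xC show thesis by (rule that)
qed

end

context grid begin

lemma vline_segment:
  assumes "i \<in> {1..8}"
  shows "grid_box s t (vline i) = closed_segment (s i, t (fst (vspan i))) (s i, t (snd (vspan i)))"
  using span_bounds(1-3)[of i] t_le[of "fst (vspan i)" "snd (vspan i)"]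
  by (simp add: grid_box_vline closed_segment_same_fst closed_segment_eq_real_ivl)

lemma hline_segment:
  assumes "j \<in> {1..8}"
  shows "grid_box s t (hline j) = closed_segment (s (fst (hspan j)), t j) (s (snd (hspan j)), t j)"
  using span_bounds(4-6)[of j] s_le[of "fst (hspan j)" "snd (hspan j)"]
  by (simp add: grid_box_hline closed_segment_same_snd closed_segment_eq_real_ivl)

lemma index_vertex: "(i, j) \<in> set vertex_indices \<Longrightarrow> (s i, t j) \<in> vertices (example_cells s t)"
  unfolding vertices_example grid_point_def by (rule image_eqI[of _ _ "(i, j)"]) simp_all

lemma vline_interior_chain:
  assumes i: "i \<in> {2..7}"
  shows "grid_box s t (vline i) \<in> interior_chains (example_cells s t)"
proof -
  let ?p = "(s i, t (fst (vspan i)))" and ?q = "(s i, t (snd (vspan i)))"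
  have i': "i \<in> {1..8}" using i by auto
  have v: "?p \<in> vertices (example_cells s t)" "?q \<in> vertices (example_cells s t)"
    using line_ends_are_vertices(1)[OF i'] by (simp_all add: index_vertex)
  have par: "axis_parallel ?p ?q"
    using span_bounds(1-3)[of i] t_eq[of "fst (vspan i)" "snd (vspan i)"] by (auto simp: axis_parallel_def)
  have "grid_box s t (vline i) \<subseteq> skeleton (example_cells s t)"
    unfolding skeleton_example using i' by (intro le_supI1 UN_upper)
  then obtain E where E: "E \<subseteq> mesh_edges (example_cells s t)" "grid_box s t (vline i) = \<Union>E"
    using mesh.segment_is_union_of_edges[OF v par] unfolding vline_segment[OF i'] by blast
  have "t 1 \<le> t (fst (vspan i))" "t (snd (vspan i)) \<le> t 8"
    using span_bounds(1-3)[of i] t_le[of 1 "fst (vspan i)"] t_le[of "snd (vspan i)" 8] by auto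
  then have "grid_box s t (vline i) \<subseteq> {s i} \<times> {t 1..t 8}" unfolding grid_box_vline by auto
  then have "F \<subseteq> {s i} \<times> {t 1..t 8}" if "F \<in> E" for F using E(2) that by (metis Union_upper order_trans)
  moreover have "s 1 < s i" "s i < s 8" using i s_less[of 1 i] s_less[of i 8] by auto
  ultimately have "E \<subseteq> interior_edges (example_cells s t)"
    using E(1) mesh.vertical_edge_interior by (meson subsetD subsetI)
  then show ?thesis
    unfolding interior_chains_def mem_Collect_eq using vline_segment[OF i'] par E(2) by metis
qed

lemma hline_interior_chain:
  assumes j: "j \<in> {2..7}"
  shows "grid_box s t (hline j) \<in> interior_chains (example_cells s t)"
proof -
  let ?p = "(s (fst (hspan j)), t j)" and ?q = "(s (snd (hspan j)), t j)"
  have j': "j \<in> {1..8}" using j by auto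
  have v: "?p \<in> vertices (example_cells s t)" "?q \<in> vertices (example_cells s t)"
    using line_ends_are_vertices(2)[OF j'] by (simp_all add: index_vertex)
  have par: "axis_parallel ?p ?q"
    using span_bounds(4-6)[of j] s_eq[of "fst (hspan j)" "snd (hspan j)"] by (auto simp: axis_parallel_def)
  have "grid_box s t (hline j) \<subseteq> skeleton (example_cells s t)"
    unfolding skeleton_example using j' by (intro le_supI2 UN_upper)
  then obtain E where E: "E \<subseteq> mesh_edges (example_cells s t)" "grid_box s t (hline j) = \<Union>E"
    using mesh.segment_is_union_of_edges[OF v par] unfolding hline_segment[OF j'] by blast
  have "s 1 \<le> s (fst (hspan j))" "s (snd (hspan j)) \<le> s 8"
    using span_bounds(4-6)[of j] s_le[of 1 "fst (hspan j)"] s_le[of "snd (hspan j)" 8] by auto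
  then have "grid_box s t (hline j) \<subseteq> {s 1..s 8} \<times> {t j}" unfolding grid_box_hline by auto
  then have "F \<subseteq> {s 1..s 8} \<times> {t j}" if "F \<in> E" for F using E(2) that by (metis Union_upper order_trans)
  moreover have "t 1 < t j" "t j < t 8" using j t_less[of 1 j] t_less[of j 8] by auto
  ultimately have "E \<subseteq> interior_edges (example_cells s t)"
    using E(1) mesh.horizontal_edge_interior by (meson subsetD subsetI)
  then show ?thesis
    unfolding interior_chains_def mem_Collect_eq using hline_segment[OF j'] par E(2) by metis
qed

lemma skeleton_example_iff:
  "(x, y) \<in> skeleton (example_cells s t) \<longleftrightarrow>
     (\<exists>i\<in>{1..8}. x = s i \<and> t (fst (vspan i)) \<le> y \<and> y \<le> t (snd (vspan i))) \<or>
     (\<exists>j\<in>{1..8}. y = t j \<and> s (fst (hspan j)) \<le> x \<and> x \<le> s (snd (hspan j)))"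
  unfolding skeleton_example grid_box_vline grid_box_hline by auto

text \<open>
  Off the finitely many grid points, a vertical segment of the skeleton only meets vertical lines;
  so it runs inside a single one.
\<close>

lemma interior_chain_in_line:
  assumes C: "C \<in> interior_chains (example_cells s t)"
  shows "\<exists>e\<in>line_indices. C \<subseteq> grid_box s t e"
proof -
  obtain p q where pq: "C = closed_segment p q" "axis_parallel p q"
    using C unfolding interior_chains_def by blast
  obtain x y x' y' where xy: "p = (x, y)" "q = (x', y')" by (metis surj_pair)
  have skel: "(a, b) \<in> skeleton (example_cells s t)" if "(a, b) \<in> C" for a b
    using that mesh.interior_chain_subset_skeleton[OF C] by (rule set_mp[rotated])
  obtain a b where ab: "(a, b) \<in> C" "(a, b) \<in> interior \<Omega>"
    using mesh.interior_chain_meets_interior[OF C] by (metis surj_pair)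
  show ?thesis
  proof (cases "x = x'")
    case True
    define y1 y2 where "y1 = min y y'" and "y2 = max y y'"
    have y12: "y1 < y2" using pq(2) True xy unfolding axis_parallel_def y1_def y2_def by auto
    have Ceq: "C = {x} \<times> {y1..y2}"
      unfolding pq(1) xy True y1_def y2_def
      by (auto simp: closed_segment_same_fst closed_segment_eq_real_ivl)
    have x18: "s 1 < x" "x < s 8" using ab unfolding Ceq interior_rectangle by auto
    have on: "\<exists>i\<in>{1..8}. x = s i \<and> t (fst (vspan i)) \<le> z \<and> z \<le> t (snd (vspan i))"
      if "y1 < z" "z < y2" "z \<notin> t ` {1..8}" for z
      using skel[of x z] that unfolding Ceq skeleton_example_iff by auto
    obtain z where "z \<in> {y1<..<y2}" "z \<notin> t ` {1..8}"
      using infinite_Ioo[OF y12] by (meson finite_atLeastAtMost finite_imageI finite_subset subsetI)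
    then obtain i where i: "i \<in> {1..8}" "x = s i" using on[of z] by auto
    have i27: "i \<in> {2..7}" using i x18 s_less[of 1 i] s_less[of i 8] by auto
    have "{y1..y2} \<subseteq> {t (fst (vspan i))..t (snd (vspan i))}"
    proof (rule interval_covered_off_finite[OF y12, of "t ` {1..8}"])
      fix z assume "y1 < z" "z < y2" "z \<notin> t ` {1..8}"
      then show "t (fst (vspan i)) \<le> z \<and> z \<le> t (snd (vspan i))"
        using on[of z] i s_eq[OF i(1)] by metis
    qed simp
    then have "C \<subseteq> grid_box s t (vline i)" unfolding Ceq grid_box_vline i(2) by auto
    then show ?thesis using i27 unfolding line_indices_def by blast
  next
    case False
    then have yy: "y = y'" using pq(2) xy unfolding axis_parallel_def by auto
    define x1 x2 where "x1 = min x x'" and "x2 = max x x'"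
    have x12: "x1 < x2" using False unfolding x1_def x2_def by auto
    have Ceq: "C = {x1..x2} \<times> {y}"
      unfolding pq(1) xy yy x1_def x2_def
      by (auto simp: closed_segment_same_snd closed_segment_eq_real_ivl)
    have y18: "t 1 < y" "y < t 8" using ab unfolding Ceq interior_rectangle by auto
    have on: "\<exists>j\<in>{1..8}. y = t j \<and> s (fst (hspan j)) \<le> z \<and> z \<le> s (snd (hspan j))"
      if "x1 < z" "z < x2" "z \<notin> s ` {1..8}" for z
      using skel[of z y] that unfolding Ceq skeleton_example_iff by auto
    obtain z where "z \<in> {x1<..<x2}" "z \<notin> s ` {1..8}"
      using infinite_Ioo[OF x12] by (meson finite_atLeastAtMost finite_imageI finite_subset subsetI)
    then obtain j where j: "j \<in> {1..8}" "y = t j" using on[of z] by auto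
    have j27: "j \<in> {2..7}" using j y18 t_less[of 1 j] t_less[of j 8] by auto
    have "{x1..x2} \<subseteq> {s (fst (hspan j))..s (snd (hspan j))}"
    proof (rule interval_covered_off_finite[OF x12, of "s ` {1..8}"])
      fix z assume "x1 < z" "z < x2" "z \<notin> s ` {1..8}"
      then show "s (fst (hspan j)) \<le> z \<and> z \<le> s (snd (hspan j))"
        using on[of z] j t_eq[OF j(1)] by metis
    qed simp
    then have "C \<subseteq> grid_box s t (hline j)" unfolding Ceq grid_box_hline j(2) by auto
    then show ?thesis using j27 unfolding line_indices_def by blast
  qed
qed

lemma line_not_nested:
  assumes "e \<in> line_indices" "e' \<in> line_indices" "grid_box s t e \<subseteq> grid_box s t e'"
  shows "e = e'"
proof -
  have tv: "t (fst (vspan i)) < t (snd (vspan i))" and sh: "s (fst (hspan i)) < s (snd (hspan i))" for i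
    using span_bounds[of i] span_bounds(4-6)[of i] t_less[of "fst (vspan i)" "snd (vspan i)"]
      s_less[of "fst (hspan i)" "snd (hspan i)"] by auto
  consider i i' where "e = vline i" "e' = vline i'" "i \<in> {2..7}" "i' \<in> {2..7}"
    | i j where "e = vline i" "e' = hline j"
    | j i where "e = hline j" "e' = vline i"
    | j j' where "e = hline j" "e' = hline j'" "j \<in> {2..7}" "j' \<in> {2..7}"
    using assms(1,2) unfolding line_indices_def by blast
  then show ?thesis
  proof cases
    case 1
    have "(s i, t (fst (vspan i))) \<in> grid_box s t e" using tv[of i] unfolding 1 grid_box_vline by auto
    then have "(s i, t (fst (vspan i))) \<in> grid_box s t e'" by (rule set_mp[OF assms(3)])
    then have "s i = s i'" unfolding 1 grid_box_vline by simp
    then show ?thesis using 1 s_eq[of i i'] by auto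
  next
    case 2
    have "(s i, t (fst (vspan i))) \<in> grid_box s t e" "(s i, t (snd (vspan i))) \<in> grid_box s t e"
      using tv[of i] unfolding 2 grid_box_vline by auto
    then have "t (fst (vspan i)) = t j" "t (snd (vspan i)) = t j"
      using assms(3) unfolding 2(2) grid_box_hline by (metis mem_Sigma_iff singletonD subsetD)+
    then show ?thesis using tv[of i] by simp
  next
    case 3
    have "(s (fst (hspan j)), t j) \<in> grid_box s t e" "(s (snd (hspan j)), t j) \<in> grid_box s t e"
      using sh[of j] unfolding 3 grid_box_hline by auto
    then have "s (fst (hspan j)) = s i" "s (snd (hspan j)) = s i"
      using assms(3) unfolding 3(2) grid_box_vline by (metis mem_Sigma_iff singletonD subsetD)+
    then show ?thesis using sh[of j] by simp
  next
    case 4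
    have "(s (fst (hspan j)), t j) \<in> grid_box s t e" using sh[of j] unfolding 4 grid_box_hline by auto
    then have "(s (fst (hspan j)), t j) \<in> grid_box s t e'" by (rule set_mp[OF assms(3)])
    then have "t j = t j'" unfolding 4 grid_box_hline by simp
    then show ?thesis using 4 t_eq[of j j'] by auto
  qed
qed

lemma interior_l_edges_example:
  "interior_l_edges (example_cells s t) = grid_box s t ` line_indices"
proof -
  have chain: "grid_box s t e \<in> interior_chains (example_cells s t)" if "e \<in> line_indices" for e
    using that vline_interior_chain hline_interior_chain unfolding line_indices_def by auto
  show ?thesis
    unfolding mesh.interior_l_edge_iff_maximal_chain
  proof (intro subset_antisym subsetI)
    fix L assume "L \<in> {L \<in> interior_chains (example_cells s t).
      \<forall>L'\<in>interior_chains (example_cells s t). L \<subseteq> L' \<longrightarrow> L' = L}"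
    then have L: "L \<in> interior_chains (example_cells s t)"
        "\<And>L'. L' \<in> interior_chains (example_cells s t) \<Longrightarrow> L \<subseteq> L' \<Longrightarrow> L' = L" by auto
    obtain e where e: "e \<in> line_indices" "L \<subseteq> grid_box s t e" using interior_chain_in_line[OF L(1)] by blast
    then have "grid_box s t e = L" using L(2) chain by simp
    then show "L \<in> grid_box s t ` line_indices" using e(1) by (intro image_eqI) simp_all
  next
    fix L assume "L \<in> grid_box s t ` line_indices"
    then obtain e where e: "e \<in> line_indices" "L = grid_box s t e" by blast
    have "L' = L" if L': "L' \<in> interior_chains (example_cells s t)" "L \<subseteq> L'" for L'
    proof -
      obtain e' where e': "e' \<in> line_indices" "L' \<subseteq> grid_box s t e'"
        using interior_chain_in_line[OF L'(1)] by blast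
      then have "e = e'" using line_not_nested[OF e(1) e'(1)] L'(2) e(2) by (metis order_trans)
      then show ?thesis using e' e(2) L'(2) by (metis subset_antisym)
    qed
    then show "L \<in> {L \<in> interior_chains (example_cells s t).
      \<forall>L'\<in>interior_chains (example_cells s t). L \<subseteq> L' \<longrightarrow> L' = L}"
      using chain[OF e(1)] e(2) by simp
  qed
qed

lemma line_indices_eq:
  "line_indices = {(2,2,1,8), (3,3,1,8), (7,7,1,8), (1,8,2,2), (1,8,3,3), (1,8,6,6), (1,8,7,7)}
     \<union> {(4,4,3,7), (2,6,5,5), (3,7,4,4), (5,5,2,6), (6,6,2,7)}"
proof -
  have "{2..7} = {2,3,4,5,6,7::nat}" by auto
  then show ?thesis unfolding line_indices_def vline_def hline_def vspan_def hspan_def by auto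
qed

lemma example_cross_cuts_eq: "example_cross_cuts s t =
    grid_box s t ` {(2,2,1,8), (3,3,1,8), (7,7,1,8), (1,8,2,2), (1,8,3,3), (1,8,6,6), (1,8,7,7)}"
  unfolding example_cross_cuts_def grid_box_def by auto

lemma example_T_l_edges_eq: "example_T_l_edges s t =
    grid_box s t ` {(4,4,3,7), (2,6,5,5), (3,7,4,4), (5,5,2,6), (6,6,2,7)}"
  unfolding example_T_l_edges_def example_cndc_def grid_box_def by auto

lemma example_mesh_example_cells: "example_mesh s t (example_cells s t)"
proof -
  have "convex \<Omega>" by (simp add: convex_Times)
  moreover have "convex (interior \<Omega>)" by (simp add: convex_Times interior_rectangle)
  moreover have "example_cells s t \<noteq> {}" by (simp add: example_cells_def cell_indices_def)
  ultimately have "t_mesh (example_cells s t)"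
    unfolding t_mesh_def Union_example_cells
    using mesh.division mesh.interior_nonempty by (simp add: convex_imp_simply_connected)
  then show ?thesis
    unfolding example_mesh_def Union_example_cells interior_l_edges_example line_indices_eq
      example_cross_cuts_eq example_T_l_edges_eq by (simp only: image_Un)
qed

lemma example_mesh_unique:
  assumes "example_mesh s t \<T>"
  shows "\<T> = example_cells s t"
proof (rule mesh_determined_by_l_edges)
  show "rectangle_mesh \<T> (s 1) (s 8) (t 1) (t 8)"
  proof
    show "\<T> division_of \<Omega>" using assms unfolding example_mesh_def t_mesh_def by metis
    show "interior K \<noteq> {}" if "K \<in> \<T>" for K
      using assms that unfolding example_mesh_def t_mesh_def by blast
  qed
  show "rectangle_mesh (example_cells s t) (s 1) (s 8) (t 1) (t 8)" by unfold_locales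
  show "interior_l_edges \<T> = interior_l_edges (example_cells s t)"
    using assms example_mesh_example_cells unfolding example_mesh_def by simp
qed

end

section \<open>All realizations have the same topology\<close>

text \<open>The piecewise linear function that maps \<open>f i\<close> to \<open>g i\<close>, written as a sum of ramps.\<close>

definition grid_map :: "(nat \<Rightarrow> real) \<Rightarrow> (nat \<Rightarrow> real) \<Rightarrow> real \<Rightarrow> real" where
  "grid_map f g x = g 1 +
     (\<Sum>i\<in>{1..<8}. (g (Suc i) - g i) / (f (Suc i) - f i) * max 0 (min (x - f i) (f (Suc i) - f i)))"

lemma grid_map_continuous: "continuous_on A (grid_map f g)"
  unfolding grid_map_def by (intro continuous_intros)

context
  fixes f g :: "nat \<Rightarrow> real"
  assumes f: "strict_mono_on {1..8} f" and g: "strict_mono_on {1..8} g"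
begin

lemma grid_map_strict_mono: "strict_mono_on {f 1..f 8} (grid_map f g)"
proof (rule strict_mono_onI)
  fix x y assume x: "x \<in> {f 1..f 8}" and y: "y \<in> {f 1..f 8}" and xy: "x < y"
  let ?r = "\<lambda>i x. (g (Suc i) - g i) / (f (Suc i) - f i) * max 0 (min (x - f i) (f (Suc i) - f i))"
  have pos: "(g (Suc i) - g i) / (f (Suc i) - f i) > 0" "f i < f (Suc i)" if "i \<in> {1..<8}" for i
    using that strict_mono_onD[OF f, of i "Suc i"] strict_mono_onD[OF g, of i "Suc i"] by auto
  obtain i where i: "1 \<le> i" "i < 8" "f i \<le> x" "x < f (Suc i)"
  proof -
    obtain i where i: "1 \<le> i" "i < 8" "f i \<le> x" "x \<le> f (Suc i)"
      using between_grid_values[of 1 8 f x] x by auto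
    show thesis
    proof (cases "x = f (Suc i)")
      case True
      have "Suc i \<noteq> 8" using True xy y by auto
      then have "f (Suc i) < f (Suc (Suc i))" using i by (intro strict_mono_onD[OF f]) auto
      then show thesis using True i \<open>Suc i \<noteq> 8\<close> by (intro that[of "Suc i"]) auto
    qed (use i that[of i] in auto)
  qed
  have "?r i x < ?r i y"
    by (rule mult_strict_left_mono) (use i pos[of i] xy in auto)
  moreover have "?r j x \<le> ?r j y" if "j \<in> {1..<8}" for j
    by (rule mult_left_mono) (use pos[OF that] xy in auto)
  ultimately have "(\<Sum>i\<in>{1..<8}. ?r i x) < (\<Sum>i\<in>{1..<8}. ?r i y)"
    using i(1,2) by (intro sum_strict_mono_ex1) auto
  then show "grid_map f g x < grid_map f g y" by (simp add: grid_map_def)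
qed

lemma grid_map_grid:
  assumes "k \<in> {1..8}"
  shows "grid_map f g (f k) = g k"
proof -
  let ?c = "\<lambda>i. (g (Suc i) - g i) / (f (Suc i) - f i) * max 0 (min (f k - f i) (f (Suc i) - f i))"
  have 1: "?c i = g (Suc i) - g i" if "i \<in> {1..<k}" for i
  proof -
    have "f i < f (Suc i)" "f (Suc i) \<le> f k"
      using that assms strict_mono_onD[OF f, of i "Suc i"] strict_mono_on_leD[OF f, of "Suc i" k] by auto
    then show ?thesis by simp
  qed
  have 2: "?c i = 0" if "i \<in> {k..<8}" for i
    using that assms strict_mono_on_leD[OF f, of k i] by auto
  have "{1..<8} = {1..<k} \<union> {k..<8}" using assms by auto
  then have "(\<Sum>i\<in>{1..<8}. ?c i) = (\<Sum>i\<in>{1..<k}. ?c i) + (\<Sum>i\<in>{k..<8}. ?c i)"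
    by (simp add: sum.union_disjoint)
  also have "(\<Sum>i\<in>{k..<8}. ?c i) = 0" using 2 by (intro sum.neutral) blast
  also have "(\<Sum>i\<in>{1..<k}. ?c i) = (\<Sum>i\<in>{1..<k}. g (Suc i) - g i)" using 1 by (rule sum.cong[OF refl])
  also have "\<dots> = g k - g 1" using assms by (intro sum_Suc_diff') auto
  finally show ?thesis by (simp add: grid_map_def)
qed

lemma grid_map_image:
  assumes "i \<in> {1..8}" "j \<in> {1..8}" "i \<le> j"
  shows "grid_map f g ` {f i..f j} = {g i..g j}"
proof (rule subset_antisym)
  have "{f i..f j} \<subseteq> {f 1..f 8}"
    using strict_mono_on_leD[OF f, of 1 i] strict_mono_on_leD[OF f, of j 8] assms by auto
  then have "grid_map f g (f i) \<le> grid_map f g x \<and> grid_map f g x \<le> grid_map f g (f j)"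
    if "x \<in> {f i..f j}" for x
    using that strict_mono_on_leD[OF grid_map_strict_mono, of "f i" x]
      strict_mono_on_leD[OF grid_map_strict_mono, of x "f j"] by auto
  then show "grid_map f g ` {f i..f j} \<subseteq> {g i..g j}" using grid_map_grid assms(1,2) by auto
  have le: "f i \<le> f j" using strict_mono_on_leD[OF f] assms by auto
  show "{g i..g j} \<subseteq> grid_map f g ` {f i..f j}"
  proof
    fix y assume "y \<in> {g i..g j}"
    then show "y \<in> grid_map f g ` {f i..f j}"
      using IVT'[of "grid_map f g" "f i" y "f j", OF _ _ le grid_map_continuous] grid_map_grid assms(1,2)
      by fastforce
  qed
qed

end

lemma map_prod_image_Times: "map_prod f g ` (A \<times> B) = (f ` A) \<times> (g ` B)"
  by force

lemma same_topology_example_cells: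
  assumes st: "admissible s t" and st': "admissible s' t'"
  shows "same_topology (example_cells s t) (example_cells s' t')"
proof -
  interpret G: grid s t by unfold_locales (rule st)
  interpret G': grid s' t' by unfold_locales (rule st')
  have mono: "strict_mono_on {1..8} s" "strict_mono_on {1..8} s'"
      "strict_mono_on {1..8} t" "strict_mono_on {1..8} t'"
    using st st' by (simp_all add: admissible_def)
  define \<Phi> where "\<Phi> = map_prod (grid_map s s') (grid_map t t')"
  have box: "\<Phi> ` grid_box s t (i, i', j, j') = grid_box s' t' (i, i', j, j')"
    if "1 \<le> i" "i \<le> i'" "i' \<le> 8" "1 \<le> j" "j \<le> j'" "j' \<le> 8" for i i' j j'
    unfolding \<Phi>_def grid_box_def prod.case map_prod_image_Times
    using that grid_map_image[OF mono(1,2), of i i'] grid_map_image[OF mono(3,4), of j j'] by simp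
  have point: "\<Phi> (grid_point s t a) = grid_point s' t' a" if "a \<in> {1..8} \<times> {1..8}" for a
    using that grid_map_grid[OF mono(1,2)] grid_map_grid[OF mono(3,4)]
    unfolding \<Phi>_def grid_point_def by auto
  have cont: "continuous_on A \<Phi>" for A
    unfolding \<Phi>_def map_prod_def case_prod_beta
    by (intro continuous_intros continuous_on_compose2[OF grid_map_continuous]) auto
  have inj: "inj_on \<Phi> G.\<Omega>"
    using strict_mono_on_imp_inj_on[OF grid_map_strict_mono[OF mono(1,2)]]
      strict_mono_on_imp_inj_on[OF grid_map_strict_mono[OF mono(3,4)]]
    unfolding \<Phi>_def by (rule map_prod_inj_on)
  have image: "\<Phi> ` G.\<Omega> = G'.\<Omega>"
    using box[of 1 8 1 8] by (simp add: grid_box_def)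
  obtain \<Psi> where hom: "homeomorphism G.\<Omega> G'.\<Omega> \<Phi> \<Psi>"
    using homeomorphism_compact[OF _ cont image inj] by (auto simp: compact_Times)
  have cells: "(`) \<Phi> ` example_cells s t = example_cells s' t'"
  proof -
    have "\<Phi> ` grid_box s t c = grid_box s' t' c" if c: "c \<in> set cell_indices" for c
    proof -
      obtain i i' j j' where ijj: "c = (i, i', j, j')" by (metis surj_pair)
      have "1 \<le> i \<and> i < i' \<and> i' \<le> 8 \<and> 1 \<le> j \<and> j < j' \<and> j' \<le> 8"
        using bspec[OF cell_indices_bounds c] unfolding ijj by simp
      then show ?thesis unfolding ijj by (intro box) simp_all
    qed
    then show ?thesis unfolding example_cells_def image_image by (rule image_cong[OF refl])
  qed
  have verts: "\<Phi> ` vertices (example_cells s t) = vertices (example_cells s' t')"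
    unfolding G.vertices_example G'.vertices_example image_image
    using vertex_indices_bounds by (intro image_cong[OF refl] point) auto
  have line: "\<Phi> ` grid_box s t (vline i) = grid_box s' t' (vline i)"
      "\<Phi> ` grid_box s t (hline i) = grid_box s' t' (hline i)" if "i \<in> {1..8}" for i
    unfolding vline_def hline_def
    by (rule box; insert that span_bounds[of i] span_bounds(4-6)[of i]; simp)+
  have ledges: "(`) \<Phi> ` interior_l_edges (example_cells s t) = interior_l_edges (example_cells s' t')"
    unfolding G.interior_l_edges_example G'.interior_l_edges_example image_image
  proof (rule image_cong[OF refl])
    fix e assume "e \<in> line_indices"
    then obtain i where "i \<in> {2..7}" "e = vline i \<or> e = hline i" unfolding line_indices_def by blast
    then show "\<Phi> ` grid_box s t e = grid_box s' t' e" using line[of i] by auto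
  qed
  have skel: "\<Phi> ` skeleton (example_cells s t) = skeleton (example_cells s' t')"
    unfolding G.skeleton_example G'.skeleton_example image_Un image_UN using line by simp
  let ?V = "set vertex_indices"
  let ?edge = "\<lambda>s t a b. axis_parallel (grid_point s t a) (grid_point s t b) \<and>
    closed_segment (grid_point s t a) (grid_point s t b) \<subseteq> skeleton (example_cells s t) \<and>
    open_segment (grid_point s t a) (grid_point s t b) \<inter> vertices (example_cells s t) = {}"
  have seg: "\<Phi> ` closed_segment (grid_point s t a) (grid_point s t b)
      = closed_segment (grid_point s' t' a) (grid_point s' t' b)"
    if ab: "a \<in> ?V" "b \<in> ?V" and par: "axis_parallel (grid_point s t a) (grid_point s t b)" for a b
  proof -
    obtain i j where a: "a = (i, j)" by fastforce
    obtain k l where b: "b = (k, l)" by fastforce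
    have bd: "i \<in> {1..8}" "j \<in> {1..8}" "k \<in> {1..8}" "l \<in> {1..8}"
      using ab vertex_indices_bounds unfolding a b by auto
    then have ik: "i = k \<or> j = l"
      using par G.s_eq[of i k] G.t_eq[of j l] unfolding axis_parallel_def a b grid_point_def by auto
    have v: "closed_segment (s i, t j) (s i, t l) = grid_box s t (i, i, min j l, max j l)"
        if "admissible s t" for s t
    proof -
      interpret grid s t by unfold_locales (rule that)
      show ?thesis using bd t_le[of j l] t_le[of l j]
        by (auto simp: grid_box_def closed_segment_same_fst closed_segment_eq_real_ivl min_def max_def)
    qed
    have h: "closed_segment (s i, t j) (s k, t j) = grid_box s t (min i k, max i k, j, j)"
        if "admissible s t" for s t
    proof -
      interpret grid s t by unfold_locales (rule that)
      show ?thesis using bd s_le[of i k] s_le[of k i]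
        by (auto simp: grid_box_def closed_segment_same_snd closed_segment_eq_real_ivl min_def max_def)
    qed
    show ?thesis
    proof (cases "i = k")
      case True
      show ?thesis
        unfolding a b True[symmetric] grid_point_def prod.case v[OF st] v[OF st']
        by (rule box) (use bd in auto)
    next
      case False
      then have jl: "j = l" using ik by simp
      show ?thesis
        unfolding a b jl[symmetric] grid_point_def prod.case h[OF st] h[OF st']
        by (rule box) (use bd in auto)
    qed
  qed
  have transfer: "?edge s t a b \<longleftrightarrow> ?edge s' t' a b" if ab: "a \<in> ?V" "b \<in> ?V" for a b
  proof -
    have bd: "fst a \<in> {1..8}" "snd a \<in> {1..8}" "fst b \<in> {1..8}" "snd b \<in> {1..8}"
      using ab vertex_indices_bounds by auto
    have par: "axis_parallel (grid_point s t a) (grid_point s t b)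
        \<longleftrightarrow> axis_parallel (grid_point s' t' a) (grid_point s' t' b)"
      using bd G.s_eq G.t_eq G'.s_eq G'.t_eq
      unfolding axis_parallel_def grid_point_def by (simp add: case_prod_beta)
    show ?thesis
    proof (cases "axis_parallel (grid_point s t a) (grid_point s t b)")
      case True
      let ?C = "closed_segment (grid_point s t a) (grid_point s t b)"
      have pts: "grid_point s t a \<in> vertices (example_cells s t)" "grid_point s t b \<in> vertices (example_cells s t)"
        using ab by (simp_all add: G.vertices_example)
      have V\<Omega>: "vertices (example_cells s t) \<subseteq> G.\<Omega>"
        using G.mesh.vertices_subset_skeleton G.mesh.skeleton_subset by (rule order_trans)
      then have C\<Omega>: "?C \<subseteq> G.\<Omega>"
        using pts by (intro closed_segment_subset) (auto simp: convex_Times)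
      have 1: "?C \<subseteq> skeleton (example_cells s t)
          \<longleftrightarrow> closed_segment (grid_point s' t' a) (grid_point s' t' b) \<subseteq> skeleton (example_cells s' t')"
        unfolding seg[OF ab True, symmetric] skel[symmetric]
        using inj_on_image_subset_iff[OF inj C\<Omega> G.mesh.skeleton_subset] by simp
      have inside: "{grid_point s t a, grid_point s t b} \<subseteq> G.\<Omega>" using pts V\<Omega> by blast
      have "\<Phi> ` open_segment (grid_point s t a) (grid_point s t b)
          = \<Phi> ` ?C - \<Phi> ` {grid_point s t a, grid_point s t b}"
        unfolding open_segment_def
        by (rule inj_on_image_set_diff[OF inj]) (use C\<Omega> inside in blast)+
      also have "\<dots> = open_segment (grid_point s' t' a) (grid_point s' t' b)"
        using point[OF set_mp[OF vertex_indices_bounds ab(1)]] point[OF set_mp[OF vertex_indices_bounds ab(2)]]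
        unfolding open_segment_def seg[OF ab True] by simp
      finally have "\<Phi> ` open_segment (grid_point s t a) (grid_point s t b)
          = open_segment (grid_point s' t' a) (grid_point s' t' b)" .
      moreover have "\<Phi> ` (open_segment (grid_point s t a) (grid_point s t b) \<inter> vertices (example_cells s t))
          = \<Phi> ` open_segment (grid_point s t a) (grid_point s t b) \<inter> \<Phi> ` vertices (example_cells s t)"
        by (rule inj_on_image_Int[OF inj order_trans[OF segment_open_subset_closed C\<Omega>] V\<Omega>])
      ultimately have 2: "open_segment (grid_point s t a) (grid_point s t b) \<inter> vertices (example_cells s t) = {}
          \<longleftrightarrow> open_segment (grid_point s' t' a) (grid_point s' t' b) \<inter> vertices (example_cells s' t') = {}"
        unfolding verts[symmetric] by (metis image_is_empty)
      show ?thesis using par 1 2 by simp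
    qed (use par in simp)
  qed
  have edges_eq: "mesh_edges (example_cells s t)
      = (\<lambda>(a, b). closed_segment (grid_point s t a) (grid_point s t b)) ` {(a, b) \<in> ?V \<times> ?V. ?edge s t a b}"
    if "admissible s t" for s t
  proof -
    interpret grid s t by unfold_locales (rule that)
    have vert: "p \<in> vertices (example_cells s t) \<longleftrightarrow> (\<exists>a\<in>?V. p = grid_point s t a)" for p
      unfolding vertices_example image_iff ..
    show ?thesis
    proof (intro subset_antisym subsetI)
      fix E assume "E \<in> mesh_edges (example_cells s t)"
      then obtain p q where pq: "E = closed_segment p q"
          "p \<in> vertices (example_cells s t)" "q \<in> vertices (example_cells s t)" "axis_parallel p q"
          "closed_segment p q \<subseteq> skeleton (example_cells s t)"
          "open_segment p q \<inter> vertices (example_cells s t) = {}"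
        unfolding mesh.mesh_edge_eq mem_Collect_eq by (elim exE conjE) (rule that)
      obtain a where a: "a \<in> ?V" "p = grid_point s t a" using pq(2) unfolding vert by (elim bexE) (rule that)
      obtain b where b: "b \<in> ?V" "q = grid_point s t b" using pq(3) unfolding vert by (elim bexE) (rule that)
      show "E \<in> (\<lambda>(a, b). closed_segment (grid_point s t a) (grid_point s t b)) `
          {(a, b) \<in> ?V \<times> ?V. ?edge s t a b}"
        by (rule image_eqI[of _ _ "(a, b)"]) (use pq a b in simp_all)
    next
      fix E assume "E \<in> (\<lambda>(a, b). closed_segment (grid_point s t a) (grid_point s t b)) `
          {(a, b) \<in> ?V \<times> ?V. ?edge s t a b}"
      then obtain z where z: "z \<in> {(a, b) \<in> ?V \<times> ?V. ?edge s t a b}"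
          "E = (\<lambda>(a, b). closed_segment (grid_point s t a) (grid_point s t b)) z"
        by (elim imageE) (rule that)
      obtain a b where ab: "z = (a, b)" by (metis surj_pair)
      show "E \<in> mesh_edges (example_cells s t)"
        unfolding mesh.mesh_edge_eq mem_Collect_eq
        by (rule exI[of _ "grid_point s t a"], rule exI[of _ "grid_point s t b"])
          (use z in \<open>auto simp: ab vert\<close>)
    qed
  qed
  have edges: "(`) \<Phi> ` mesh_edges (example_cells s t) = mesh_edges (example_cells s' t')"
    unfolding edges_eq[OF st] edges_eq[OF st'] image_image
  proof (rule image_cong)
    show "{(a, b) \<in> ?V \<times> ?V. ?edge s t a b} = {(a, b) \<in> ?V \<times> ?V. ?edge s' t' a b}"
    proof (rule set_eqI)
      fix z :: "(nat \<times> nat) \<times> nat \<times> nat"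
      obtain a b where z: "z = (a, b)" by (metis surj_pair)
      show "z \<in> {(a, b) \<in> ?V \<times> ?V. ?edge s t a b} \<longleftrightarrow> z \<in> {(a, b) \<in> ?V \<times> ?V. ?edge s' t' a b}"
      proof (cases "a \<in> ?V \<and> b \<in> ?V")
        case True
        then show ?thesis using transfer[of a b] unfolding z by simp
      qed (auto simp: z)
    qed
    fix z assume "z \<in> {(a, b) \<in> ?V \<times> ?V. ?edge s' t' a b}"
    then obtain a b where ab: "z = (a, b)" "a \<in> ?V" "b \<in> ?V" "?edge s' t' a b"
      by (cases z) simp
    have "axis_parallel (grid_point s t a) (grid_point s t b)"
      using iffD2[OF transfer[OF ab(2,3)] ab(4)] by (rule conjunct1)
    then show "\<Phi> ` (case z of (a, b) \<Rightarrow> closed_segment (grid_point s t a) (grid_point s t b))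
        = (case z of (a, b) \<Rightarrow> closed_segment (grid_point s' t' a) (grid_point s' t' b))"
      unfolding ab(1) prod.case by (rule seg[OF ab(2,3)])
  qed
  show ?thesis
    unfolding same_topology_def G.Union_example_cells G'.Union_example_cells
    using hom cells verts edges ledges by blast
qed

section \<open>Reasonable orders and the CNDC\<close>

text \<open>
  The counting condition in a form suited to induction along the order; \<open>U\<close> is the union of the
  edges already deleted.
\<close>

primrec reasonable_list ::
  "nat \<Rightarrow> (real \<times> real) set \<Rightarrow> (real \<times> real) set \<Rightarrow> (real \<times> real) set list \<Rightarrow> bool" where
  "reasonable_list d W U [] \<longleftrightarrow> True"
| "reasonable_list d W U (l # ls) \<longleftrightarrow> d + 1 \<le> card (W \<inter> l - U) \<and> reasonable_list d W (U \<union> l) ls"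

lemma reasonable_list_iff:
  "reasonable_list d W U ls \<longleftrightarrow> (\<forall>i < length ls. d + 1 \<le> card ((W \<inter> ls ! i) - (U \<union> (\<Union>j<i. ls ! j))))"
proof (induction ls arbitrary: U)
  case (Cons l ls)
  have "(\<Union>j<Suc i. (l # ls) ! j) = l \<union> (\<Union>j<i. ls ! j)" for i
    unfolding lessThan_Suc_eq_insert_0 by simp
  then show ?case
    unfolding reasonable_list.simps Cons.IH
    by (simp add: All_less_Suc2 Un_assoc)
qed simp

lemma has_reasonable_order_iff:
  "has_reasonable_order d W T \<longleftrightarrow> (\<exists>ls. set ls = T \<and> distinct ls \<and> reasonable_list d W {} ls)"
  by (auto simp: has_reasonable_order_def reasonable_list_iff permutations_of_set_def)

lemma reasonable_list_filter:
  assumes "finite W"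
  shows "reasonable_list d W U ls \<Longrightarrow> U' \<subseteq> U \<Longrightarrow> reasonable_list d W U' (filter P ls)"
proof (induction ls arbitrary: U U')
  case (Cons l ls)
  have "card (W \<inter> l - U) \<le> card (W \<inter> l - U')"
    using assms Cons.prems(2) by (intro card_mono) auto
  then show ?case
    using Cons.prems Cons.IH[of "U \<union> l" U'] Cons.IH[of "U \<union> l" "U' \<union> l"] by auto
qed simp

text \<open>Dropping edges from a reasonable order deletes fewer vertices from the remaining ones.\<close>

lemma has_reasonable_order_subset:
  assumes "finite W" "has_reasonable_order d W T" "T' \<subseteq> T"
  shows "has_reasonable_order d W T'"
proof -
  obtain ls where ls: "set ls = T" "distinct ls" "reasonable_list d W {} ls"
    using assms(2) unfolding has_reasonable_order_iff by blast
  then have "set (filter (\<lambda>l. l \<in> T') ls) = T'" "distinct (filter (\<lambda>l. l \<in> T') ls)"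
    using assms(3) by auto
  then show ?thesis
    using reasonable_list_filter[OF assms(1) ls(3)] unfolding has_reasonable_order_iff by blast
qed

lemma reasonable_list_last:
  "reasonable_list d W U (ls @ [l]) \<Longrightarrow> d + 1 \<le> card (W \<inter> l - (U \<union> \<Union>(set ls)))"
proof (induction ls arbitrary: U)
  case (Cons a ls)
  then show ?case using Cons.IH[of "U \<union> a"] by (simp add: Un_assoc)
qed simp

text \<open>
  Whichever edge comes last has lost its vertices on all the others.
\<close>

lemma no_reasonable_order:
  assumes "T \<noteq> {}" "\<And>l. l \<in> T \<Longrightarrow> card (W \<inter> l - \<Union>(T - {l})) \<le> d"
  shows "\<not> has_reasonable_order d W T"
proof
  assume "has_reasonable_order d W T"
  then obtain ls where ls: "set ls = T" "distinct ls" "reasonable_list d W {} ls"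
    unfolding has_reasonable_order_iff by blast
  then obtain xs l where xs: "ls = xs @ [l]" using assms(1) by (cases ls rule: rev_cases) auto
  then have "l \<in> T" "set xs = T - {l}" using ls(1,2) by auto
  then show False
    using assms(2)[of l] ls(3) reasonable_list_last[of d W "{}" xs l] xs by simp
qed

definition in_box :: "nat \<times> nat \<Rightarrow> nat \<times> nat \<times> nat \<times> nat \<Rightarrow> bool" where
  "in_box = (\<lambda>(a, b) (i, i', j, j'). i \<le> a \<and> a \<le> i' \<and> j \<le> b \<and> b \<le> j')"

definition cndc_indices :: "(nat \<times> nat \<times> nat \<times> nat) set" where
  "cndc_indices = {(4,4,3,7), (2,6,5,5), (3,7,4,4), (5,5,2,6)}"

definition T_indices :: "(nat \<times> nat \<times> nat \<times> nat) set" where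
  "T_indices = {(4,4,3,7), (2,6,5,5), (3,7,4,4), (5,5,2,6), (6,6,2,7)}"

definition cross_cut_indices :: "(nat \<times> nat \<times> nat \<times> nat) set" where
  "cross_cut_indices = {(2,2,1,8), (3,3,1,8), (7,7,1,8), (1,8,2,2), (1,8,3,3), (1,8,6,6), (1,8,7,7)}"

text \<open>
  The same process on indices, where it can be evaluated; \<open>us\<close> lists the edges already deleted.
\<close>

primrec reasonable_indices ::
  "(nat \<times> nat \<times> nat \<times> nat) list \<Rightarrow> (nat \<times> nat \<times> nat \<times> nat) list \<Rightarrow> bool" where
  "reasonable_indices us [] \<longleftrightarrow> True"
| "reasonable_indices us (e # es) \<longleftrightarrow>
     4 \<le> length (filter (\<lambda>v. in_box v e \<and> \<not> list_ex (in_box v) us) vertex_indices) \<and>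
     reasonable_indices (e # us) es"

context grid begin

abbreviation "\<M> \<equiv> example_cells s t"
abbreviation "gbox \<equiv> grid_box s t"

lemma inj_gbox: "inj_on gbox line_indices"
  using line_not_nested by (intro inj_onI) simp

lemma line_indices_split: "line_indices = cross_cut_indices \<union> T_indices"
  unfolding line_indices_eq cross_cut_indices_def T_indices_def ..

lemma example_cndc_eq: "example_cndc s t = gbox ` cndc_indices"
  unfolding example_cndc_def cndc_indices_def grid_box_def by simp

lemma line_bounds:
  assumes "(i, i', j, j') \<in> line_indices"
  shows "i \<in> {1..8} \<and> i' \<in> {1..8} \<and> j \<in> {1..8} \<and> j' \<in> {1..8}"
  using assms unfolding line_indices_split cross_cut_indices_def T_indices_def by auto

lemma grid_point_in_line:
  assumes "v \<in> {1..8} \<times> {1..8}" "e \<in> line_indices"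
  shows "grid_point s t v \<in> gbox e \<longleftrightarrow> in_box v e"
proof -
  obtain a b i i' j j' where eq: "v = (a, b)" "e = (i, i', j, j')" by (metis surj_pair)
  show ?thesis
    using assms(1) line_bounds[of i i' j j'] assms(2) s_le t_le
    unfolding eq grid_point_def grid_box_def in_box_def by simp
qed

lemma card_grid_points:
  assumes "distinct W" "set W \<subseteq> {1..8} \<times> {1..8}" "\<And>v. v \<in> set W \<Longrightarrow> grid_point s t v \<in> S \<longleftrightarrow> P v"
  shows "card (grid_point s t ` set W \<inter> S) = length (filter P W)"
proof -
  have "grid_point s t ` set W \<inter> S = grid_point s t ` set (filter P W)"
    using assms(3) by auto
  also have "card \<dots> = card (set (filter P W))"
    using inj_on_subset[OF inj_grid_point] assms(2) by (intro card_image) (meson filter_is_subset order_trans)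
  also have "\<dots> = length (filter P W)" using assms(1) by (intro distinct_card) simp
  finally show ?thesis .
qed

lemma card_vertices:
  assumes "\<And>v. v \<in> set vertex_indices \<Longrightarrow> grid_point s t v \<in> S \<longleftrightarrow> P v"
  shows "card (vertices \<M> \<inter> S) = length (filter P vertex_indices)"
  unfolding vertices_example
  by (rule card_grid_points[OF distinct_vertex_indices vertex_indices_bounds assms])

lemma vertex_in_line:
  "v \<in> set vertex_indices \<Longrightarrow> e \<in> line_indices \<Longrightarrow> grid_point s t v \<in> gbox e \<longleftrightarrow> in_box v e"
  using grid_point_in_line vertex_indices_bounds by blast

lemma vertex_in_line_diff:
  assumes v: "v \<in> set vertex_indices" and e: "e \<in> line_indices" and X: "X \<subseteq> line_indices"
  shows "grid_point s t v \<in> gbox e - \<Union>(gbox ` X) \<longleftrightarrow> in_box v e \<and> (\<forall>e'\<in>X. \<not> in_box v e')"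
proof -
  have "\<forall>e'\<in>X. grid_point s t v \<in> gbox e' \<longleftrightarrow> in_box v e'"
    using vertex_in_line[OF v] X by (meson subsetD)
  then show ?thesis using vertex_in_line[OF v e] by simp
qed

lemma T_in_lines: "e \<in> T_indices \<Longrightarrow> e \<in> line_indices"
  by (simp add: line_indices_split)

lemma gbox_image_diff:
  "X \<subseteq> line_indices \<Longrightarrow> Y \<subseteq> line_indices \<Longrightarrow> gbox ` (X - Y) = gbox ` X - gbox ` Y"
  by (rule inj_on_image_set_diff[OF inj_gbox]) (simp_all add: le_infI1 Diff_subset[THEN order_trans])

lemma cndc_in_T: "e \<in> cndc_indices \<Longrightarrow> e \<in> T_indices"
  by (auto simp: cndc_indices_def T_indices_def)

lemma reasonable_indices:
  assumes "set us \<subseteq> line_indices" "set es \<subseteq> line_indices" "reasonable_indices us es"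
  shows "reasonable_list 3 (vertices \<M>) (\<Union>(gbox ` set us)) (map gbox es)"
  using assms
proof (induction es arbitrary: us)
  case (Cons e es)
  have "card (vertices \<M> \<inter> (gbox e - \<Union>(gbox ` set us)))
      = length (filter (\<lambda>v. in_box v e \<and> \<not> list_ex (in_box v) us) vertex_indices)"
    unfolding list_ex_iff
  proof (rule card_vertices)
    fix v assume v: "v \<in> set vertex_indices"
    have "e \<in> line_indices" using Cons.prems(2) by simp
    from vertex_in_line_diff[OF v this Cons.prems(1)]
    show "grid_point s t v \<in> gbox e - \<Union>(gbox ` set us) \<longleftrightarrow> in_box v e \<and> \<not> (\<exists>x\<in>set us. in_box v x)"
      by blast
  qed
  moreover have "vertices \<M> \<inter> gbox e - \<Union>(gbox ` set us) = vertices \<M> \<inter> (gbox e - \<Union>(gbox ` set us))"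
    by blast
  ultimately show ?case
    using Cons.prems Cons.IH[of "e # us"] by (simp add: Un_commute)
qed simp

lemma reasonable_order_by_indices:
  assumes "set es = X" "X \<subseteq> line_indices" "distinct es" "reasonable_indices [] es"
  shows "has_reasonable_order 3 (vertices \<M>) (gbox ` X)"
  unfolding has_reasonable_order_iff
  using assms reasonable_indices[of "[]" es] inj_on_subset[OF inj_gbox assms(2)]
  by (intro exI[of _ "map gbox es"]) (auto simp: distinct_map)

text \<open>
  Without one of its edges the cycle of the CNDC is a path of three edges.  Processed from the
  middle one, the two others lose one vertex each; the fifth T $l$-edge comes last and keeps at
  least four of its six vertices.
\<close>

lemma reasonable_without_one:
  assumes "e \<in> cndc_indices"
  shows "has_reasonable_order 3 (vertices \<M>) (gbox ` (T_indices - {e}))"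
proof -
  have "\<exists>es. set es = T_indices - {e} \<and> distinct es \<and> reasonable_indices [] es"
    using assms unfolding cndc_indices_def insert_iff empty_iff
  proof (elim disjE FalseE)
    assume "e = (4,4,3,7)"
    then show ?thesis
      by (intro exI[of _ "[(5,5,2,6), (2,6,5,5), (3,7,4,4), (6,6,2,7)]"])
        (intro conjI, simp add: T_indices_def insert_Diff_if insert_commute, simp,
          simp add: vertex_indices_def in_box_def)
  next
    assume "e = (2,6,5,5)"
    then show ?thesis
      by (intro exI[of _ "[(3,7,4,4), (4,4,3,7), (5,5,2,6), (6,6,2,7)]"])
        (intro conjI, simp add: T_indices_def insert_Diff_if insert_commute, simp,
          simp add: vertex_indices_def in_box_def)
  next
    assume "e = (3,7,4,4)"
    then show ?thesis
      by (intro exI[of _ "[(2,6,5,5), (4,4,3,7), (5,5,2,6), (6,6,2,7)]"])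
        (intro conjI, simp add: T_indices_def insert_Diff_if insert_commute, simp,
          simp add: vertex_indices_def in_box_def)
  next
    assume "e = (5,5,2,6)"
    then show ?thesis
      by (intro exI[of _ "[(4,4,3,7), (2,6,5,5), (3,7,4,4), (6,6,2,7)]"])
        (intro conjI, simp add: T_indices_def insert_Diff_if insert_commute, simp,
          simp add: vertex_indices_def in_box_def)
  qed
  then obtain es where es: "set es = T_indices - {e}" "distinct es" "reasonable_indices [] es" by blast
  have "T_indices - {e} \<subseteq> line_indices" using T_in_lines by blast
  then show ?thesis by (rule reasonable_order_by_indices[OF es(1) _ es(2,3)])
qed

lemma cndc_edge_cards:
  assumes "e \<in> cndc_indices"
  shows "length (filter (\<lambda>v. in_box v e) vertex_indices) = 5"
    "length (filter (\<lambda>v. in_box v e \<and> (\<forall>e'\<in>cndc_indices - {e}. \<not> in_box v e')) vertex_indices) = 3"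
proof -
  have "\<forall>e\<in>cndc_indices. length (filter (\<lambda>v. in_box v e) vertex_indices) = 5 \<and>
    length (filter (\<lambda>v. in_box v e \<and> (\<forall>e'\<in>cndc_indices - {e}. \<not> in_box v e')) vertex_indices) = 3"
    unfolding cndc_indices_def ball_simps insert_Diff_if
    by (simp add: vertex_indices_def in_box_def)
  then show "length (filter (\<lambda>v. in_box v e) vertex_indices) = 5"
    "length (filter (\<lambda>v. in_box v e \<and> (\<forall>e'\<in>cndc_indices - {e}. \<not> in_box v e')) vertex_indices) = 3"
    using assms by blast+
qed

lemma cndc_not_reasonable: "\<not> has_reasonable_order 3 (vertices \<M>) (gbox ` cndc_indices)"
proof (rule no_reasonable_order)
  show "gbox ` cndc_indices \<noteq> {}" by (simp add: cndc_indices_def)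
  fix l assume "l \<in> gbox ` cndc_indices"
  then obtain e where e: "e \<in> cndc_indices" "l = gbox e" by blast
  have lines: "e' \<in> line_indices" if "e' \<in> cndc_indices" for e'
    using that cndc_in_T T_in_lines by blast
  have "gbox ` cndc_indices - {l} = gbox ` (cndc_indices - {e})"
    using gbox_image_diff[of cndc_indices "{e}"] lines e by (simp add: subsetI)
  then have "vertices \<M> \<inter> l - \<Union>(gbox ` cndc_indices - {l})
      = vertices \<M> \<inter> (gbox e - \<Union>(gbox ` (cndc_indices - {e})))"
    using e(2) by auto
  also have "card \<dots> = length (filter (\<lambda>v. in_box v e \<and> (\<forall>e'\<in>cndc_indices - {e}. \<not> in_box v e')) vertex_indices)"
    by (rule card_vertices, rule vertex_in_line_diff) (use lines e(1) in blast)+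
  also have "\<dots> = 3" by (rule cndc_edge_cards(2)[OF e(1)])
  finally show "card (vertices \<M> \<inter> l - \<Union>(gbox ` cndc_indices - {l})) \<le> 3" by simp
qed

lemma remaining_edge_reasonable:
  "has_reasonable_order 3 (vertices \<M> - \<Union>(gbox ` cndc_indices)) (gbox ` T_indices - gbox ` cndc_indices)"
proof -
  let ?f = "(6,6,2,7)"
  have lines: "e' \<in> line_indices" if "e' \<in> cndc_indices" for e'
    using that cndc_in_T T_in_lines by blast
  have f: "?f \<in> line_indices" by (rule T_in_lines) (simp add: T_indices_def)
  have "gbox ` T_indices - gbox ` cndc_indices = gbox ` (T_indices - cndc_indices)"
    by (rule gbox_image_diff[symmetric]) (use T_in_lines lines in blast)+
  also have "T_indices - cndc_indices = {?f}" unfolding T_indices_def cndc_indices_def by auto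
  finally have eq: "gbox ` T_indices - gbox ` cndc_indices = {gbox ?f}" by simp
  have "card (vertices \<M> \<inter> (gbox ?f - \<Union>(gbox ` cndc_indices)))
      = length (filter (\<lambda>v. in_box v ?f \<and> (\<forall>e'\<in>cndc_indices. \<not> in_box v e')) vertex_indices)"
    by (rule card_vertices, rule vertex_in_line_diff) (use lines f in blast)+
  also have "\<dots> = 4" by (simp add: vertex_indices_def in_box_def cndc_indices_def)
  finally have "card ((vertices \<M> - \<Union>(gbox ` cndc_indices)) \<inter> gbox ?f) = 4"
    by (metis (no_types, lifting) Int_Diff Int_commute)
  then show ?thesis
    unfolding eq has_reasonable_order_iff by (intro exI[of _ "[gbox ?f]"]) simp
qed

lemma line_segment_ends:
  assumes "(i, i', j, j') \<in> line_indices"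
  shows "gbox (i, i', j, j') = closed_segment (grid_point s t (i, j)) (grid_point s t (i', j'))"
proof -
  from assms consider k where "(i, i', j, j') = vline k" "k \<in> {1..8}" | k where "(i, i', j, j') = hline k" "k \<in> {1..8}"
    unfolding line_indices_def by fastforce
  then show ?thesis
  proof cases
    case 1
    have "i = k" "i' = k" "j = fst (vspan k)" "j' = snd (vspan k)" using 1(1) by (auto simp: vline_def prod_eq_iff)
    then show ?thesis unfolding 1(1) vline_segment[OF 1(2)] grid_point_def by simp
  next
    case 2
    have "j = k" "j' = k" "i = fst (hspan k)" "i' = snd (hspan k)" using 2(1) by (auto simp: hline_def prod_eq_iff)
    then show ?thesis unfolding 2(1) hline_segment[OF 2(2)] grid_point_def by simp
  qed
qed

lemma cross_cut_ends:
  assumes "(i, i', j, j') \<in> cross_cut_indices"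
  shows "grid_point s t (i, j) \<in> boundary_vertices \<M>" "grid_point s t (i', j') \<in> boundary_vertices \<M>"
proof -
  have "grid_point s t (a, b) \<in> boundary_vertices \<M>"
    if "(a, b) \<in> set vertex_indices" "a = 1 \<or> a = 8 \<or> b = 1 \<or> b = 8" for a b
  proof -
    have "a \<in> {1..8}" "b \<in> {1..8}" using that(1) vertex_indices_bounds by auto
    then have "grid_point s t (a, b) \<in> frontier \<Omega>"
      using that(2) s_le[of 1 a] s_le[of a 8] t_le[of 1 b] t_le[of b 8]
      unfolding frontier_rectangle grid_point_def by auto
    then show ?thesis
      using index_vertex[OF that(1)] unfolding boundary_vertices_def Union_example_cells
      by (simp add: grid_point_def)
  qed
  then show "grid_point s t (i, j) \<in> boundary_vertices \<M>" "grid_point s t (i', j') \<in> boundary_vertices \<M>"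
    using assms unfolding cross_cut_indices_def insert_iff empty_iff
    by (elim disjE FalseE; simp add: vertex_indices_def)+
qed

lemma T_l_edge_ends:
  assumes "(i, i', j, j') \<in> T_indices"
  shows "grid_point s t (i, j) \<in> interior \<Omega>" "grid_point s t (i', j') \<in> interior \<Omega>"
proof -
  have "grid_point s t (a, b) \<in> interior \<Omega>" if "a \<in> {2..7}" "b \<in> {2..7}" for a b
    using that s_less[of 1 a] s_less[of a 8] t_less[of 1 b] t_less[of b 8]
    unfolding interior_rectangle grid_point_def by auto
  then show "grid_point s t (i, j) \<in> interior \<Omega>" "grid_point s t (i', j') \<in> interior \<Omega>"
    using assms unfolding T_indices_def insert_iff empty_iff by (elim disjE FalseE; simp)+
qed

lemma boundary_not_interior: "v \<in> boundary_vertices \<M> \<Longrightarrow> v \<notin> interior \<Omega>"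
  unfolding boundary_vertices_def Union_example_cells frontier_def by blast

lemma T_junction_interior: "v \<in> T_junctions \<M> \<Longrightarrow> v \<in> interior \<Omega>"
  unfolding T_junctions_def interior_vertices_def Union_example_cells by blast

lemma cross_cuts_example: "cross_cuts \<M> = gbox ` cross_cut_indices"
proof (intro subset_antisym subsetI)
  fix L assume L: "L \<in> cross_cuts \<M>"
  then have "L \<in> gbox ` line_indices" unfolding cross_cuts_def interior_l_edges_example by blast
  then obtain i i' j j' where e: "(i, i', j, j') \<in> line_indices" "L = gbox (i, i', j, j')" by (metis imageE surj_pair)
  obtain p q where pq: "L = closed_segment p q" "p \<in> boundary_vertices \<M>" "q \<in> boundary_vertices \<M>"
    using L unfolding cross_cuts_def by blast
  have "{p, q} = {grid_point s t (i, j), grid_point s t (i', j')}"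
    using pq(1) line_segment_ends[OF e(1)] e(2) by (simp add: closed_segment_eq)
  then have "grid_point s t (i, j) \<notin> interior \<Omega>" using pq(2,3) boundary_not_interior by (metis insertCI insertE singletonD)
  then have "(i, i', j, j') \<notin> T_indices" using T_l_edge_ends by metis
  then show "L \<in> gbox ` cross_cut_indices" using e unfolding line_indices_split by blast
next
  fix L assume "L \<in> gbox ` cross_cut_indices"
  then obtain i i' j j' where e: "(i, i', j, j') \<in> cross_cut_indices" "L = gbox (i, i', j, j')" by (metis imageE surj_pair)
  then have line: "(i, i', j, j') \<in> line_indices" by (simp add: line_indices_split)
  then have "L \<in> interior_l_edges \<M>" unfolding interior_l_edges_example e(2) by (rule imageI)
  then show "L \<in> cross_cuts \<M>"
    unfolding cross_cuts_def using line_segment_ends[OF line] cross_cut_ends[OF e(1)] e(2) by blast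
qed

lemma T_l_edges_example: "T_l_edges \<M> = gbox ` T_indices"
proof (intro subset_antisym subsetI)
  fix L assume L: "L \<in> T_l_edges \<M>"
  then have "L \<in> gbox ` line_indices" unfolding T_l_edges_def interior_l_edges_example by blast
  then obtain i i' j j' where e: "(i, i', j, j') \<in> line_indices" "L = gbox (i, i', j, j')" by (metis imageE surj_pair)
  obtain p q where pq: "L = closed_segment p q" "p \<in> T_junctions \<M>" "q \<in> T_junctions \<M>"
    using L unfolding T_l_edges_def by blast
  have "{p, q} = {grid_point s t (i, j), grid_point s t (i', j')}"
    using pq(1) line_segment_ends[OF e(1)] e(2) by (simp add: closed_segment_eq)
  then have "grid_point s t (i, j) \<in> interior \<Omega>" using pq(2,3) T_junction_interior by (metis insertCI insertE singletonD)
  then have "(i, i', j, j') \<notin> cross_cut_indices" using cross_cut_ends boundary_not_interior by metis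
  then show "L \<in> gbox ` T_indices" using e unfolding line_indices_split by blast
next
  fix L assume "L \<in> gbox ` T_indices"
  then obtain i i' j j' where e: "(i, i', j, j') \<in> T_indices" "L = gbox (i, i', j, j')" by (metis imageE surj_pair)
  then have line: "(i, i', j, j') \<in> line_indices" by (simp add: line_indices_split)
  then have L: "L \<in> interior_l_edges \<M>" unfolding interior_l_edges_example e(2) by (rule imageI)
  then obtain p q where pq: "L = closed_segment p q" "p \<in> T_junctions \<M> \<union> boundary_vertices \<M>"
      "q \<in> T_junctions \<M> \<union> boundary_vertices \<M>"
    unfolding interior_l_edges_def by blast
  have "{p, q} = {grid_point s t (i, j), grid_point s t (i', j')}"
    using pq(1) line_segment_ends[OF line] e(2) by (simp add: closed_segment_eq)
  then have "p \<in> interior \<Omega>" "q \<in> interior \<Omega>" using T_l_edge_ends[OF e(1)] by (metis insertCI insertE singletonD)+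
  then have "p \<in> T_junctions \<M>" "q \<in> T_junctions \<M>" using pq(2,3) boundary_not_interior by (metis UnE)+
  then show "L \<in> T_l_edges \<M>" unfolding T_l_edges_def using L pq(1) by blast
qed

lemma cndc_subset_lines: "cndc_indices \<subseteq> line_indices"
  using cndc_in_T T_in_lines by blast

lemma regular_cndc: "regular_partition 3 \<M> (gbox ` cndc_indices)"
  unfolding regular_partition_def T_l_edges_example
  using cndc_not_reasonable remaining_edge_reasonable cndc_in_T by (intro conjI image_mono) auto

text \<open>
  By heredity, a set without a reasonable order contains each of the four edges.
\<close>

lemma regular_contains_cndc:
  assumes "regular_partition 3 \<M> T1"
  shows "gbox ` cndc_indices \<subseteq> T1"
proof (rule image_subsetI, rule ccontr)
  fix e assume e: "e \<in> cndc_indices" "gbox e \<notin> T1"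
  have "gbox ` (T_indices - {e}) = gbox ` T_indices - {gbox e}"
    using gbox_image_diff[of T_indices "{e}"] T_in_lines cndc_in_T e(1) by (simp add: subsetI)
  moreover have "T1 \<subseteq> gbox ` T_indices"
    using assms unfolding regular_partition_def T_l_edges_example by (rule conjunct1)
  ultimately have "T1 \<subseteq> gbox ` (T_indices - {e})" using e(2) by (simp add: subset_Diff_insert)
  then have "has_reasonable_order 3 (vertices \<M>) T1"
    using has_reasonable_order_subset[OF mesh.finite_vertices reasonable_without_one[OF e(1)]] by blast
  then show False using assms unfolding regular_partition_def by blast
qed

lemma complete_partition_example: "complete_partition 3 \<M> T1 \<longleftrightarrow> T1 = gbox ` cndc_indices"
  using regular_cndc regular_contains_cndc unfolding complete_partition_def by (metis psubsetI psubsetE)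

lemma not_diagonalizable_example: "\<not> diagonalizable 3 \<M>"
proof
  assume "diagonalizable 3 \<M>"
  then have "has_reasonable_order 3 (vertices \<M>) (gbox ` T_indices)"
    unfolding diagonalizable_def T_l_edges_example .
  then have "has_reasonable_order 3 (vertices \<M>) (gbox ` cndc_indices)"
    by (rule has_reasonable_order_subset[OF mesh.finite_vertices]) (use cndc_in_T in blast)
  then show False using cndc_not_reasonable by blast
qed

lemma cndc_example: "cndc 3 \<M> = gbox ` cndc_indices"
proof -
  have "(THE T1. complete_partition 3 \<M> T1) = gbox ` cndc_indices"
    by (rule the_equality) (simp_all only: complete_partition_example)
  then show ?thesis unfolding cndc_def using not_diagonalizable_example by simp
qed

lemma multi_vertices_example:
  "multi_vertices 3 \<M> = grid_point s t ` set [(4,4), (4,5), (5,4), (5,5)]"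
proof -
  have "multi_vertices 3 \<M> = grid_point s t `
      {v \<in> set vertex_indices. \<exists>e\<in>cndc_indices. \<exists>e'\<in>cndc_indices. e \<noteq> e' \<and> in_box v e \<and> in_box v e'}"
  proof (intro subset_antisym subsetI)
    fix x assume "x \<in> multi_vertices 3 \<M>"
    then obtain v e e' where v: "x = grid_point s t v" "v \<in> set vertex_indices"
        and e: "e \<in> cndc_indices" "e' \<in> cndc_indices" "gbox e \<noteq> gbox e'" "x \<in> gbox e" "x \<in> gbox e'"
      unfolding multi_vertices_def cndc_example vertices_example by blast
    then have "e \<noteq> e'" "in_box v e" "in_box v e'"
      using vertex_in_line[OF v(2)] cndc_subset_lines by (blast, (meson subsetD)+)
    then show "x \<in> grid_point s t ` {v \<in> set vertex_indices. \<exists>e\<in>cndc_indices. \<exists>e'\<in>cndc_indices.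
        e \<noteq> e' \<and> in_box v e \<and> in_box v e'}" using v e by blast
  next
    fix x assume "x \<in> grid_point s t ` {v \<in> set vertex_indices. \<exists>e\<in>cndc_indices. \<exists>e'\<in>cndc_indices.
        e \<noteq> e' \<and> in_box v e \<and> in_box v e'}"
    then obtain v e e' where v: "x = grid_point s t v" "v \<in> set vertex_indices"
        and e: "e \<in> cndc_indices" "e' \<in> cndc_indices" "e \<noteq> e'" "in_box v e" "in_box v e'" by blast
    have l: "e \<in> line_indices" "e' \<in> line_indices" using e(1,2) cndc_subset_lines by (meson subsetD)+
    then have "gbox e \<noteq> gbox e'" using e(3) inj_onD[OF inj_gbox] by metis
    moreover have "x \<in> gbox e \<inter> gbox e'" using vertex_in_line[OF v(2)] l e(4,5) v(1) by simp
    moreover have "x \<in> vertices \<M>" unfolding vertices_example v(1) using v(2) by (rule imageI)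
    ultimately show "x \<in> multi_vertices 3 \<M>"
      unfolding multi_vertices_def cndc_example using e(1,2) by blast
  qed
  also have "{v \<in> set vertex_indices. \<exists>e\<in>cndc_indices. \<exists>e'\<in>cndc_indices. e \<noteq> e' \<and> in_box v e \<and> in_box v e'}
      = set (filter (\<lambda>v. \<exists>e\<in>cndc_indices. \<exists>e'\<in>cndc_indices. e \<noteq> e' \<and> in_box v e \<and> in_box v e') vertex_indices)"
    by simp
  also have "filter (\<lambda>v. \<exists>e\<in>cndc_indices. \<exists>e'\<in>cndc_indices. e \<noteq> e' \<and> in_box v e \<and> in_box v e') vertex_indices
      = [(4,4), (4,5), (5,4), (5,5)]"
    by (simp add: vertex_indices_def cndc_indices_def in_box_def)
  finally show ?thesis .
qed

lemma card_multi_vertices: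
  assumes "\<And>v. v \<in> {4,5} \<times> {4,5} \<Longrightarrow> grid_point s t v \<in> S \<longleftrightarrow> P v"
  shows "card (multi_vertices 3 \<M> \<inter> S) = length (filter P [(4,4), (4,5), (5,4), (5,5)])"
  unfolding multi_vertices_example by (rule card_grid_points) (use assms in auto)

lemma K_base_example: "K_base 3 \<M> = 56"
proof -
  have cc: "card (cross_cuts \<M>) = 7"
    unfolding cross_cuts_example
    by (subst card_image[OF inj_on_subset[OF inj_gbox]]) (simp_all add: line_indices_split cross_cut_indices_def)
  have tt: "card (T_l_edges \<M>) = 5"
    unfolding T_l_edges_example
    by (subst card_image[OF inj_on_subset[OF inj_gbox]]) (simp_all add: line_indices_split T_indices_def)
  have "card (interior_vertices \<M>) = length (filter (\<lambda>(a, b). 1 < a \<and> a < 8 \<and> 1 < b \<and> b < 8) vertex_indices)"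
    unfolding interior_vertices_def
  proof (rule card_vertices)
    fix v assume "v \<in> set vertex_indices"
    then obtain a b where "v = (a, b)" "a \<in> {1..8}" "b \<in> {1..8}" using vertex_indices_bounds by blast
    then show "grid_point s t v \<in> interior (\<Union>\<M>) \<longleftrightarrow> (case v of (a, b) \<Rightarrow> 1 < a \<and> a < 8 \<and> 1 < b \<and> b < 8)"
      using s_less[of 1 a] s_less[of a 8] t_less[of 1 b] t_less[of b 8]
      unfolding Union_example_cells interior_rectangle grid_point_def by auto
  qed
  also have "\<dots> = 32" by (simp add: vertex_indices_def)
  finally show ?thesis unfolding K_base_def cc tt by simp
qed

lemma L_K_example: "L_K 3 \<M> = 56"
proof -
  have "card (cndc 3 \<M>) = 4"
    unfolding cndc_example
    by (subst card_image[OF inj_on_subset[OF inj_gbox cndc_subset_lines]]) (simp add: cndc_indices_def)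
  moreover have "card (vertices \<M> \<inter> \<Union>(cndc 3 \<M>)) = length (filter (\<lambda>v. \<exists>e\<in>cndc_indices. in_box v e) vertex_indices)"
    unfolding cndc_example
  proof (rule card_vertices)
    fix v assume v: "v \<in> set vertex_indices"
    have "\<forall>e\<in>cndc_indices. grid_point s t v \<in> gbox e \<longleftrightarrow> in_box v e"
      using vertex_in_line[OF v] cndc_subset_lines by (meson subsetD)
    then show "grid_point s t v \<in> \<Union>(gbox ` cndc_indices) \<longleftrightarrow> (\<exists>e\<in>cndc_indices. in_box v e)" by simp
  qed
  moreover have "\<dots> = 16" by (simp add: vertex_indices_def cndc_indices_def in_box_def)
  ultimately show ?thesis unfolding L_K_def K_base_example by simp
qed

end

context grid begin

text \<open>
  Whatever comes first in an order of the CNDC contributes \<open>2 - 5 + 4 = 1\<close>; the other three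
  summands vanish if each edge meets one of its predecessors.
\<close>

lemma U_K_example: "U_K 3 \<M> = 57"
proof -
  let ?mv = "multi_vertices 3 \<M>" and ?C = "gbox ` cndc_indices"
  let ?term = "\<lambda>ls i. max (int (card (?mv \<inter> ls ! i)) - int (card (vertices \<M> \<inter> ls ! i)) + int 3 + 1
      - int (card (?mv \<inter> ls ! i \<inter> (\<Union>j<i. ls ! j)))) 0"
  let ?sum = "\<lambda>ls. \<Sum>i<length ls. ?term ls i"
  have mem: "grid_point s t v \<in> gbox e \<longleftrightarrow> in_box v e" if "v \<in> {4,5} \<times> {4,5}" "e \<in> cndc_indices" for v e
  proof (rule grid_point_in_line)
    show "v \<in> {1..8} \<times> {1..8}" using that(1) by auto
    show "e \<in> line_indices" using that(2) cndc_subset_lines by (rule set_mp[rotated])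
  qed
  have cv: "card (vertices \<M> \<inter> gbox e) = 5" if e: "e \<in> cndc_indices" for e
    using card_vertices[OF vertex_in_line] cndc_edge_cards(1)[OF e] set_mp[OF cndc_subset_lines e] by simp
  have cm: "card (?mv \<inter> gbox e) = 2" if e: "e \<in> cndc_indices" for e
  proof -
    have "card (?mv \<inter> gbox e) = length (filter (\<lambda>v. in_box v e) [(4,4), (4,5), (5,4), (5,5)])"
      by (rule card_multi_vertices) (rule mem[OF _ e])
    then show ?thesis using e unfolding cndc_indices_def by (auto simp: in_box_def)
  qed
  have ge: "1 \<le> ?sum ls" if "ls \<in> permutations_of_set ?C" for ls
  proof -
    have ls: "set ls = ?C" using that by (simp add: permutations_of_set_def)
    then have pos: "0 < length ls" by (auto simp: cndc_indices_def)
    then obtain e where e: "e \<in> cndc_indices" "ls ! 0 = gbox e" using ls nth_mem[OF pos] by auto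
    have "?term ls 0 = 1" using cv[OF e(1)] cm[OF e(1)] by (simp add: e(2))
    moreover have "?term ls 0 \<le> ?sum ls"
      by (rule member_le_sum) (use pos in auto)
    ultimately show ?thesis by (rule order_trans[OF eq_refl[OF sym]])
  qed
  define es :: "(nat \<times> nat \<times> nat \<times> nat) list" where "es = [(4,4,3,7), (2,6,5,5), (5,5,2,6), (3,7,4,4)]"
  have es: "set es = cndc_indices" "distinct es" by (auto simp: es_def cndc_indices_def)
  have perm: "map gbox es \<in> permutations_of_set ?C"
    using es inj_on_subset[OF inj_gbox cndc_subset_lines] by (simp add: permutations_of_set_def distinct_map)
  have prev: "card (?mv \<inter> map gbox es ! i \<inter> (\<Union>j<i. map gbox es ! j))
      = length (filter (\<lambda>v. in_box v (es ! i) \<and> (\<exists>j<i. in_box v (es ! j))) [(4,4), (4,5), (5,4), (5,5)])"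
    if i: "i < 4" for i
    unfolding Int_assoc
  proof (rule card_multi_vertices)
    fix v :: "nat \<times> nat" assume v: "v \<in> {4,5} \<times> {4,5}"
    have "grid_point s t v \<in> map gbox es ! j \<longleftrightarrow> in_box v (es ! j)" if "j < 4" for j
    proof -
      have "j < length es" using that by (simp add: es_def)
      then show ?thesis using mem[OF v, of "es ! j"] es(1) nth_mem by fastforce
    qed
    then show "grid_point s t v \<in> map gbox es ! i \<inter> (\<Union>j<i. map gbox es ! j)
        \<longleftrightarrow> in_box v (es ! i) \<and> (\<exists>j<i. in_box v (es ! j))"
      using i by auto
  qed
  have summand: "?term (map gbox es) i
      = max (1 - int (length (filter (\<lambda>v. in_box v (es ! i) \<and> (\<exists>j<i. in_box v (es ! j)))
          [(4,4), (4,5), (5,4), (5,5)]))) 0" if i: "i < 4" for i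
  proof -
    have "i < length es" using i by (simp add: es_def)
    then have "es ! i \<in> cndc_indices" "map gbox es ! i = gbox (es ! i)" using es(1) nth_mem by auto
    then show ?thesis unfolding prev[OF i] using cv cm by simp
  qed
  have "length es = 4" by (simp add: es_def)
  then have "?sum (map gbox es) = (\<Sum>i<4. ?term (map gbox es) i)" by (simp only: length_map)
  also have "\<dots> = (\<Sum>i<4. max (1 - int (length (filter (\<lambda>v. in_box v (es ! i) \<and> (\<exists>j<i. in_box v (es ! j)))
          [(4,4), (4,5), (5,4), (5,5)]))) 0)"
    by (rule sum.cong[OF refl], rule summand) simp
  also have "\<dots> = 1"
    by (simp add: es_def in_box_def numeral_eq_Suc Ex_less_Suc2)
  finally have one: "?sum (map gbox es) = 1" .
  have "Min {?sum ls | ls. ls \<in> permutations_of_set ?C} = 1"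
  proof (rule Min_eqI)
    show "finite {?sum ls | ls. ls \<in> permutations_of_set ?C}" by simp
    show "1 \<le> y" if "y \<in> {?sum ls | ls. ls \<in> permutations_of_set ?C}" for y using that ge by blast
    show "1 \<in> {?sum ls | ls. ls \<in> permutations_of_set ?C}"
      unfolding mem_Collect_eq using perm one by (intro exI[of _ "map gbox es"]) simp
  qed
  then show ?thesis unfolding U_K_def K_base_example cndc_example by simp
qed

end

section \<open>Univariate cubic splines\<close>

definition cubic_polys :: "real poly set" where
  "cubic_polys = {p. degree p \<le> 3}"

lemma cubic_polys_add: "p \<in> cubic_polys \<Longrightarrow> q \<in> cubic_polys \<Longrightarrow> p + q \<in> cubic_polys"
  and cubic_polys_diff: "p \<in> cubic_polys \<Longrightarrow> q \<in> cubic_polys \<Longrightarrow> p - q \<in> cubic_polys"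
  and cubic_polys_smult: "p \<in> cubic_polys \<Longrightarrow> smult c p \<in> cubic_polys"
  and cubic_polys_zero: "0 \<in> cubic_polys"
  by (auto simp: cubic_polys_def intro: degree_add_le degree_diff_le order_trans[OF degree_smult_le])

lemma cubic_polys_sum: "(\<And>i. i \<in> A \<Longrightarrow> f i \<in> cubic_polys) \<Longrightarrow> (\<Sum>i\<in>A. f i) \<in> cubic_polys"
  by (induction A rule: infinite_finite_induct) (auto intro: cubic_polys_add cubic_polys_zero)

lemma cubic_polys_prod_linear:
  fixes x :: "'i \<Rightarrow> real"
  assumes "finite A" "card A \<le> 3"
  shows "(\<Prod>i\<in>A. [:- x i, 1:]) \<in> cubic_polys"
proof -
  have "degree (\<Prod>i\<in>A. [:- x i, 1:]) \<le> (\<Sum>i\<in>A. degree [:- x i, 1:])"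
    using degree_prod_sum_le[OF assms(1), of "\<lambda>i. [:- x i, 1:]"] by (simp add: comp_def)
  then show ?thesis using assms(2) by (simp add: cubic_polys_def)
qed

lemma cubic_polys_power_linear: "[:- a, 1:] ^ 3 \<in> cubic_polys"
  by (simp add: cubic_polys_def degree_power_eq)

lemma poly_cubic:
  assumes "p \<in> cubic_polys"
  shows "poly p x = (\<Sum>k\<le>3. coeff p k * x ^ k)"
proof -
  have "(\<Sum>k\<le>degree p. coeff p k * x ^ k) = (\<Sum>k\<le>3. coeff p k * x ^ k)"
    using assms by (intro sum.mono_neutral_left) (auto simp: cubic_polys_def coeff_eq_0)
  then show ?thesis by (simp add: poly_altdef)
qed

lemma poly_of_coeffs: "\<exists>p\<in>cubic_polys. \<forall>x. poly p x = (\<Sum>k\<le>3. c k * x ^ k)"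
proof (intro bexI allI)
  show "(\<Sum>k\<le>3. monom (c k) k) \<in> cubic_polys"
    by (intro cubic_polys_sum) (auto simp: cubic_polys_def intro: order_trans[OF degree_monom_le])
qed (simp add: poly_sum poly_monom)

lemma poly_zero_on_interval:
  fixes p :: "real poly"
  assumes "a < b" "\<And>x. x \<in> {a..b} \<Longrightarrow> poly p x = 0"
  shows "p = 0"
proof (rule ccontr)
  assume "p \<noteq> 0"
  then have "finite {x. poly p x = 0}" by (rule poly_roots_finite)
  moreover have "{a..b} \<subseteq> {x. poly p x = 0}" using assms(2) by auto
  ultimately have "finite {a..b}" by (rule rev_finite_subset)
  then show False using assms(1) by (simp add: infinite_Icc)
qed

lemma poly_eq_on_interval:
  fixes p q :: "real poly"
  assumes "a < b" "\<And>x. x \<in> {a..b} \<Longrightarrow> poly p x = poly q x"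
  shows "p = q"
  using poly_zero_on_interval[OF assms(1), of "p - q"] assms(2) by simp

text \<open>
  A Taylor expansion at \<open>a\<close>, where only the cubic term is left.
\<close>

lemma cubic_with_triple_zero:
  assumes "p \<in> cubic_polys" "poly p a = 0" "poly (pderiv p) a = 0" "poly (pderiv (pderiv p)) a = 0"
  shows "poly p x = coeff p 3 * (x - a) ^ 3"
proof -
  have "poly (pderiv p) z = (\<Sum>k\<le>2. of_nat (Suc k) * coeff p (Suc k) * z ^ k)" for z
  proof -
    have d: "degree (pderiv p) \<le> 2" using assms(1) by (simp add: cubic_polys_def degree_pderiv)
    have "poly (pderiv p) z = (\<Sum>k\<le>2. coeff (pderiv p) k * z ^ k)"
      unfolding poly_altdef using d by (intro sum.mono_neutral_left) (auto simp: coeff_eq_0)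
    then show ?thesis by (simp add: coeff_pderiv)
  qed
  then have d1: "coeff p 1 + 2 * coeff p 2 * a + 3 * coeff p 3 * a ^ 2 = 0"
    using assms(3) by (simp add: eval_nat_numeral)
  have "poly (pderiv (pderiv p)) z = (\<Sum>k\<le>1. of_nat (Suc k) * (of_nat (Suc (Suc k)) * coeff p (Suc (Suc k))) * z ^ k)" for z
  proof -
    have d: "degree (pderiv (pderiv p)) \<le> 1" using assms(1) by (simp add: cubic_polys_def degree_pderiv)
    have "poly (pderiv (pderiv p)) z = (\<Sum>k\<le>1. coeff (pderiv (pderiv p)) k * z ^ k)"
      unfolding poly_altdef using d by (intro sum.mono_neutral_left) (auto simp: coeff_eq_0)
    then show ?thesis by (simp add: coeff_pderiv)
  qed
  then have d2: "2 * coeff p 2 + 6 * coeff p 3 * a = 0"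
    using assms(4) by (simp add: eval_nat_numeral)
  have d0: "coeff p 0 + coeff p 1 * a + coeff p 2 * a ^ 2 + coeff p 3 * a ^ 3 = 0"
    using assms(2) poly_cubic[OF assms(1), of a] by (simp add: eval_nat_numeral)
  have c2: "coeff p 2 = - 3 * coeff p 3 * a" using d2 by simp
  have c1: "coeff p 1 = 3 * coeff p 3 * a ^ 2" using d1 unfolding c2 by (simp add: power2_eq_square)
  have c0: "coeff p 0 = - coeff p 3 * a ^ 3"
    using d0 unfolding c1 c2 by (simp add: power2_eq_square power3_eq_cube algebra_simps)
  have "poly p x = coeff p 0 + coeff p 1 * x + coeff p 2 * x ^ 2 + coeff p 3 * x ^ 3"
    using poly_cubic[OF assms(1), of x] by (simp add: eval_nat_numeral)
  then show ?thesis
    unfolding c0 c1 c2 by (simp add: power2_eq_square power3_eq_cube algebra_simps)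
qed

lemma ramp_power_has_derivative:
  fixes a :: real
  shows "((\<lambda>x. max 0 (x - a) ^ Suc (Suc n)) has_real_derivative
      real (Suc (Suc n)) * max 0 (x - a) ^ Suc n) (at x)"
proof -
  consider "x < a" | "x > a" | "x = a" by linarith
  then show ?thesis
  proof cases
    case 1
    have "((\<lambda>_. 0) has_real_derivative 0) (at x)" by simp
    then have "((\<lambda>x. max 0 (x - a) ^ Suc (Suc n)) has_real_derivative 0) (at x)"
      by (rule has_field_derivative_transform_within_open[of _ _ _ "{..<a}"]) (use 1 in auto)
    then show ?thesis using 1 by simp
  next
    case 2
    have "((\<lambda>x. x - a) has_real_derivative 1) (at x)" by (auto intro!: derivative_eq_intros)
    from DERIV_power[OF this, of "Suc (Suc n)"]
    have "((\<lambda>x. (x - a) ^ Suc (Suc n)) has_real_derivative real (Suc (Suc n)) * (x - a) ^ Suc n) (at x)"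
      by simp
    then have "((\<lambda>x. max 0 (x - a) ^ Suc (Suc n)) has_real_derivative
        real (Suc (Suc n)) * (x - a) ^ Suc n) (at x)"
      by (rule has_field_derivative_transform_within_open[of _ _ _ "{a<..}"]) (use 2 in auto)
    then show ?thesis using 2 by simp
  next
    case 3
    have "(\<lambda>h. (max 0 (a + h - a) ^ Suc (Suc n) - max 0 (a - a) ^ Suc (Suc n)) / h) \<midarrow>0\<rightarrow> 0"
    proof (rule Lim_null_comparison)
      show "\<forall>\<^sub>F h in at 0. norm ((max 0 (a + h - a) ^ Suc (Suc n) - max 0 (a - a) ^ Suc (Suc n)) / h)
          \<le> \<bar>h\<bar> ^ Suc n"
      proof (rule always_eventually, rule allI)
        fix h :: real
        show "norm ((max 0 (a + h - a) ^ Suc (Suc n) - max 0 (a - a) ^ Suc (Suc n)) / h) \<le> \<bar>h\<bar> ^ Suc n"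
          by (cases "h > 0") (auto simp: abs_mult power_abs max_def mult_nonpos_nonneg)
      qed
      show "((\<lambda>h. \<bar>h\<bar> ^ Suc n) \<longlongrightarrow> 0) (at (0::real))"
        by (auto intro!: tendsto_eq_intros)
    qed
    then show ?thesis unfolding 3 by (simp add: DERIV_def)
  qed
qed

text \<open>
  One-sided derivatives are unique, so \<open>f\<close> inherits them from any function it agrees with on an
  interval, also at the end points.
\<close>

lemma derivative_determined_on_interval:
  fixes f u :: "real \<Rightarrow> real"
  assumes "a < b" "x \<in> {a..b}" "{a..b} \<subseteq> S" "(f has_real_derivative D) (at x within S)"
    "\<And>y. y \<in> {a..b} \<Longrightarrow> f y = u y" "(u has_real_derivative E) (at x)"
  shows "D = E"
proof -
  have "(f has_real_derivative D) (at x within {a..b})"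
    using assms(3,4) by (rule has_field_derivative_subset[rotated])
  moreover have "(f has_real_derivative E) (at x within {a..b})"
    using assms(2,5,6) has_field_derivative_at_within[of u E x "{a..b}"]
    by (intro has_field_derivative_transform_within[of u E x "{a..b}" 1 f]) auto
  ultimately show ?thesis
    using vector_derivative_unique_within_closed_interval[of a b x f D E] assms(1,2)
    by (simp add: has_real_derivative_iff_has_vector_derivative)
qed

text \<open>
  Newton polynomials for the cubic part, truncated powers for the knots \<open>s 2, \<dots>, s 7\<close> (the
  knot \<open>s i\<close> has index \<open>i + 2\<close>).  The interpolation nodes are chosen such that the matrix of
  the values is triangular.
\<close>

definition spline_node :: "(nat \<Rightarrow> real) \<Rightarrow> nat \<Rightarrow> real" where
  "spline_node s a = (if a < 4 then s 1 + real a * (s 2 - s 1) / 3 else s (a - 1))"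

definition spline_basis :: "(nat \<Rightarrow> real) \<Rightarrow> nat \<Rightarrow> real \<Rightarrow> real" where
  "spline_basis s a x = (if a < 4 then \<Prod>m<a. (x - spline_node s m) else max 0 (x - s (a - 2)) ^ 3)"

definition spline_comb :: "(nat \<Rightarrow> real) \<Rightarrow> (nat \<Rightarrow> real) \<Rightarrow> real \<Rightarrow> real" where
  "spline_comb s c x = (\<Sum>a<10. c a * spline_basis s a x)"

definition C2_cubic_spline :: "(nat \<Rightarrow> real) \<Rightarrow> (real \<Rightarrow> real) \<Rightarrow> bool" where
  "C2_cubic_spline s g \<longleftrightarrow> (\<exists>g' g''.
     (\<forall>x\<in>{s 1..s 8}. (g has_real_derivative g' x) (at x within {s 1..s 8})) \<and>
     (\<forall>x\<in>{s 1..s 8}. (g' has_real_derivative g'' x) (at x within {s 1..s 8}))) \<and>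
     (\<forall>i\<in>{1..<8}. \<exists>p\<in>cubic_polys. \<forall>x\<in>{s i..s (Suc i)}. g x = poly p x)"

lemma spline_basis_derivatives:
  "\<exists>d d'. continuous_on UNIV d' \<and>
     (\<forall>x. (spline_basis s a has_real_derivative d x) (at x) \<and> (d has_real_derivative d' x) (at x))"
proof (cases "a < 4")
  case True
  let ?p = "\<Prod>m<a. [:- spline_node s m, 1:]"
  have "spline_basis s a = poly ?p"
    using True by (auto simp: spline_basis_def poly_prod)
  then show ?thesis
    by (intro exI[of _ "poly (pderiv ?p)"] exI[of _ "poly (pderiv (pderiv ?p))"])
      (simp add: poly_DERIV continuous_on_poly continuous_on_id)
next
  case False
  let ?k = "s (a - 2)"
  have eq: "spline_basis s a = (\<lambda>x. max 0 (x - ?k) ^ Suc (Suc 1))"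
    using False by (simp add: spline_basis_def fun_eq_iff eval_nat_numeral)
  have "(spline_basis s a has_real_derivative 3 * max 0 (x - ?k) ^ 2) (at x)" for x
    unfolding eq using ramp_power_has_derivative[of ?k 1 x] by (simp add: eval_nat_numeral)
  moreover have "((\<lambda>x. 3 * max 0 (x - ?k) ^ 2) has_real_derivative 3 * (2 * max 0 (x - ?k))) (at x)" for x
    using DERIV_cmult[OF ramp_power_has_derivative[of ?k 0 x], of 3] by (simp add: eval_nat_numeral)
  moreover have "continuous_on UNIV (\<lambda>x. 3 * (2 * max 0 (x - ?k)))" by (intro continuous_intros)
  ultimately show ?thesis
    by (intro exI[of _ "\<lambda>x. 3 * max 0 (x - ?k) ^ 2"] exI[of _ "\<lambda>x. 3 * (2 * max 0 (x - ?k))"]) blast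
qed

context
  fixes s :: "nat \<Rightarrow> real"
  assumes s: "strict_mono_on {1..8} s"
begin

lemma knot_less: "1 \<le> i \<Longrightarrow> i < j \<Longrightarrow> j \<le> 8 \<Longrightarrow> s i < s j"
  using strict_mono_onD[OF s, of i j] by simp

lemma knot_le: "1 \<le> i \<Longrightarrow> i \<le> j \<Longrightarrow> j \<le> 8 \<Longrightarrow> s i \<le> s j"
  using strict_mono_on_leD[OF s, of i j] by simp

lemma node_le:
  assumes "1 \<le> n" "n \<le> 7" "a < n + 3"
  shows "spline_node s a \<in> {s 1..s (Suc n)}"
proof (cases "a < 4")
  case True
  have "s 1 < s 2" by (rule knot_less) auto
  moreover have "real a * (s 2 - s 1) / 3 \<le> s 2 - s 1"
    using True \<open>s 1 < s 2\<close> by (simp add: field_simps) (use mult_right_mono[of "real a" 3 "s 2 - s 1"] in \<open>simp add: algebra_simps\<close>)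
  moreover have "s 2 \<le> s (Suc n)" using assms by (intro knot_le) auto
  ultimately show ?thesis using True by (simp add: spline_node_def)
next
  case False
  then have "s 1 \<le> s (a - 1)" "s (a - 1) \<le> s (Suc n)" using assms by (intro knot_le; simp)+
  then show ?thesis using False by (simp add: spline_node_def)
qed

lemma basis_zero_left: "4 \<le> a \<Longrightarrow> x \<le> s (a - 2) \<Longrightarrow> spline_basis s a x = 0"
  by (simp add: spline_basis_def)

lemma basis_at_earlier_node:
  assumes "m < a" "a < 10"
  shows "spline_basis s a (spline_node s m) = 0"
proof (cases "a < 4")
  case True
  then show ?thesis using assms(1) by (auto simp: spline_basis_def intro!: prod_zero)
next
  case False
  have "spline_node s m \<le> s (a - 2)"
  proof (cases "m < 4")
    case True
    then have "spline_node s m \<le> s 2" using node_le[of 1 m] by (simp add: eval_nat_numeral)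
    also have "s 2 \<le> s (a - 2)" using False assms by (intro knot_le) auto
    finally show ?thesis .
  next
    case m: False
    then show ?thesis using assms by (auto simp: spline_node_def intro!: knot_le)
  qed
  then show ?thesis using False by (intro basis_zero_left) auto
qed

lemma basis_at_own_node:
  assumes "a < 10"
  shows "spline_basis s a (spline_node s a) \<noteq> 0"
proof (cases "a < 4")
  case True
  have "s 1 < s 2" by (rule knot_less) auto
  then have "spline_node s a \<noteq> spline_node s m" if "m < a" for m
    using that True by (simp add: spline_node_def)
  then show ?thesis using True by (auto simp: spline_basis_def)
next
  case False
  then have "s (a - 2) < s (a - 1)" using assms by (intro knot_less) auto
  then show ?thesis using False by (simp add: spline_basis_def spline_node_def)
qed

lemma spline_comb_at_node:
  assumes "a < 10"
  shows "spline_comb s c (spline_node s a)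
    = (\<Sum>b<a. c b * spline_basis s b (spline_node s a)) + c a * spline_basis s a (spline_node s a)"
proof -
  have "spline_comb s c (spline_node s a) = (\<Sum>b<Suc a. c b * spline_basis s b (spline_node s a))"
    unfolding spline_comb_def
    by (rule sum.mono_neutral_right) (use assms basis_at_earlier_node in auto)
  then show ?thesis by simp
qed

text \<open>
  The nodes \<open>0, \<dots>, n + 2\<close> lie in the interval, and the system of the values there is triangular.
\<close>

lemma spline_comb_zero:
  assumes "1 \<le> n" "n \<le> 7" "\<And>x. x \<in> {s 1..s (Suc n)} \<Longrightarrow> spline_comb s c x = 0" "a < n + 3"
  shows "c a = 0"
  using assms(4)
proof (induction a rule: less_induct)
  case (less a)
  have "0 = spline_comb s c (spline_node s a)"
    using assms(3)[OF node_le[OF assms(1,2) less.prems]] by simp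
  also have "\<dots> = c a * spline_basis s a (spline_node s a)"
    using less assms(2) by (subst spline_comb_at_node) auto
  finally show ?case using basis_at_own_node[of a] less.prems assms(2) by simp
qed

text \<open>To the right of \<open>s n\<close>, the truncated powers for the knots up to \<open>s n\<close> are polynomials.\<close>

lemma basis_cubic_right:
  assumes "1 \<le> n" "n \<le> 8" "a < n + 3"
  shows "\<exists>p\<in>cubic_polys. \<forall>x\<ge>s n. spline_basis s a x = poly p x"
proof (cases "a < 4")
  case True
  then have "(\<Prod>m<a. [:- spline_node s m, 1:]) \<in> cubic_polys" by (intro cubic_polys_prod_linear) auto
  then show ?thesis
    by (rule bexI[rotated]) (use True in \<open>simp add: spline_basis_def poly_prod\<close>)
next
  case False
  have "s (a - 2) \<le> s n" using False assms by (intro knot_le) auto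
  then show ?thesis
    by (intro bexI[OF _ cubic_polys_power_linear[of "s (a - 2)"]])
      (use False in \<open>auto simp: spline_basis_def poly_power\<close>)
qed

lemma comb_cubic_right:
  assumes "1 \<le> n" "n \<le> 8"
  shows "\<exists>p\<in>cubic_polys. \<forall>x\<ge>s n. (\<Sum>a<n + 3. c a * spline_basis s a x) = poly p x"
proof -
  obtain P where P: "\<And>a. a < n + 3 \<Longrightarrow> P a \<in> cubic_polys \<and> (\<forall>x\<ge>s n. spline_basis s a x = poly (P a) x)"
    using basis_cubic_right[OF assms] by metis
  show ?thesis
  proof (intro bexI allI impI)
    show "(\<Sum>a<n + 3. smult (c a) (P a)) \<in> cubic_polys"
      using P by (intro cubic_polys_sum cubic_polys_smult) auto
    show "(\<Sum>a<n + 3. c a * spline_basis s a x) = poly (\<Sum>a<n + 3. smult (c a) (P a)) x" if "x \<ge> s n" for x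
      using P that by (simp add: poly_sum)
  qed
qed

lemma spline_comb_left:
  assumes "1 \<le> n" "n \<le> 7" "x \<le> s (Suc n)"
  shows "spline_comb s c x = (\<Sum>a<n + 3. c a * spline_basis s a x)"
  unfolding spline_comb_def
proof (rule sum.mono_neutral_right)
  show "\<forall>a\<in>{..<10} - {..<n + 3}. c a * spline_basis s a x = 0"
  proof
    fix a assume a: "a \<in> {..<10} - {..<n + 3}"
    then have "s (Suc n) \<le> s (a - 2)" using assms by (intro knot_le) auto
    then show "c a * spline_basis s a x = 0" using assms a by (subst basis_zero_left) auto
  qed
qed (use assms in auto)

text \<open>
  The coefficients are the divided differences of \<open>p\<close>.
\<close>

lemma newton_expansion:
  assumes "p \<in> cubic_polys"
  shows "\<exists>c. \<forall>x. poly p x = (\<Sum>a<4. c a * spline_basis s a x)"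
proof -
  let ?n = "spline_node s"
  let ?a = "coeff p 0" and ?b = "coeff p 1" and ?c = "coeff p 2" and ?d = "coeff p 3"
  define c where "c a = (if a = 0 then ?a + ?b * ?n 0 + ?c * ?n 0 ^ 2 + ?d * ?n 0 ^ 3
    else if a = 1 then ?b + ?c * (?n 0 + ?n 1) + ?d * (?n 0 ^ 2 + ?n 0 * ?n 1 + ?n 1 ^ 2)
    else if a = 2 then ?c + ?d * (?n 0 + ?n 1 + ?n 2) else ?d)" for a :: nat
  have "poly p x = (\<Sum>a<4. c a * spline_basis s a x)" for x
  proof -
    have "poly p x = ?a + ?b * x + ?c * x ^ 2 + ?d * x ^ 3"
      using poly_cubic[OF assms, of x] by (simp add: eval_nat_numeral)
    also have "\<dots> = c 0 + c 1 * (x - ?n 0) + c 2 * ((x - ?n 0) * (x - ?n 1))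
        + c 3 * ((x - ?n 0) * (x - ?n 1) * (x - ?n 2))"
      by (simp add: c_def) (simp add: algebra_simps power2_eq_square power3_eq_cube)
    also have "\<dots> = (\<Sum>a<4. c a * spline_basis s a x)"
      by (simp add: spline_basis_def eval_nat_numeral lessThan_Suc algebra_simps)
    finally show ?thesis .
  qed
  then show ?thesis by blast
qed

text \<open>
  Across a knot two cubics that agree to second order differ by a multiple of the third power,
  which is the next truncated power.
\<close>

lemma C2_spline_extend:
  assumes d1: "\<And>x. x \<in> {s 1..s 8} \<Longrightarrow> (g has_real_derivative g' x) (at x within {s 1..s 8})"
    and d2: "\<And>x. x \<in> {s 1..s 8} \<Longrightarrow> (g' has_real_derivative g'' x) (at x within {s 1..s 8})"
    and piece: "u \<in> cubic_polys" "\<And>x. x \<in> {s (Suc n)..s (Suc (Suc n))} \<Longrightarrow> g x = poly u x"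
    and n: "1 \<le> n" "n \<le> 6"
    and c: "\<And>x. x \<in> {s 1..s (Suc n)} \<Longrightarrow> g x = (\<Sum>a<n + 3. c a * spline_basis s a x)"
  shows "\<exists>k. \<forall>x\<in>{s 1..s (Suc (Suc n))}. g x = (\<Sum>a<n + 3. c a * spline_basis s a x) + k * spline_basis s (n + 3) x"
proof -
  let ?R = "\<lambda>x. \<Sum>a<n + 3. c a * spline_basis s a x" and ?k = "s (Suc n)" and ?e = "s (Suc (Suc n))"
  obtain D D' where D: "\<And>a x. (spline_basis s a has_real_derivative D a x) (at x)"
      "\<And>a x. (D a has_real_derivative D' a x) (at x)"
    using spline_basis_derivatives[of s] by metis
  let ?R' = "\<lambda>x. \<Sum>a<n + 3. c a * D a x" and ?R'' = "\<lambda>x. \<Sum>a<n + 3. c a * D' a x"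
  have R1: "(?R has_real_derivative ?R' x) (at x)" and R2: "(?R' has_real_derivative ?R'' x) (at x)" for x
    by (intro DERIV_sum DERIV_cmult D)+
  obtain v where v: "v \<in> cubic_polys" "\<And>x. x \<ge> s n \<Longrightarrow> ?R x = poly v x"
    using comb_cubic_right[of n c] n by auto
  have k: "s 1 < ?k" "s n < ?k" "?k < ?e" "?e \<le> s 8"
    using n by (auto intro!: knot_less knot_le)
  have left: "{s 1..?k} \<subseteq> {s 1..s 8}" and right: "{?k..?e} \<subseteq> {s 1..s 8}" using k by auto
  have eq1: "g' x = ?R' x" if "x \<in> {s 1..?k}" for x
    by (rule derivative_determined_on_interval[OF k(1) that left d1 c R1]) (use left that in auto)
  have eq2: "g'' x = ?R'' x" if "x \<in> {s 1..?k}" for x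
    by (rule derivative_determined_on_interval[OF k(1) that left d2 eq1 R2]) (use left that in auto)
  have u1: "g' x = poly (pderiv u) x" if "x \<in> {?k..?e}" for x
    by (rule derivative_determined_on_interval[OF k(3) that right d1 piece(2) poly_DERIV])
      (use right that in auto)
  have u2: "g'' x = poly (pderiv (pderiv u)) x" if "x \<in> {?k..?e}" for x
    by (rule derivative_determined_on_interval[OF k(3) that right d2 u1 poly_DERIV])
      (use right that in auto)
  have v1: "?R' x = poly (pderiv v) x" if "x \<in> {?k..?e}" for x
    by (rule derivative_determined_on_interval[OF k(3) that subset_UNIV R1 _ poly_DERIV])
      (use v(2) k in auto)
  have v2: "?R'' x = poly (pderiv (pderiv v)) x" if "x \<in> {?k..?e}" for x
    by (rule derivative_determined_on_interval[OF k(3) that subset_UNIV R2 v1 poly_DERIV])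
  have "poly (u - v) x = coeff (u - v) 3 * (x - ?k) ^ 3" for x
  proof (rule cubic_with_triple_zero)
    show "u - v \<in> cubic_polys" by (rule cubic_polys_diff[OF piece(1) v(1)])
    show "poly (u - v) ?k = 0" using piece(2)[of ?k] c[of ?k] v(2)[of ?k] k by simp
    show "poly (pderiv (u - v)) ?k = 0"
      using u1[of ?k] v1[of ?k] eq1[of ?k] k by (simp add: pderiv_diff)
    show "poly (pderiv (pderiv (u - v))) ?k = 0"
      using u2[of ?k] v2[of ?k] eq2[of ?k] k by (simp add: pderiv_diff)
  qed
  then have jump: "poly u x = poly v x + coeff (u - v) 3 * (x - ?k) ^ 3" for x
    by (metis add_diff_cancel_left' diff_add_cancel poly_diff add.commute)
  have basis: "spline_basis s (n + 3) x = max 0 (x - ?k) ^ 3" for x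
    using n by (simp add: spline_basis_def)
  show ?thesis
  proof (intro exI ballI)
    fix x assume x: "x \<in> {s 1..?e}"
    show "g x = ?R x + coeff (u - v) 3 * spline_basis s (n + 3) x"
    proof (cases "x \<le> ?k")
      case True
      then show ?thesis using c[of x] x by (simp add: basis)
    next
      case False
      then show ?thesis using jump[of x] piece(2)[of x] v(2)[of x] x k by (simp add: basis)
    qed
  qed
qed

lemma C2_cubic_spline_eq_comb:
  assumes "C2_cubic_spline s g"
  shows "\<exists>c. \<forall>x\<in>{s 1..s 8}. g x = spline_comb s c x"
proof -
  obtain g' g'' where d1: "\<And>x. x \<in> {s 1..s 8} \<Longrightarrow> (g has_real_derivative g' x) (at x within {s 1..s 8})"
      and d2: "\<And>x. x \<in> {s 1..s 8} \<Longrightarrow> (g' has_real_derivative g'' x) (at x within {s 1..s 8})"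
    using assms unfolding C2_cubic_spline_def by blast
  have piece: "\<exists>u\<in>cubic_polys. \<forall>x\<in>{s i..s (Suc i)}. g x = poly u x" if "i \<in> {1..<8}" for i
    using assms that unfolding C2_cubic_spline_def by blast
  have "n \<le> 6 \<Longrightarrow> \<exists>c. \<forall>x\<in>{s 1..s (Suc (Suc n))}. g x = (\<Sum>a<Suc n + 3. c a * spline_basis s a x)" for n
  proof (induction n)
    case 0
    obtain u where u: "u \<in> cubic_polys" "\<And>x. x \<in> {s 1..s (Suc 1)} \<Longrightarrow> g x = poly u x"
      using piece[of 1] by auto
    obtain c where "\<And>x. poly u x = (\<Sum>a<4. c a * spline_basis s a x)" using newton_expansion[OF u(1)] by blast
    then show ?case using u(2) by (intro exI[of _ c]) auto
  next
    case (Suc n)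
    then obtain c where c: "\<And>x. x \<in> {s 1..s (Suc (Suc n))} \<Longrightarrow> g x = (\<Sum>a<Suc n + 3. c a * spline_basis s a x)"
      by auto
    obtain u where u: "u \<in> cubic_polys" "\<And>x. x \<in> {s (Suc (Suc n))..s (Suc (Suc (Suc n)))} \<Longrightarrow> g x = poly u x"
      using piece[of "Suc (Suc n)"] Suc.prems by auto
    obtain k where k: "\<And>x. x \<in> {s 1..s (Suc (Suc (Suc n)))} \<Longrightarrow>
        g x = (\<Sum>a<Suc n + 3. c a * spline_basis s a x) + k * spline_basis s (Suc n + 3) x"
      using C2_spline_extend[OF d1 d2 u, where c = c] c Suc.prems by force
    show ?case
    proof (intro exI ballI)
      fix x assume x: "x \<in> {s 1..s (Suc (Suc (Suc n)))}"
      have "(\<Sum>a<Suc n + 3. (c(Suc n + 3 := k)) a * spline_basis s a x) = (\<Sum>a<Suc n + 3. c a * spline_basis s a x)"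
        by (rule sum.cong) auto
      moreover have "Suc (Suc n) + 3 = Suc (Suc n + 3)" by simp
      ultimately show "g x = (\<Sum>a<Suc (Suc n) + 3. (c(Suc n + 3 := k)) a * spline_basis s a x)"
        using k[OF x] by (simp only: sum.lessThan_Suc fun_upd_same)
    qed
  qed
  from this[of 6] show ?thesis by (simp add: spline_comb_def eval_nat_numeral)
qed

text \<open>
  Left of \<open>s k\<close> the spline is given by the functions with smaller index, whose cubic there would
  continue unchanged; the truncated power is the whole difference to the right of \<open>s k\<close>.
\<close>

lemma no_jump:
  assumes k: "2 \<le> k" "k \<le> 7" and p: "p \<in> cubic_polys"
    and eq: "\<And>x. x \<in> {s (k - 1)..s (Suc k)} \<Longrightarrow> spline_comb s c x = poly p x"
  shows "c (k + 2) = 0"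
proof -
  have "1 \<le> k - 1" "k - 1 \<le> 8" using k by auto
  from comb_cubic_right[OF this, where c = c]
  obtain v where v: "v \<in> cubic_polys" "\<And>x. x \<ge> s (k - 1) \<Longrightarrow> (\<Sum>a<k + 2. c a * spline_basis s a x) = poly v x"
    using k(1) by (auto simp: numeral_eq_Suc Suc_diff_Suc)
  have less: "s (k - 1) < s k" "s k < s (Suc k)" using k by (auto intro!: knot_less)
  have "p = v"
  proof (rule poly_eq_on_interval[OF less(1)])
    fix x assume x: "x \<in> {s (k - 1)..s k}"
    have "spline_comb s c x = (\<Sum>a<k - 1 + 3. c a * spline_basis s a x)"
      using k x by (intro spline_comb_left) auto
    moreover have "k - 1 + 3 = k + 2" using k by simp
    ultimately show "poly p x = poly v x" using eq[of x] v(2)[of x] x less by simp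
  qed
  moreover have "spline_comb s c (s (Suc k)) = (\<Sum>a<k + 3. c a * spline_basis s a (s (Suc k)))"
    using k by (intro spline_comb_left) auto
  moreover have "\<dots> = (\<Sum>a<k + 2. c a * spline_basis s a (s (Suc k))) + c (k + 2) * (s (Suc k) - s k) ^ 3"
    using less k by (simp add: numeral_eq_Suc spline_basis_def)
  ultimately have "c (k + 2) * (s (Suc k) - s k) ^ 3 = 0"
    using eq[of "s (Suc k)"] v(2)[of "s (Suc k)"] less by simp
  then show ?thesis using less(2) by simp
qed

lemma basis_cubic_on:
  assumes "a < 10" "1 \<le> i" "i < i'" "i' \<le> 8" "a < 4 \<or> a - 2 \<le> i \<or> i' \<le> a - 2"
  shows "\<exists>p\<in>cubic_polys. \<forall>x\<in>{s i..s i'}. spline_basis s a x = poly p x"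
proof (cases "a < i + 3")
  case True
  then show ?thesis using basis_cubic_right[of i a] assms by fastforce
next
  case False
  then have "4 \<le> a" "s i' \<le> s (a - 2)" using assms by (auto intro!: knot_le)
  then show ?thesis using basis_zero_left by (intro bexI[OF _ cubic_polys_zero]) auto
qed

text \<open>
  The coefficients of the polynomial \<open>\<Sum>j. c j * (y - x j)\<^sup>3\<close> in \<open>y\<close> are, up to binomial factors,
  the first four moments of the weights \<open>c\<close> at the nodes \<open>x\<close>.
\<close>

lemma moments_of_vanishing_comb:
  assumes J: "finite J" and ab: "a < b"
    and zero: "\<And>y. y \<in> {a..b} \<Longrightarrow> (\<Sum>j\<in>J. c j * (y - x j) ^ 3) = 0"
    and r: "r \<in> cubic_polys"
  shows "(\<Sum>j\<in>J. c j * poly r (x j)) = 0"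
proof -
  let ?M = "\<lambda>k. \<Sum>j\<in>J. c j * x j ^ k"
  let ?p = "[:- ?M 3, 3 * ?M 2, - 3 * ?M 1, ?M 0:]"
  have "poly ?p y = (\<Sum>j\<in>J. c j * (y - x j) ^ 3)" for y
  proof -
    have "c j * (y - x j) ^ 3 = - (c j * x j ^ 3) + y * (3 * (c j * x j ^ 2)) - y ^ 2 * (3 * (c j * x j)) + y ^ 3 * c j" for j
      by (simp add: power2_eq_square power3_eq_cube algebra_simps)
    then have "(\<Sum>j\<in>J. c j * (y - x j) ^ 3)
        = - ?M 3 + y * (3 * ?M 2) - y ^ 2 * (3 * ?M 1) + y ^ 3 * ?M 0"
      by (simp add: sum.distrib sum_subtractf sum_negf sum_distrib_left)
    then show ?thesis by (simp add: power2_eq_square power3_eq_cube algebra_simps)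
  qed
  then have "?p = 0" using zero by (intro poly_zero_on_interval[OF ab]) simp
  then have M: "?M 0 = 0" "?M 1 = 0" "?M 2 = 0" "?M 3 = 0" by auto
  have "(\<Sum>j\<in>J. c j * poly r (x j)) = (\<Sum>j\<in>J. \<Sum>k\<le>3. coeff r k * (c j * x j ^ k))"
    unfolding poly_cubic[OF r] by (simp add: sum_distrib_left mult_ac)
  also have "\<dots> = (\<Sum>k\<le>3. coeff r k * ?M k)"
    unfolding sum_distrib_left by (rule sum.swap)
  also have "\<dots> = 0" using M by (simp add: eval_nat_numeral)
  finally show ?thesis .
qed

lemma comb_right_of_knots:
  assumes c: "\<And>b. b < p + 2 \<Longrightarrow> c b = 0" and pq: "2 \<le> p" "p \<le> q" "q \<le> 7" and y: "y \<ge> s q"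
  shows "(\<Sum>b<q + 3. c b * spline_basis s b y) = (\<Sum>j\<in>{p..q}. c (j + 2) * (y - s j) ^ 3)"
proof -
  have "(\<Sum>b<q + 3. c b * spline_basis s b y) = (\<Sum>b\<in>{p + 2..q + 2}. c b * spline_basis s b y)"
    using c pq by (intro sum.mono_neutral_right) auto
  also have "\<dots> = (\<Sum>j\<in>{p..q}. c (j + 2) * spline_basis s (j + 2) y)"
    by (rule sum.shift_bounds_cl_nat_ivl)
  also have "\<dots> = (\<Sum>j\<in>{p..q}. c (j + 2) * (y - s j) ^ 3)"
  proof (rule sum.cong[OF refl])
    fix j assume "j \<in> {p..q}"
    then have "s j \<le> s q" "2 \<le> j" using pq by (auto intro!: knot_le)
    then show "c (j + 2) * spline_basis s (j + 2) y = c (j + 2) * (y - s j) ^ 3"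
      using y by (simp add: spline_basis_def)
  qed
  finally show ?thesis .
qed

text \<open>
  The restrictions on the coefficients along a grid line of which the mesh contains the part from
  \<open>s p\<close> to \<open>s q\<close>: below \<open>s p\<close> all functions involved are independent, and above \<open>s q\<close> the truncated
  powers of the edge have to cancel before the remaining ones come in.
\<close>

lemma edge_coefficients:
  assumes pq: "2 \<le> p" "p < q" "q \<le> 7"
    and lo: "\<And>y. y \<in> {s 1..s p} \<Longrightarrow> spline_comb s c y = 0"
    and hi: "\<And>y. y \<in> {s q..s 8} \<Longrightarrow> spline_comb s c y = 0"
  shows "b < p + 2 \<Longrightarrow> c b = 0"
    and "q + 2 < b \<Longrightarrow> b < 10 \<Longrightarrow> c b = 0"
    and "r \<in> cubic_polys \<Longrightarrow> (\<Sum>j\<in>{p..q}. c (j + 2) * poly r (s j)) = 0"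
proof -
  show low: "c b = 0" if "b < p + 2" for b
    by (rule spline_comb_zero[of "p - 1"]) (use pq lo that in auto)
  have "s q < s (Suc q)" "s (Suc q) \<le> s 8" using pq by (auto intro!: knot_less knot_le)
  then have zero: "(\<Sum>j\<in>{p..q}. c (j + 2) * (y - s j) ^ 3) = 0" if "y \<in> {s q..s (Suc q)}" for y
    using comb_right_of_knots[OF low pq(1) _ pq(3), where y = y] spline_comb_left[of q y c] hi[of y] pq that by auto
  show mom: "(\<Sum>j\<in>{p..q}. c (j + 2) * poly r (s j)) = 0" if "r \<in> cubic_polys" for r
    using moments_of_vanishing_comb[OF _ \<open>s q < s (Suc q)\<close> zero that] by simp
  show "c b = 0" if b: "q + 2 < b" "b < 10" for b
  proof -
    let ?c = "\<lambda>b. if b < q + 3 then 0 else c b"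
    have "?c b = 0"
    proof (rule spline_comb_zero[of 7])
      fix y assume y: "y \<in> {s 1..s (Suc 7)}"
      have split: "spline_comb s c y = (\<Sum>b<q + 3. c b * spline_basis s b y) + spline_comb s ?c y"
      proof -
        have "spline_comb s c y = (\<Sum>b<10. (if b < q + 3 then c b * spline_basis s b y else 0) + ?c b * spline_basis s b y)"
          unfolding spline_comb_def by (rule sum.cong) auto
        also have "\<dots> = (\<Sum>b<10. if b < q + 3 then c b * spline_basis s b y else 0) + spline_comb s ?c y"
          unfolding spline_comb_def by (rule sum.distrib)
        also have "(\<Sum>b<10. if b < q + 3 then c b * spline_basis s b y else 0) = (\<Sum>b<q + 3. c b * spline_basis s b y)"
          using pq by (intro sum.mono_neutral_cong_right) auto
        finally show ?thesis .
      qed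
      show "spline_comb s ?c y = 0"
      proof (cases "y \<le> s q")
        case True
        have "?c b * spline_basis s b y = 0" if "b < 10" for b
        proof (cases "b < q + 3")
          case False
          then have "s q \<le> s (b - 2)" using pq that by (intro knot_le) auto
          then show ?thesis using True False pq by (subst basis_zero_left) auto
        qed simp
        then show ?thesis unfolding spline_comb_def by (intro sum.neutral) auto
      next
        case False
        have "(\<Sum>j\<in>{p..q}. c (j + 2) * (y - s j) ^ 3)
            = (\<Sum>j\<in>{p..q}. c (j + 2) * poly ([:y, -1:] ^ 3) (s j))"
          by (simp add: poly_power)
        also have "\<dots> = 0" by (rule mom) (simp add: cubic_polys_def degree_power_eq)
        finally show ?thesis
          using split comb_right_of_knots[OF low pq(1) _ pq(3), where y = y] hi[of y] pq y False by simp
      qed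
    qed (use b in auto)
    then show ?thesis using b by simp
  qed
qed

lemma edge_coefficients_converse:
  assumes pq: "2 \<le> p" "p < q" "q \<le> 7"
    and lo: "\<And>b. b < p + 2 \<Longrightarrow> c b = 0" and hi: "\<And>b. q + 2 < b \<Longrightarrow> b < 10 \<Longrightarrow> c b = 0"
    and mom: "\<And>r. r \<in> cubic_polys \<Longrightarrow> (\<Sum>j\<in>{p..q}. c (j + 2) * poly r (s j)) = 0"
    and y: "y \<le> s p \<or> s q \<le> y"
  shows "spline_comb s c y = 0"
  using y
proof
  assume y: "y \<le> s p"
  have "c b * spline_basis s b y = 0" if "b < 10" for b
  proof (cases "b < p + 2")
    case False
    then have "s p \<le> s (b - 2)" using pq that by (intro knot_le) auto
    then show ?thesis using y False pq by (subst basis_zero_left) auto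
  qed (simp add: lo)
  then show ?thesis unfolding spline_comb_def by (intro sum.neutral) auto
next
  assume y: "s q \<le> y"
  have "spline_comb s c y = (\<Sum>b<q + 3. c b * spline_basis s b y)"
    unfolding spline_comb_def using pq hi by (intro sum.mono_neutral_right) auto
  also have "\<dots> = (\<Sum>j\<in>{p..q}. c (j + 2) * (y - s j) ^ 3)"
    using comb_right_of_knots[OF lo pq(1) _ pq(3) y] pq by simp
  also have "\<dots> = (\<Sum>j\<in>{p..q}. c (j + 2) * poly ([:y, -1:] ^ 3) (s j))"
    by (simp add: poly_power)
  also have "\<dots> = 0" by (rule mom) (simp add: cubic_polys_def degree_power_eq)
  finally show ?thesis .
qed

end

text \<open>
  Testing with the cubic that vanishes at the at most three other nodes isolates a single weight.
\<close>

lemma moments_four_nodes: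
  fixes x c :: "'i \<Rightarrow> real"
  assumes J: "finite J" "inj_on x J" and N: "N \<subseteq> J" "card N \<le> 4"
    and mom: "\<And>r. r \<in> cubic_polys \<Longrightarrow> (\<Sum>j\<in>J. c j * poly r (x j)) = 0"
    and zero: "\<And>j. j \<in> J - N \<Longrightarrow> c j = 0" and i: "i \<in> J"
  shows "c i = 0"
proof (cases "i \<in> N")
  case True
  let ?r = "\<Prod>j\<in>N - {i}. [:- x j, 1:]"
  have fin: "finite N" using J(1) N(1) by (rule rev_finite_subset)
  have "?r \<in> cubic_polys" using fin N(2) True by (intro cubic_polys_prod_linear) auto
  then have "0 = (\<Sum>j\<in>J. c j * poly ?r (x j))" using mom by simp
  also have "\<dots> = (\<Sum>j\<in>{i}. c j * poly ?r (x j))"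
  proof (rule sum.mono_neutral_right)
    show "\<forall>j\<in>J - {i}. c j * poly ?r (x j) = 0"
    proof
      fix j assume j: "j \<in> J - {i}"
      show "c j * poly ?r (x j) = 0"
      proof (cases "j \<in> N")
        case True
        then have "poly ?r (x j) = 0" using fin j by (auto simp: poly_prod intro!: prod_zero)
        then show ?thesis by simp
      qed (use zero j in simp)
    qed
  qed (use J i in auto)
  finally have "c i * poly ?r (x i) = 0" by simp
  moreover have "poly ?r (x i) \<noteq> 0"
    using fin J(2) N(1) i by (auto simp: poly_prod inj_on_def)
  ultimately show ?thesis by simp
qed (use zero i in simp)

text \<open>
  Lagrange interpolation at four nodes expresses the value of a cubic at the fifth.
\<close>

lemma moments_five_nodes:
  fixes x :: "'i \<Rightarrow> real"
  assumes N: "finite N" "card N = 4" "i \<notin> N" "inj_on x (insert i N)"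
  obtains w where "w i = 1" "\<And>j. j \<notin> insert i N \<Longrightarrow> w j = 0"
    "\<And>r. r \<in> cubic_polys \<Longrightarrow> (\<Sum>j\<in>insert i N. w j * poly r (x j)) = 0"
proof -
  let ?l = "\<lambda>j. \<Prod>m\<in>N - {j}. [:- x m, 1:]"
  define L where "L j = smult (1 / poly (?l j) (x j)) (?l j)" for j
  have l0: "poly (?l j) (x j) \<noteq> 0" if "j \<in> N" for j
    using that N by (auto simp: poly_prod inj_on_def)
  have Lc: "L j \<in> cubic_polys" if "j \<in> N" for j
    unfolding L_def using that N by (intro cubic_polys_smult cubic_polys_prod_linear) auto
  have L: "poly (L j) (x m) = (if m = j then 1 else 0)" if "j \<in> N" "m \<in> N" for j m
  proof (cases "m = j")
    case False
    then have "poly (?l j) (x m) = 0" using that N(1) by (auto simp: poly_prod intro!: prod_zero)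
    then show ?thesis using False by (simp add: L_def)
  qed (use l0[OF that(1)] in \<open>simp add: L_def\<close>)
  have interp: "r = (\<Sum>j\<in>N. smult (poly r (x j)) (L j))" if r: "r \<in> cubic_polys" for r
  proof (rule ccontr)
    assume ne: "r \<noteq> (\<Sum>j\<in>N. smult (poly r (x j)) (L j))"
    let ?q = "r - (\<Sum>j\<in>N. smult (poly r (x j)) (L j))"
    have "?q \<in> cubic_polys" using r Lc by (intro cubic_polys_diff cubic_polys_sum cubic_polys_smult)
    moreover have "x ` N \<subseteq> {y. poly ?q y = 0}"
    proof
      fix y assume "y \<in> x ` N"
      then obtain m where m: "m \<in> N" "y = x m" by blast
      have "(\<Sum>j\<in>N. poly r (x j) * poly (L j) (x m)) = (\<Sum>j\<in>N. if m = j then poly r (x j) else 0)"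
        using L m(1) by (intro sum.cong) auto
      then show "y \<in> {y. poly ?q y = 0}" using m N(1) by (simp add: poly_sum)
    qed
    moreover have "card (x ` N) = 4" using N by (simp add: card_image)
    moreover have "?q \<noteq> 0" using ne by simp
    ultimately have "4 \<le> degree ?q"
      using card_mono[OF poly_roots_finite[OF \<open>?q \<noteq> 0\<close>]] card_poly_roots_bound[OF \<open>?q \<noteq> 0\<close>]
      by (metis (no_types, lifting) le_trans)
    then show False using \<open>?q \<in> cubic_polys\<close> by (simp add: cubic_polys_def)
  qed
  define w where "w j = (if j = i then 1 else if j \<in> N then - poly (L j) (x i) else 0)" for j
  show thesis
  proof (rule that[of w])
    show "w i = 1" by (simp add: w_def)
    show "w j = 0" if "j \<notin> insert i N" for j using that by (simp add: w_def)
    fix r :: "real poly" assume r: "r \<in> cubic_polys"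
    have "(\<Sum>j\<in>N. w j * poly r (x j)) = - (\<Sum>j\<in>N. poly r (x j) * poly (L j) (x i))"
      unfolding sum_negf[symmetric] using N(3) by (intro sum.cong) (auto simp: w_def)
    also have "\<dots> = - poly r (x i)" using arg_cong[OF interp[OF r], of "\<lambda>p. poly p (x i)"] by (simp add: poly_sum)
    finally show "(\<Sum>j\<in>insert i N. w j * poly r (x j)) = 0"
      using N(1,3) by (simp add: w_def)
  qed
qed

section \<open>The spline space in coordinates\<close>

lemma derivative_along_x_iff:
  fixes f :: "real \<times> real \<Rightarrow> real"
  assumes "y \<in> B"
  shows "((\<lambda>h. f ((x, y) + h *\<^sub>R (1, 0))) has_real_derivative D) (at 0 within {h. (x, y) + h *\<^sub>R (1, 0) \<in> A \<times> B})
    \<longleftrightarrow> ((\<lambda>x. f (x, y)) has_real_derivative D) (at x within A)"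
proof -
  have "A = (+) x ` {h. x + h \<in> A}" by (auto intro!: image_eqI[of _ _ "_ - x"])
  then show ?thesis
    using DERIV_at_within_shift[of "\<lambda>x. f (x, y)" D x 0 "{h. x + h \<in> A}"] assms by simp
qed

lemma derivative_along_y_iff:
  fixes f :: "real \<times> real \<Rightarrow> real"
  assumes "x \<in> A"
  shows "((\<lambda>h. f ((x, y) + h *\<^sub>R (0, 1))) has_real_derivative D) (at 0 within {h. (x, y) + h *\<^sub>R (0, 1) \<in> A \<times> B})
    \<longleftrightarrow> ((\<lambda>y. f (x, y)) has_real_derivative D) (at y within B)"
proof -
  have "B = (+) y ` {h. y + h \<in> B}" by (auto intro!: image_eqI[of _ _ "_ - y"])
  then show ?thesis
    using DERIV_at_within_shift[of "\<lambda>y. f (x, y)" D y 0 "{h. y + h \<in> B}"] assms by simp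
qed

lemma Ck_along_x_2:
  assumes "Ck_along (1, 0) 2 (A \<times> B) f" "y \<in> B"
  obtains g' g'' where "\<And>x. x \<in> A \<Longrightarrow> ((\<lambda>x. f (x, y)) has_real_derivative g' x) (at x within A)"
    "\<And>x. x \<in> A \<Longrightarrow> (g' has_real_derivative g'' x) (at x within A)"
proof -
  obtain g h where
    g: "\<forall>p\<in>A \<times> B. ((\<lambda>h. f (p + h *\<^sub>R (1, 0))) has_real_derivative g p) (at 0 within {h. p + h *\<^sub>R (1, 0) \<in> A \<times> B})"
    and h: "\<forall>p\<in>A \<times> B. ((\<lambda>h. g (p + h *\<^sub>R (1, 0))) has_real_derivative h p) (at 0 within {h. p + h *\<^sub>R (1, 0) \<in> A \<times> B})"
    using assms(1) unfolding numeral_2_eq_2 Ck_along.simps by blast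
  show thesis
  proof (rule that)
    fix x assume x: "x \<in> A"
    show "((\<lambda>x. f (x, y)) has_real_derivative g (x, y)) (at x within A)"
      using bspec[OF g, of "(x, y)"] x assms(2) unfolding derivative_along_x_iff[OF assms(2)] by simp
    show "((\<lambda>x. g (x, y)) has_real_derivative h (x, y)) (at x within A)"
      using bspec[OF h, of "(x, y)"] x assms(2) unfolding derivative_along_x_iff[OF assms(2)] by simp
  qed
qed

lemma Ck_along_y_2:
  assumes "Ck_along (0, 1) 2 (A \<times> B) f" "x \<in> A"
  obtains g' g'' where "\<And>y. y \<in> B \<Longrightarrow> ((\<lambda>y. f (x, y)) has_real_derivative g' y) (at y within B)"
    "\<And>y. y \<in> B \<Longrightarrow> (g' has_real_derivative g'' y) (at y within B)"
proof -
  obtain g h where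
    g: "\<forall>p\<in>A \<times> B. ((\<lambda>h. f (p + h *\<^sub>R (0, 1))) has_real_derivative g p) (at 0 within {h. p + h *\<^sub>R (0, 1) \<in> A \<times> B})"
    and h: "\<forall>p\<in>A \<times> B. ((\<lambda>h. g (p + h *\<^sub>R (0, 1))) has_real_derivative h p) (at 0 within {h. p + h *\<^sub>R (0, 1) \<in> A \<times> B})"
    using assms(1) unfolding numeral_2_eq_2 Ck_along.simps by blast
  show thesis
  proof (rule that)
    fix y assume y: "y \<in> B"
    show "((\<lambda>y. f (x, y)) has_real_derivative g (x, y)) (at y within B)"
      using bspec[OF g, of "(x, y)"] y assms(2) unfolding derivative_along_y_iff[OF assms(2)] by simp
    show "((\<lambda>y. g (x, y)) has_real_derivative h (x, y)) (at y within B)"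
      using bspec[OF h, of "(x, y)"] y assms(2) unfolding derivative_along_y_iff[OF assms(2)] by simp
  qed
qed

lemma Ck_along_cong:
  assumes "\<And>p. p \<in> \<Phi> \<Longrightarrow> f p = g p" "Ck_along v k \<Phi> f"
  shows "Ck_along v k \<Phi> g"
proof (cases k)
  case 0
  then show ?thesis using assms continuous_on_cong[of \<Phi> \<Phi> f g] by simp
next
  case (Suc n)
  then obtain h where h: "\<forall>p\<in>\<Phi>. ((\<lambda>h. f (p + h *\<^sub>R v)) has_real_derivative h p) (at 0 within {h. p + h *\<^sub>R v \<in> \<Phi>})"
      "Ck_along v n \<Phi> h" and cont: "continuous_on \<Phi> f"
    using assms(2) by auto
  have "((\<lambda>h. g (p + h *\<^sub>R v)) has_real_derivative h p) (at 0 within {h. p + h *\<^sub>R v \<in> \<Phi>})" if p: "p \<in> \<Phi>" for p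
    by (rule has_field_derivative_transform_within[OF bspec[OF h(1) p], of 1]) (use assms(1) p in auto)
  moreover have "continuous_on \<Phi> g" using cont continuous_on_cong[of \<Phi> \<Phi> f g] assms(1) by simp
  ultimately show ?thesis unfolding Suc Ck_along.simps using h(2) by blast
qed

lemma bidegree_poly_products:
  assumes "finite A" "\<And>a. a \<in> A \<Longrightarrow> p a \<in> cubic_polys" "\<And>a. a \<in> A \<Longrightarrow> q a \<in> cubic_polys"
    and f: "\<And>x y. (x, y) \<in> K \<Longrightarrow> f (x, y) = (\<Sum>a\<in>A. poly (p a) x * poly (q a) y)"
  shows "bidegree_poly_on 3 K f"
  unfolding bidegree_poly_on_def
proof (intro exI ballI, clarify)
  fix x y assume "(x, y) \<in> K"
  then have "f (x, y) = (\<Sum>a\<in>A. (\<Sum>i\<le>3. coeff (p a) i * x ^ i) * (\<Sum>j\<le>3. coeff (q a) j * y ^ j))"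
    using f assms(2,3) poly_cubic by simp
  also have "\<dots> = (\<Sum>a\<in>A. \<Sum>i\<le>3. \<Sum>j\<le>3. coeff (p a) i * coeff (q a) j * x ^ i * y ^ j)"
    by (simp add: sum_product mult_ac)
  also have "\<dots> = (\<Sum>i\<le>3. \<Sum>j\<le>3. (\<Sum>a\<in>A. coeff (p a) i * coeff (q a) j) * x ^ i * y ^ j)"
    by (subst sum.swap, rule sum.cong[OF refl], subst sum.swap) (simp add: sum_distrib_right)
  finally show "f (x, y) = (\<Sum>i\<le>3. \<Sum>j\<le>3. (\<Sum>a\<in>A. coeff (p a) i * coeff (q a) j) * x ^ i * y ^ j)" .
qed

lemma bidegree_poly_slices:
  assumes "bidegree_poly_on 3 K f"
  shows "\<exists>p\<in>cubic_polys. \<forall>x. (x, y) \<in> K \<longrightarrow> f (x, y) = poly p x"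
    and "\<exists>p\<in>cubic_polys. \<forall>y. (x, y) \<in> K \<longrightarrow> f (x, y) = poly p y"
proof -
  obtain a where a: "\<And>x y. (x, y) \<in> K \<Longrightarrow> f (x, y) = (\<Sum>i\<le>3. \<Sum>j\<le>3. a i j * x ^ i * y ^ j)"
    using assms unfolding bidegree_poly_on_def by blast
  obtain p where p: "p \<in> cubic_polys" "\<And>x. poly p x = (\<Sum>i\<le>3. (\<Sum>j\<le>3. a i j * y ^ j) * x ^ i)"
    using poly_of_coeffs[of "\<lambda>i. \<Sum>j\<le>3. a i j * y ^ j"] by blast
  have "f (x, y) = poly p x" if "(x, y) \<in> K" for x
    unfolding a[OF that] p(2) by (simp add: sum_distrib_left mult_ac)
  then show "\<exists>p\<in>cubic_polys. \<forall>x. (x, y) \<in> K \<longrightarrow> f (x, y) = poly p x" using p(1) by blast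
  obtain q where q: "q \<in> cubic_polys" "\<And>y. poly q y = (\<Sum>j\<le>3. (\<Sum>i\<le>3. a i j * x ^ i) * y ^ j)"
    using poly_of_coeffs[of "\<lambda>j. \<Sum>i\<le>3. a i j * x ^ i"] by blast
  have "f (x, y) = poly q y" if "(x, y) \<in> K" for y
    unfolding a[OF that] q(2) by (subst sum.swap) (simp add: sum_distrib_right)
  then show "\<exists>p\<in>cubic_polys. \<forall>y. (x, y) \<in> K \<longrightarrow> f (x, y) = poly p y" using q(1) by blast
qed

context grid begin

lemma s_mono: "strict_mono_on {1..8} s" and t_mono: "strict_mono_on {1..8} t"
  using admissible by (simp_all add: admissible_def)

definition tensor_comb :: "(nat \<Rightarrow> nat \<Rightarrow> real) \<Rightarrow> real \<times> real \<Rightarrow> real" where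
  "tensor_comb c p = (if p \<in> \<Omega> then
     \<Sum>a<10. \<Sum>b<10. c a b * spline_basis s a (fst p) * spline_basis t b (snd p) else 0)"

lemma tensor_comb_x:
  "(x, y) \<in> \<Omega> \<Longrightarrow> tensor_comb c (x, y) = spline_comb s (\<lambda>a. spline_comb t (c a) y) x"
  by (simp add: tensor_comb_def spline_comb_def sum_distrib_left mult_ac)

lemma tensor_comb_y:
  "(x, y) \<in> \<Omega> \<Longrightarrow> tensor_comb c (x, y) = spline_comb t (\<lambda>b. spline_comb s (\<lambda>a. c a b) x) y"
  unfolding tensor_comb_def spline_comb_def
  by (subst sum.swap) (simp add: sum_distrib_left mult_ac)

text \<open>
  Across \<open>x = s k\<close> the combination jumps by \<open>(x - s k)\<^sup>3\<close> times \<open>spline_comb t (c (k + 2)) y\<close>, and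
  similarly across \<open>y = t l\<close>.  The condition is that these factors vanish where the grid line
  does not belong to the mesh.  The other lines are cross-cuts.
\<close>

definition mesh_coefficients :: "(nat \<Rightarrow> nat \<Rightarrow> real) \<Rightarrow> bool" where
  "mesh_coefficients c \<longleftrightarrow>
     (\<forall>k\<in>{4,5,6}. \<forall>y\<in>{t 1..t 8}. y \<le> t (fst (vspan k)) \<or> t (snd (vspan k)) \<le> y \<longrightarrow>
        spline_comb t (c (k + 2)) y = 0) \<and>
     (\<forall>l\<in>{4,5}. \<forall>x\<in>{s 1..s 8}. x \<le> s (fst (hspan l)) \<or> s (snd (hspan l)) \<le> x \<longrightarrow>
        spline_comb s (\<lambda>a. c a (l + 2)) x = 0)"

lemma spline_slice_x:
  assumes f: "f \<in> spline_space 3 \<M>" and y: "y \<in> {t 1..t 8}"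
  shows "C2_cubic_spline s (\<lambda>x. f (x, y))"
proof -
  have C: "Ck_along (1, 0) 2 \<Omega> f" using f by (simp add: spline_space_def Union_example_cells)
  obtain g' g'' where g: "\<And>x. x \<in> {s 1..s 8} \<Longrightarrow> ((\<lambda>x. f (x, y)) has_real_derivative g' x) (at x within {s 1..s 8})"
      "\<And>x. x \<in> {s 1..s 8} \<Longrightarrow> (g' has_real_derivative g'' x) (at x within {s 1..s 8})"
    by (rule Ck_along_x_2[OF C y]) blast
  have "\<exists>p\<in>cubic_polys. \<forall>x\<in>{s i..s (Suc i)}. f (x, y) = poly p x" if i: "i \<in> {1..<8}" for i
  proof -
    have "t 1 \<le> y" "y \<le> t 8" using y by auto
    then obtain j where j: "1 \<le> j" "j < 8" "t j \<le> y" "y \<le> t (Suc j)"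
      using between_grid_values[of 1 8 t y] by auto
    then have "j \<in> {1..<8}" by simp
    obtain K where K: "K \<in> \<M>" "{s i..s (Suc i)} \<times> {t j..t (Suc j)} \<subseteq> K"
      by (rule unit_square_subset_cell[OF i \<open>j \<in> {1..<8}\<close>])
    have "bidegree_poly_on 3 K f" using f K(1) by (simp add: spline_space_def)
    then obtain p where "p \<in> cubic_polys" "\<And>x. (x, y) \<in> K \<Longrightarrow> f (x, y) = poly p x"
      using bidegree_poly_slices(1) by blast
    moreover have "(x, y) \<in> K" if "x \<in> {s i..s (Suc i)}" for x
      by (rule set_mp[OF K(2)]) (use that j in simp)
    ultimately show ?thesis by blast
  qed
  then show ?thesis unfolding C2_cubic_spline_def using g by blast
qed

lemma spline_slice_y:
  assumes f: "f \<in> spline_space 3 \<M>" and x: "x \<in> {s 1..s 8}"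
  shows "C2_cubic_spline t (\<lambda>y. f (x, y))"
proof -
  have C: "Ck_along (0, 1) 2 \<Omega> f" using f by (simp add: spline_space_def Union_example_cells)
  obtain g' g'' where g: "\<And>y. y \<in> {t 1..t 8} \<Longrightarrow> ((\<lambda>y. f (x, y)) has_real_derivative g' y) (at y within {t 1..t 8})"
      "\<And>y. y \<in> {t 1..t 8} \<Longrightarrow> (g' has_real_derivative g'' y) (at y within {t 1..t 8})"
    by (rule Ck_along_y_2[OF C x]) blast
  have "\<exists>p\<in>cubic_polys. \<forall>y\<in>{t j..t (Suc j)}. f (x, y) = poly p y" if j: "j \<in> {1..<8}" for j
  proof -
    have "s 1 \<le> x" "x \<le> s 8" using x by auto
    then obtain i where i: "1 \<le> i" "i < 8" "s i \<le> x" "x \<le> s (Suc i)"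
      using between_grid_values[of 1 8 s x] by auto
    then have "i \<in> {1..<8}" by simp
    obtain K where K: "K \<in> \<M>" "{s i..s (Suc i)} \<times> {t j..t (Suc j)} \<subseteq> K"
      by (rule unit_square_subset_cell[OF \<open>i \<in> {1..<8}\<close> j])
    have "bidegree_poly_on 3 K f" using f K(1) by (simp add: spline_space_def)
    then obtain p where "p \<in> cubic_polys" "\<And>y. (x, y) \<in> K \<Longrightarrow> f (x, y) = poly p y"
      using bidegree_poly_slices(2) by blast
    moreover have "(x, y) \<in> K" if "y \<in> {t j..t (Suc j)}" for y
      by (rule set_mp[OF K(2)]) (use that i in simp)
    ultimately show ?thesis by blast
  qed
  then show ?thesis unfolding C2_cubic_spline_def using g by blast
qed

text \<open>
  The coefficients in \<open>x\<close> of the slices are, by triangularity of the nodes, linear combinations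
  of values \<open>f (x, y)\<close>, hence splines in \<open>y\<close>.
\<close>

lemma spline_eq_tensor_comb:
  assumes f: "f \<in> spline_space 3 \<M>"
  shows "\<exists>c. f = tensor_comb c"
proof -
  have "\<exists>k. \<forall>x\<in>{s 1..s 8}. f (x, y) = spline_comb s k x" if "y \<in> {t 1..t 8}" for y
    using C2_cubic_spline_eq_comb[OF s_mono spline_slice_x[OF f that]] .
  then obtain k where k: "\<And>x y. y \<in> {t 1..t 8} \<Longrightarrow> x \<in> {s 1..s 8} \<Longrightarrow> f (x, y) = spline_comb s (k y) x"
    by metis
  have "\<exists>c. \<forall>y\<in>{t 1..t 8}. k y a = spline_comb t c y" if "a < 10" for a
    using that
  proof (induction a rule: less_induct)
    case (less a)
    let ?n = "spline_node s a"
    have n: "?n \<in> {s 1..s 8}" using node_le[OF s_mono, of 7 a] less.prems by simp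
    have nz: "spline_basis s a ?n \<noteq> 0" by (rule basis_at_own_node[OF s_mono less.prems])
    obtain d where d: "\<And>y. y \<in> {t 1..t 8} \<Longrightarrow> f (?n, y) = spline_comb t d y"
      using C2_cubic_spline_eq_comb[OF t_mono spline_slice_y[OF f n]] by blast
    obtain C where C: "\<And>b y. b < a \<Longrightarrow> y \<in> {t 1..t 8} \<Longrightarrow> k y b = spline_comb t (C b) y"
      using less.IH less.prems by (metis order.strict_trans)
    show ?case
    proof (intro exI ballI)
      fix y assume y: "y \<in> {t 1..t 8}"
      have "k y a * spline_basis s a ?n = f (?n, y) - (\<Sum>b<a. k y b * spline_basis s b ?n)"
        using k[OF y n] spline_comb_at_node[OF s_mono less.prems, of "k y"] by simp
      also have "\<dots> = spline_comb t d y - (\<Sum>b<a. spline_comb t (C b) y * spline_basis s b ?n)"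
        using d[OF y] C y by simp
      also have "\<dots> = spline_comb t (\<lambda>j. d j - (\<Sum>b<a. C b j * spline_basis s b ?n)) y"
      proof -
        have "(\<Sum>b<a. spline_comb t (C b) y * spline_basis s b ?n)
            = spline_comb t (\<lambda>j. \<Sum>b<a. C b j * spline_basis s b ?n) y"
          unfolding spline_comb_def sum_distrib_right by (subst sum.swap) (simp add: mult_ac)
        then show ?thesis by (simp add: spline_comb_def left_diff_distrib sum_subtractf)
      qed
      finally have "k y a = spline_comb t (\<lambda>j. d j - (\<Sum>b<a. C b j * spline_basis s b ?n)) y / spline_basis s a ?n"
        using nz by (simp add: field_simps)
      then show "k y a = spline_comb t (\<lambda>j. (d j - (\<Sum>b<a. C b j * spline_basis s b ?n)) / spline_basis s a ?n) y"
        by (simp add: spline_comb_def sum_divide_distrib)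
    qed
  qed
  then obtain c where c: "\<And>a y. a < 10 \<Longrightarrow> y \<in> {t 1..t 8} \<Longrightarrow> k y a = spline_comb t (c a) y"
    by metis
  have "f p = tensor_comb c p" for p
  proof (cases "p \<in> \<Omega>")
    case True
    obtain x y where p: "p = (x, y)" by fastforce
    have "f (x, y) = spline_comb s (k y) x" using k True p by simp
    also have "\<dots> = spline_comb s (\<lambda>a. spline_comb t (c a) y) x"
      using c True p by (simp add: spline_comb_def)
    finally show ?thesis using tensor_comb_x[of x y c] True p by simp
  next
    case False
    have "\<forall>p. p \<notin> \<Omega> \<longrightarrow> f p = 0"
      using f unfolding spline_space_def Union_example_cells mem_Collect_eq by (rule conjunct1)
    from this[rule_format, OF False] show ?thesis using False by (simp only: tensor_comb_def if_False)
  qed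
  then show ?thesis by blast
qed

lemma tensor_comb_zero:
  assumes "\<And>p. p \<in> \<Omega> \<Longrightarrow> tensor_comb c p = 0" "a < 10" "b < 10"
  shows "c a b = 0"
proof (rule spline_comb_zero[OF t_mono, of 7])
  fix y assume y: "y \<in> {t 1..t (Suc 7)}"
  show "spline_comb t (c a) y = 0"
  proof (rule spline_comb_zero[OF s_mono, of 7])
    fix x assume "x \<in> {s 1..s (Suc 7)}"
    then have "(x, y) \<in> \<Omega>" using y by simp
    then show "spline_comb s (\<lambda>a. spline_comb t (c a) y) x = 0"
      using assms(1) tensor_comb_x by metis
  qed (use assms in auto)
qed (use assms in auto)

lemma cells_across_missing_segments:
  "\<forall>k\<in>{4,5,6}. \<forall>j\<in>{1..<8}. j < fst (vspan k) \<or> snd (vspan k) \<le> j \<longrightarrow>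
     (\<exists>(i, i', l, l')\<in>set cell_indices. i < k \<and> k < i' \<and> l \<le> j \<and> Suc j \<le> l')"
  "\<forall>l\<in>{4,5}. \<forall>i\<in>{1..<8}. i < fst (hspan l) \<or> snd (hspan l) \<le> i \<longrightarrow>
     (\<exists>(k, k', j, j')\<in>set cell_indices. j < l \<and> l < j' \<and> k \<le> i \<and> Suc i \<le> k')"
  by code_simp+

lemma lines_inside_cells:
  "\<forall>(i, i', j, j')\<in>set cell_indices. (i' = Suc i \<or> j' = Suc j) \<and>
     (\<forall>k\<in>{2,3,4,5,6,7}. i < k \<and> k < i' \<longrightarrow> k \<in> {4,5,6} \<and> (j' \<le> fst (vspan k) \<or> snd (vspan k) \<le> j)) \<and>
     (\<forall>l\<in>{2,3,4,5,6,7}. j < l \<and> l < j' \<longrightarrow> l \<in> {4,5} \<and> (i' \<le> fst (hspan l) \<or> snd (hspan l) \<le> i))"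
  unfolding cell_indices_def by (simp add: vspan_def hspan_def)

text \<open>
  Off its T $l$-edge each line runs through the interior of cells, where the spline is
  a single polynomial and the truncated power must not occur.
\<close>

lemma spline_mesh_coefficients:
  assumes f: "tensor_comb c \<in> spline_space 3 \<M>"
  shows "mesh_coefficients c"
  unfolding mesh_coefficients_def
proof (intro conjI ballI impI)
  fix k y assume k: "k \<in> {4,5,6::nat}" and y: "y \<in> {t 1..t 8}"
    and out: "y \<le> t (fst (vspan k)) \<or> t (snd (vspan k)) \<le> y"
  have k8: "2 \<le> k" "k \<le> 7" and k1: "fst (vspan k) > 1" "snd (vspan k) < 8" using k by (auto simp: vspan_def)
  obtain j where j: "j \<in> {1..<8}" "j < fst (vspan k) \<or> snd (vspan k) \<le> j" "t j \<le> y" "y \<le> t (Suc j)"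
  proof (cases "y \<le> t (fst (vspan k))")
    case True
    then obtain j where "1 \<le> j" "j < fst (vspan k)" "t j \<le> y" "y \<le> t (Suc j)"
      using between_grid_values[of 1 "fst (vspan k)" t y] k1 y by auto
    then show thesis using span_bounds(1-3)[of k] by (intro that[of j]) auto
  next
    case False
    then obtain j where "snd (vspan k) \<le> j" "j < 8" "t j \<le> y" "y \<le> t (Suc j)"
      using between_grid_values[of "snd (vspan k)" 8 t y] k1 y out by auto
    then show thesis using span_bounds(1-3)[of k] by (intro that[of j]) auto
  qed
  from cells_across_missing_segments(1)[rule_format, OF k j(1,2)]
  obtain i i' l l' where c: "(i, i', l, l') \<in> set cell_indices" "i < k" "k < i'" "l \<le> j" "Suc j \<le> l'" by blast
  have b: "1 \<le> i" "i' \<le> 8" "1 \<le> l" "l' \<le> 8" using bspec[OF cell_indices_bounds c(1)] by auto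
  let ?K = "{s i..s i'} \<times> {t l..t l'}"
  have "?K \<in> \<M>" using c(1) unfolding example_cells_def grid_box_def by force
  then have "bidegree_poly_on 3 ?K (tensor_comb c)" using f by (simp add: spline_space_def)
  then obtain p where p: "p \<in> cubic_polys" "\<And>x. (x, y) \<in> ?K \<Longrightarrow> tensor_comb c (x, y) = poly p x"
    using bidegree_poly_slices(1) by blast
  have yK: "y \<in> {t l..t l'}"
    using j(3,4) t_le[of l j] t_le[of "Suc j" l'] b c by auto
  show "spline_comb t (c (k + 2)) y = 0"
  proof (rule no_jump[OF s_mono k8 p(1), of "\<lambda>a. spline_comb t (c a) y"])
    fix x assume x: "x \<in> {s (k - 1)..s (Suc k)}"
    have "s i \<le> s (k - 1)" "s (Suc k) \<le> s i'" "s 1 \<le> s (k - 1)" "s (Suc k) \<le> s 8"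
      using b c k8 by (intro knot_le[OF s_mono]; simp)+
    then have "(x, y) \<in> ?K" "(x, y) \<in> \<Omega>" using x yK y by auto
    then show "spline_comb s (\<lambda>a. spline_comb t (c a) y) x = poly p x"
      using p(2) tensor_comb_x by metis
  qed
next
  fix k x assume k: "k \<in> {4,5::nat}" and x: "x \<in> {s 1..s 8}"
    and out: "x \<le> s (fst (hspan k)) \<or> s (snd (hspan k)) \<le> x"
  have k8: "2 \<le> k" "k \<le> 7" and k1: "fst (hspan k) > 1" "snd (hspan k) < 8" using k by (auto simp: hspan_def)
  obtain j where j: "j \<in> {1..<8}" "j < fst (hspan k) \<or> snd (hspan k) \<le> j" "s j \<le> x" "x \<le> s (Suc j)"
  proof (cases "x \<le> s (fst (hspan k))")
    case True
    then obtain j where "1 \<le> j" "j < fst (hspan k)" "s j \<le> x" "x \<le> s (Suc j)"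
      using between_grid_values[of 1 "fst (hspan k)" s x] k1 x by auto
    then show thesis using span_bounds(4-6)[of k] by (intro that[of j]) auto
  next
    case False
    then obtain j where "snd (hspan k) \<le> j" "j < 8" "s j \<le> x" "x \<le> s (Suc j)"
      using between_grid_values[of "snd (hspan k)" 8 s x] k1 x out by auto
    then show thesis using span_bounds(4-6)[of k] by (intro that[of j]) auto
  qed
  from cells_across_missing_segments(2)[rule_format, OF k j(1,2)]
  obtain i i' l l' where c: "(i, i', l, l') \<in> set cell_indices" "l < k" "k < l'" "i \<le> j" "Suc j \<le> i'" by blast
  have b: "1 \<le> i" "i' \<le> 8" "1 \<le> l" "l' \<le> 8" using bspec[OF cell_indices_bounds c(1)] by auto
  let ?K = "{s i..s i'} \<times> {t l..t l'}"
  have "?K \<in> \<M>" using c(1) unfolding example_cells_def grid_box_def by force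
  then have "bidegree_poly_on 3 ?K (tensor_comb c)" using f by (simp add: spline_space_def)
  then obtain p where p: "p \<in> cubic_polys" "\<And>y. (x, y) \<in> ?K \<Longrightarrow> tensor_comb c (x, y) = poly p y"
    using bidegree_poly_slices(2) by blast
  have xK: "x \<in> {s i..s i'}"
    using j(3,4) s_le[of i j] s_le[of "Suc j" i'] b c by auto
  show "spline_comb s (\<lambda>a. c a (k + 2)) x = 0"
  proof (rule no_jump[OF t_mono k8 p(1), of "\<lambda>b. spline_comb s (\<lambda>a. c a b) x"])
    fix y assume y: "y \<in> {t (k - 1)..t (Suc k)}"
    have "t l \<le> t (k - 1)" "t (Suc k) \<le> t l'" "t 1 \<le> t (k - 1)" "t (Suc k) \<le> t 8"
      using b c k8 by (intro knot_le[OF t_mono]; simp)+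
    then have "(x, y) \<in> ?K" "(x, y) \<in> \<Omega>" using y xK x by auto
    then show "spline_comb t (\<lambda>b. spline_comb s (\<lambda>a. c a b) x) y = poly p y"
      using p(2) tensor_comb_y by metis
  qed
qed

lemma comb_cubic_on_unit:
  assumes f: "strict_mono_on {1..8} f" and i: "1 \<le> i" "i < 8"
  shows "\<exists>p\<in>cubic_polys. \<forall>x\<in>{f i..f (Suc i)}. spline_comb f c x = poly p x"
proof -
  obtain p where "p \<in> cubic_polys" "\<And>x. x \<ge> f i \<Longrightarrow> (\<Sum>a<i + 3. c a * spline_basis f a x) = poly p x"
    using comb_cubic_right[OF f, of i c] i by auto
  moreover have "spline_comb f c x = (\<Sum>a<i + 3. c a * spline_basis f a x)" if "x \<le> f (Suc i)" for x
    by (rule spline_comb_left[OF f]) (use i that in auto)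
  ultimately show ?thesis by (intro bexI[of _ p]) auto
qed

text \<open>
  No cell is crossed by missing grid segments in both directions.  With the slices taken across
  the crossing lines, their truncated powers drop out, and the remaining products are bicubic.
\<close>

lemma tensor_comb_bidegree:
  assumes c: "mesh_coefficients c" and K: "K \<in> \<M>"
  shows "bidegree_poly_on 3 K (tensor_comb c)"
proof -
  obtain i i' j j' where ij: "(i, i', j, j') \<in> set cell_indices" "K = {s i..s i'} \<times> {t j..t j'}"
      "1 \<le> i" "i < i'" "i' \<le> 8" "1 \<le> j" "j < j'" "j' \<le> 8"
    using K by (rule cell_cases)
  have K\<Omega>: "K \<subseteq> \<Omega>" by (rule mesh.cell_subset[OF K])
  have inner: "k \<in> {2,3,4,5,6,7}" if "1 < k" "k < 8" for k :: nat using that by auto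
  have lines: "i' = Suc i \<or> j' = Suc j"
    "\<And>k. i < k \<Longrightarrow> k < i' \<Longrightarrow> k \<in> {4,5,6} \<and> (j' \<le> fst (vspan k) \<or> snd (vspan k) \<le> j)"
    "\<And>l. j < l \<Longrightarrow> l < j' \<Longrightarrow> l \<in> {4,5} \<and> (i' \<le> fst (hspan l) \<or> snd (hspan l) \<le> i)"
  proof -
    have all: "(i' = Suc i \<or> j' = Suc j) \<and>
      (\<forall>k\<in>{2,3,4,5,6,7}. i < k \<and> k < i' \<longrightarrow> k \<in> {4,5,6} \<and> (j' \<le> fst (vspan k) \<or> snd (vspan k) \<le> j)) \<and>
      (\<forall>l\<in>{2,3,4,5,6,7}. j < l \<and> l < j' \<longrightarrow> l \<in> {4,5} \<and> (i' \<le> fst (hspan l) \<or> snd (hspan l) \<le> i))"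
      using bspec[OF lines_inside_cells ij(1)] unfolding prod.case .
    show "i' = Suc i \<or> j' = Suc j" using all by (rule conjunct1)
    show "k \<in> {4,5,6} \<and> (j' \<le> fst (vspan k) \<or> snd (vspan k) \<le> j)" if "i < k" "k < i'" for k
    proof -
      have "1 < k" "k < 8" using that ij(3-8) by linarith+
      from bspec[OF conjunct1[OF conjunct2[OF all]] inner[OF this]] that show ?thesis by blast
    qed
    show "l \<in> {4,5} \<and> (i' \<le> fst (hspan l) \<or> snd (hspan l) \<le> i)" if "j < l" "l < j'" for l
    proof -
      have "1 < l" "l < 8" using that ij(3-8) by linarith+
      from bspec[OF conjunct2[OF conjunct2[OF all]] inner[OF this]] that show ?thesis by blast
    qed
  qed
  show ?thesis
  proof (cases "j' = Suc j")
    case True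
    let ?skip = "\<lambda>a. 4 \<le> a \<and> i < a - 2 \<and> a - 2 < i'"
    have zero: "spline_comb t (c a) y = 0" if a: "?skip a" and y: "y \<in> {t j..t j'}" for a y
    proof -
      from lines(2)[of "a - 2"] a have k: "a - 2 \<in> {4,5,6}" "j' \<le> fst (vspan (a - 2)) \<or> snd (vspan (a - 2)) \<le> j"
        by blast+
      have "y \<le> t (fst (vspan (a - 2))) \<or> t (snd (vspan (a - 2))) \<le> y"
        using k(2) y ij t_le[of j' "fst (vspan (a - 2))"] t_le[of "snd (vspan (a - 2))" j] span_bounds(1-3)[of "a - 2"]
        by auto
      moreover have "y \<in> {t 1..t 8}" using y ij t_le[of 1 j] t_le[of j' 8] by auto
      moreover have "a - 2 + 2 = a" using a by linarith
      ultimately show ?thesis using c k(1) unfolding mesh_coefficients_def by metis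
    qed
    have "\<exists>p\<in>cubic_polys. \<forall>x\<in>{s i..s i'}. spline_basis s a x = poly p x" if "a < 10" "\<not> ?skip a" for a
    proof -
      have "a < 4 \<or> a - 2 \<le> i \<or> i' \<le> a - 2" using that(2) by linarith
      then show ?thesis by (rule basis_cubic_on[OF s_mono that(1) ij(3,4,5)])
    qed
    then obtain P where P: "\<And>a. a < 10 \<Longrightarrow> \<not> ?skip a \<Longrightarrow> P a \<in> cubic_polys"
        "\<And>a x. a < 10 \<Longrightarrow> \<not> ?skip a \<Longrightarrow> x \<in> {s i..s i'} \<Longrightarrow> spline_basis s a x = poly (P a) x"
      by metis
    have "\<forall>a. \<exists>q\<in>cubic_polys. \<forall>y\<in>{t j..t j'}. spline_comb t (c a) y = poly q y"
      using comb_cubic_on_unit[OF t_mono, of j] ij True by simp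
    then obtain Q where Q: "\<And>a. Q a \<in> cubic_polys" "\<And>a y. y \<in> {t j..t j'} \<Longrightarrow> spline_comb t (c a) y = poly (Q a) y"
      by metis
    show ?thesis
    proof (rule bidegree_poly_products[of "{a. a < 10 \<and> \<not> ?skip a}" P Q])
      fix x y assume xy: "(x, y) \<in> K"
      then have y: "y \<in> {t j..t j'}" and x: "x \<in> {s i..s i'}" unfolding ij(2) by auto
      have "tensor_comb c (x, y) = (\<Sum>a<10. spline_comb t (c a) y * spline_basis s a x)"
        using tensor_comb_x[OF set_mp[OF K\<Omega> xy]] by (simp add: spline_comb_def)
      also have "\<dots> = (\<Sum>a\<in>{a. a < 10 \<and> \<not> ?skip a}. spline_comb t (c a) y * spline_basis s a x)"
        using zero[OF _ y] by (intro sum.mono_neutral_right) auto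
      also have "\<dots> = (\<Sum>a\<in>{a. a < 10 \<and> \<not> ?skip a}. poly (P a) x * poly (Q a) y)"
        using P(2) Q(2)[OF y] x by (intro sum.cong) auto
      finally show "tensor_comb c (x, y) = (\<Sum>a\<in>{a. a < 10 \<and> \<not> ?skip a}. poly (P a) x * poly (Q a) y)" .
    qed (use P Q in auto)
  next
    case False
    then have i': "i' = Suc i" using lines(1) by simp
    let ?skip = "\<lambda>b. 4 \<le> b \<and> j < b - 2 \<and> b - 2 < j'"
    have zero: "spline_comb s (\<lambda>a. c a b) x = 0" if b: "?skip b" and x: "x \<in> {s i..s i'}" for b x
    proof -
      from lines(3)[of "b - 2"] b have k: "b - 2 \<in> {4,5}" "i' \<le> fst (hspan (b - 2)) \<or> snd (hspan (b - 2)) \<le> i"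
        by blast+
      have "x \<le> s (fst (hspan (b - 2))) \<or> s (snd (hspan (b - 2))) \<le> x"
        using k(2) x ij s_le[of i' "fst (hspan (b - 2))"] s_le[of "snd (hspan (b - 2))" i] span_bounds(4-6)[of "b - 2"]
        by auto
      moreover have "x \<in> {s 1..s 8}" using x ij s_le[of 1 i] s_le[of i' 8] by auto
      moreover have "b - 2 + 2 = b" using b by linarith
      ultimately show ?thesis using c k(1) unfolding mesh_coefficients_def by metis
    qed
    have "\<exists>p\<in>cubic_polys. \<forall>y\<in>{t j..t j'}. spline_basis t b y = poly p y" if "b < 10" "\<not> ?skip b" for b
    proof -
      have "b < 4 \<or> b - 2 \<le> j \<or> j' \<le> b - 2" using that(2) by linarith
      then show ?thesis by (rule basis_cubic_on[OF t_mono that(1) ij(6,7,8)])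
    qed
    then obtain Q where Q: "\<And>b. b < 10 \<Longrightarrow> \<not> ?skip b \<Longrightarrow> Q b \<in> cubic_polys"
        "\<And>b y. b < 10 \<Longrightarrow> \<not> ?skip b \<Longrightarrow> y \<in> {t j..t j'} \<Longrightarrow> spline_basis t b y = poly (Q b) y"
      by metis
    have "\<forall>b. \<exists>p\<in>cubic_polys. \<forall>x\<in>{s i..s i'}. spline_comb s (\<lambda>a. c a b) x = poly p x"
      using comb_cubic_on_unit[OF s_mono, of i] ij i' by simp
    then obtain P where P: "\<And>b. P b \<in> cubic_polys" "\<And>b x. x \<in> {s i..s i'} \<Longrightarrow> spline_comb s (\<lambda>a. c a b) x = poly (P b) x"
      by metis
    show ?thesis
    proof (rule bidegree_poly_products[of "{b. b < 10 \<and> \<not> ?skip b}" P Q])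
      fix x y assume xy: "(x, y) \<in> K"
      then have y: "y \<in> {t j..t j'}" and x: "x \<in> {s i..s i'}" unfolding ij(2) by auto
      have "tensor_comb c (x, y) = (\<Sum>b<10. spline_comb s (\<lambda>a. c a b) x * spline_basis t b y)"
        using tensor_comb_y[OF set_mp[OF K\<Omega> xy]] by (simp add: spline_comb_def)
      also have "\<dots> = (\<Sum>b\<in>{b. b < 10 \<and> \<not> ?skip b}. spline_comb s (\<lambda>a. c a b) x * spline_basis t b y)"
        using zero[OF _ x] by (intro sum.mono_neutral_right) auto
      also have "\<dots> = (\<Sum>b\<in>{b. b < 10 \<and> \<not> ?skip b}. poly (P b) x * poly (Q b) y)"
        using P(2)[OF x] Q(2) y by (intro sum.cong) auto
      finally show "tensor_comb c (x, y) = (\<Sum>b\<in>{b. b < 10 \<and> \<not> ?skip b}. poly (P b) x * poly (Q b) y)" .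
    qed (use P Q in auto)
  qed
qed

lemma tensor_comb_Ck:
  "Ck_along (1, 0) 2 \<Omega> (tensor_comb c)" "Ck_along (0, 1) 2 \<Omega> (tensor_comb c)"
proof -
  have ex: "\<exists>D D'. \<forall>a. continuous_on UNIV (D' a) \<and>
      (\<forall>x. (spline_basis f a has_real_derivative D a x) (at x) \<and> (D a has_real_derivative D' a x) (at x))" for f
    using spline_basis_derivatives[of f] by metis
  obtain D D' where D: "\<And>a x. (spline_basis s a has_real_derivative D a x) (at x)"
      "\<And>a x. (D a has_real_derivative D' a x) (at x)" "\<And>a. continuous_on UNIV (D' a)" using ex by blast
  obtain E E' where E: "\<And>a x. (spline_basis t a has_real_derivative E a x) (at x)"
      "\<And>a x. (E a has_real_derivative E' a x) (at x)" "\<And>a. continuous_on UNIV (E' a)" using ex by blast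
  let ?F = "\<lambda>u v p. \<Sum>a<10. \<Sum>b<10. c a b * u a (fst p) * v b (snd p)"
  have cont1: "continuous_on UNIV (spline_basis f a)" for f a
    using spline_basis_derivatives[of f a] by (metis DERIV_continuous_on has_field_derivative_at_within)
  have contD: "continuous_on UNIV (D a)" "continuous_on UNIV (E a)" for a
    using D(2) E(2) by (metis DERIV_continuous_on has_field_derivative_at_within)+
  have cont: "continuous_on \<Omega> (?F u v)" if "\<And>a. continuous_on UNIV (u a)" "\<And>b. continuous_on UNIV (v b)" for u v
    by (intro continuous_intros continuous_on_compose2[OF that(1)] continuous_on_compose2[OF that(2)]) auto
  have dx: "((\<lambda>h. ?F u v (p + h *\<^sub>R (1, 0))) has_real_derivative ?F u' v p) (at 0 within S)"
    if "\<And>a x. (u a has_real_derivative u' a x) (at x)" for u u' v p S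
  proof -
    have "((\<lambda>h. u a (fst p + h)) has_real_derivative u' a (fst p)) (at 0 within S)" for a
      using that[of a "fst p"] DERIV_shift[of "u a" "u' a (fst p)" 0 "fst p"]
      by (simp add: add.commute has_field_derivative_at_within)
    then show ?thesis by (auto intro!: DERIV_sum derivative_eq_intros simp: mult_ac)
  qed
  have dy: "((\<lambda>h. ?F u v (p + h *\<^sub>R (0, 1))) has_real_derivative ?F u v' p) (at 0 within S)"
    if "\<And>a x. (v a has_real_derivative v' a x) (at x)" for u v v' p S
  proof -
    have "((\<lambda>h. v a (snd p + h)) has_real_derivative v' a (snd p)) (at 0 within S)" for a
      using that[of a "snd p"] DERIV_shift[of "v a" "v' a (snd p)" 0 "snd p"]
      by (simp add: add.commute has_field_derivative_at_within)
    then show ?thesis by (auto intro!: DERIV_sum derivative_eq_intros simp: mult_ac)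
  qed
  have eq: "?F (spline_basis s) (spline_basis t) p = tensor_comb c p" if "p \<in> \<Omega>" for p
    using that by (simp add: tensor_comb_def)
  have "Ck_along (1, 0) 2 \<Omega> (?F (spline_basis s) (spline_basis t))"
    unfolding numeral_2_eq_2 Ck_along.simps
  proof (rule conjI[OF cont[OF cont1 cont1]], rule exI[of _ "?F (D) (spline_basis t)"], intro conjI)
    show "\<forall>p\<in>\<Omega>. ((\<lambda>h. ?F (spline_basis s) (spline_basis t) (p + h *\<^sub>R (1, 0))) has_real_derivative
        ?F (D) (spline_basis t) p) (at 0 within {h. p + h *\<^sub>R (1, 0) \<in> \<Omega>})"
      by (rule ballI, rule dx[OF D(1)])
    show "continuous_on \<Omega> (?F (D) (spline_basis t))" by (rule cont[OF contD(1) cont1])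
    show "\<exists>g. (\<forall>p\<in>\<Omega>. ((\<lambda>h. ?F (D) (spline_basis t) (p + h *\<^sub>R (1, 0))) has_real_derivative g p)
        (at 0 within {h. p + h *\<^sub>R (1, 0) \<in> \<Omega>})) \<and> continuous_on \<Omega> g"
      by (rule exI[of _ "?F (D') (spline_basis t)"], rule conjI[OF ballI], rule dx[OF D(2)], rule cont[OF D(3) cont1])
  qed
  then show "Ck_along (1, 0) 2 \<Omega> (tensor_comb c)" by (rule Ck_along_cong[rotated]) (rule eq)
  have "Ck_along (0, 1) 2 \<Omega> (?F (spline_basis s) (spline_basis t))"
    unfolding numeral_2_eq_2 Ck_along.simps
  proof (rule conjI[OF cont[OF cont1 cont1]], rule exI[of _ "?F (spline_basis s) (E)"], intro conjI)
    show "\<forall>p\<in>\<Omega>. ((\<lambda>h. ?F (spline_basis s) (spline_basis t) (p + h *\<^sub>R (0, 1))) has_real_derivative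
        ?F (spline_basis s) (E) p) (at 0 within {h. p + h *\<^sub>R (0, 1) \<in> \<Omega>})"
      by (rule ballI, rule dy[OF E(1)])
    show "continuous_on \<Omega> (?F (spline_basis s) (E))" by (rule cont[OF cont1 contD(2)])
    show "\<exists>g. (\<forall>p\<in>\<Omega>. ((\<lambda>h. ?F (spline_basis s) (E) (p + h *\<^sub>R (0, 1))) has_real_derivative g p)
        (at 0 within {h. p + h *\<^sub>R (0, 1) \<in> \<Omega>})) \<and> continuous_on \<Omega> g"
      by (rule exI[of _ "?F (spline_basis s) (E')"], rule conjI[OF ballI], rule dy[OF E(2)], rule cont[OF cont1 E(3)])
  qed
  then show "Ck_along (0, 1) 2 \<Omega> (tensor_comb c)" by (rule Ck_along_cong[rotated]) (rule eq)
qed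

lemma tensor_comb_in_spline_space: "tensor_comb c \<in> spline_space 3 \<M> \<longleftrightarrow> mesh_coefficients c"
proof
  assume c: "mesh_coefficients c"
  show "tensor_comb c \<in> spline_space 3 \<M>"
    unfolding spline_space_def mem_Collect_eq Union_example_cells
    using tensor_comb_Ck tensor_comb_bidegree[OF c] by (simp add: tensor_comb_def)
qed (rule spline_mesh_coefficients)

end

section \<open>The dimension\<close>

text \<open>
  Going once round the cycle of four proportionalities.
\<close>

lemma kernel_relation:
  fixes u v w z :: real
  assumes "a4 \<noteq> 0" "a5 \<noteq> 0" "b4 \<noteq> 0" "b5 \<noteq> 0" "e4 \<noteq> 0" "e5 \<noteq> 0" "g4 \<noteq> 0" "g5 \<noteq> 0"
    and A: "u * a4 + v * a5 = 0" and E: "w * e4 + z * e5 = 0"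
    and B: "v * b4 + z * b5 = 0" and C: "u * g4 + w * g5 = 0"
  shows "v * (a4 / a5 - b5 / b4 * (e4 / e5) * (g4 / g5)) = 0"
proof -
  have z: "z = - w * e4 / e5" using E assms(6) by (simp add: field_simps)
  have w: "w = - u * g4 / g5" using C assms(8) by (simp add: field_simps)
  have u: "u = - v * a5 / a4" using A assms(1) by (simp add: field_simps)
  have v: "v = - z * b5 / b4" using B assms(3) by (simp add: field_simps)
  have "v = v * (a5 / a4) * (b5 / b4 * (e4 / e5) * (g4 / g5))"
    by (subst v, subst z, subst w, subst u) (simp add: mult_ac)
  then have "v * (a4 / a5) = v * ((a5 / a4) * (a4 / a5)) * (b5 / b4 * (e4 / e5) * (g4 / g5))"
    by (metis (no_types, lifting) mult.assoc mult.commute)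
  also have "(a5 / a4) * (a4 / a5) = 1" using assms(1,2) by simp
  finally show ?thesis by (simp add: algebra_simps)
qed

lemma weights_edge:
  assumes f: "strict_mono_on {1..8} f" and pq: "2 \<le> p" "p < q" "q \<le> 7"
    and zero: "\<And>j. j \<notin> {p..q} \<Longrightarrow> w j = 0"
    and mom: "\<And>r. r \<in> cubic_polys \<Longrightarrow> (\<Sum>j\<in>{p..q}. w j * poly r (f j)) = 0"
    and y: "y \<le> f p \<or> f q \<le> y"
  shows "spline_comb f (\<lambda>b. w (b - 2)) y = 0"
proof (rule edge_coefficients_converse[OF f pq _ _ _ y])
  show "w (b - 2) = 0" if "b < p + 2" for b using that pq by (intro zero) auto
  show "w (b - 2) = 0" if "q + 2 < b" for b using that by (intro zero) auto
  show "(\<Sum>j\<in>{p..q}. w (j + 2 - 2) * poly r (f j)) = 0" if "r \<in> cubic_polys" for r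
    using mom[OF that] by simp
qed

lemma five_weights:
  fixes x :: "'i \<Rightarrow> real"
  assumes "finite N" "card N = 4" "i \<notin> N" "finite J" "inj_on x J" "insert i N \<subseteq> J"
  obtains w where "w i = 1" "\<And>j. j \<notin> insert i N \<Longrightarrow> w j = 0"
    "\<And>r. r \<in> cubic_polys \<Longrightarrow> (\<Sum>j\<in>J. w j * poly r (x j)) = 0"
proof -
  obtain w where w: "w i = 1" "\<And>j. j \<notin> insert i N \<Longrightarrow> w j = 0"
    "\<And>r. r \<in> cubic_polys \<Longrightarrow> (\<Sum>j\<in>insert i N. w j * poly r (x j)) = 0"
    using moments_five_nodes[OF assms(1-3) inj_on_subset[OF assms(5,6)]] by blast
  have "(\<Sum>j\<in>J. w j * poly r (x j)) = (\<Sum>j\<in>insert i N. w j * poly r (x j))" for r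
    using assms(4,6) w(2) by (intro sum.mono_neutral_right) auto
  then show thesis using w by (intro that[of w]) simp_all
qed

definition cubic_roots :: "real \<Rightarrow> real \<Rightarrow> real \<Rightarrow> real poly" where
  "cubic_roots a b c = [:- a, 1:] * [:- b, 1:] * [:- c, 1:]"

lemma poly_cubic_roots: "poly (cubic_roots a b c) x = (x - a) * (x - b) * (x - c)"
  by (simp add: cubic_roots_def algebra_simps)

lemma cubic_roots_cubic: "cubic_roots a b c \<in> cubic_polys"
  by (simp add: cubic_roots_def cubic_polys_def)

lemma spline_comb_linear:
  "spline_comb f (\<lambda>b. c b + k * d b) y = spline_comb f c y + k * spline_comb f d y"
  by (simp add: spline_comb_def algebra_simps sum.distrib sum_distrib_left)

lemma sum_function_apply: "(\<Sum>i\<in>A. f i) x = (\<Sum>i\<in>A. f i x :: real)"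
  by (induction A rule: infinite_finite_induct) simp_all

lemma interval_2_6: "{2..6} = {2,3,4,5,6::nat}" and interval_3_7: "{3..7} = {3,4,5,6,7::nat}"
  and interval_2_7: "{2..7} = {2,3,4,5,6,7::nat}"
  by auto

context grid begin

lemma vline_coefficients:
  assumes c: "mesh_coefficients c" and k: "k \<in> {4,5,6}"
  shows "b < fst (vspan k) + 2 \<Longrightarrow> c (k + 2) b = 0"
    and "snd (vspan k) + 2 < b \<Longrightarrow> b < 10 \<Longrightarrow> c (k + 2) b = 0"
    and "r \<in> cubic_polys \<Longrightarrow> (\<Sum>j\<in>{fst (vspan k)..snd (vspan k)}. c (k + 2) (j + 2) * poly r (t j)) = 0"
proof -
  have pq: "2 \<le> fst (vspan k)" "fst (vspan k) < snd (vspan k)" "snd (vspan k) \<le> 7"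
    using k by (auto simp: vspan_def)
  have lo: "spline_comb t (c (k + 2)) y = 0" if "y \<in> {t 1..t (fst (vspan k))}" for y
    using c k that t_le[of "fst (vspan k)" 8] pq unfolding mesh_coefficients_def by auto
  have hi: "spline_comb t (c (k + 2)) y = 0" if "y \<in> {t (snd (vspan k))..t 8}" for y
    using c k that t_le[of 1 "snd (vspan k)"] pq unfolding mesh_coefficients_def by auto
  note * = edge_coefficients[OF t_mono pq lo hi]
  show "b < fst (vspan k) + 2 \<Longrightarrow> c (k + 2) b = 0" by (rule *(1))
  show "snd (vspan k) + 2 < b \<Longrightarrow> b < 10 \<Longrightarrow> c (k + 2) b = 0" by (rule *(2))
  show "r \<in> cubic_polys \<Longrightarrow> (\<Sum>j\<in>{fst (vspan k)..snd (vspan k)}. c (k + 2) (j + 2) * poly r (t j)) = 0"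
    by (rule *(3))
qed

lemma hline_coefficients:
  assumes c: "mesh_coefficients c" and k: "k \<in> {4,5}"
  shows "b < fst (hspan k) + 2 \<Longrightarrow> c b (k + 2) = 0"
    and "snd (hspan k) + 2 < b \<Longrightarrow> b < 10 \<Longrightarrow> c b (k + 2) = 0"
    and "r \<in> cubic_polys \<Longrightarrow> (\<Sum>j\<in>{fst (hspan k)..snd (hspan k)}. c (j + 2) (k + 2) * poly r (s j)) = 0"
proof -
  have pq: "2 \<le> fst (hspan k)" "fst (hspan k) < snd (hspan k)" "snd (hspan k) \<le> 7"
    using k by (auto simp: hspan_def)
  have lo: "spline_comb s (\<lambda>a. c a (k + 2)) x = 0" if "x \<in> {s 1..s (fst (hspan k))}" for x
    using c k that s_le[of "fst (hspan k)" 8] pq unfolding mesh_coefficients_def by auto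
  have hi: "spline_comb s (\<lambda>a. c a (k + 2)) x = 0" if "x \<in> {s (snd (hspan k))..s 8}" for x
    using c k that s_le[of 1 "snd (hspan k)"] pq unfolding mesh_coefficients_def by auto
  note * = edge_coefficients[OF s_mono pq lo hi]
  show "b < fst (hspan k) + 2 \<Longrightarrow> c b (k + 2) = 0" by (rule *(1))
  show "snd (hspan k) + 2 < b \<Longrightarrow> b < 10 \<Longrightarrow> c b (k + 2) = 0" by (rule *(2))
  show "r \<in> cubic_polys \<Longrightarrow> (\<Sum>j\<in>{fst (hspan k)..snd (hspan k)}. c (j + 2) (k + 2) * poly r (s j)) = 0"
    by (rule *(3))
qed

lemma vline_zero:
  assumes c: "mesh_coefficients c" and k: "k \<in> {4,5,6}"
    and N: "N \<subseteq> {fst (vspan k)..snd (vspan k)}" "card N \<le> 4"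
    and zero: "\<And>j. j \<in> {fst (vspan k)..snd (vspan k)} - N \<Longrightarrow> c (k + 2) (j + 2) = 0" and b: "b < 10"
  shows "c (k + 2) b = 0"
proof (cases "b - 2 \<in> {fst (vspan k)..snd (vspan k)}")
  case True
  have inj: "inj_on t {fst (vspan k)..snd (vspan k)}"
    using t_eq span_bounds(1-3)[of k] by (auto intro!: inj_onI)
  have "c (k + 2) (b - 2 + 2) = 0"
    by (rule moments_four_nodes[OF _ inj N vline_coefficients(3)[OF c k] zero True]) simp_all
  moreover have "b - 2 + 2 = b" using True k by (auto simp: vspan_def split: if_splits)
  ultimately show ?thesis by simp
next
  case False
  then have "b < fst (vspan k) + 2 \<or> snd (vspan k) + 2 < b" by auto
  then show ?thesis using vline_coefficients(1,2)[OF c k] b by blast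
qed

lemma hline_zero:
  assumes c: "mesh_coefficients c" and k: "k \<in> {4,5}"
    and N: "N \<subseteq> {fst (hspan k)..snd (hspan k)}" "card N \<le> 4"
    and zero: "\<And>j. j \<in> {fst (hspan k)..snd (hspan k)} - N \<Longrightarrow> c (j + 2) (k + 2) = 0" and b: "b < 10"
  shows "c b (k + 2) = 0"
proof (cases "b - 2 \<in> {fst (hspan k)..snd (hspan k)}")
  case True
  have inj: "inj_on s {fst (hspan k)..snd (hspan k)}"
    using s_eq span_bounds(4-6)[of k] by (auto intro!: inj_onI)
  have "c (b - 2 + 2) (k + 2) = 0"
    by (rule moments_four_nodes[OF _ inj N hline_coefficients(3)[OF c k] zero True]) simp_all
  moreover have "b - 2 + 2 = b" using True k by (auto simp: hspan_def split: if_splits)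
  ultimately show ?thesis by simp
next
  case False
  then have "b < fst (hspan k) + 2 \<or> snd (hspan k) + 2 < b" by auto
  then show ?thesis using hline_coefficients(1,2)[OF c k] b by blast
qed

text \<open>
  For each edge of the CNDC the cubic vanishing at its three vertices on no other edge of the CNDC:
  \<open>A\<close> and \<open>E\<close> are the edges on \<open>x = s 4\<close> and \<open>x = s 5\<close>, and \<open>B\<close> and \<open>C\<close> those on \<open>y = t 5\<close> and
  \<open>y = t 4\<close>.
\<close>

abbreviation "\<alpha>\<^sub>A y \<equiv> (y - t 7) * (y - t 3) * (y - t 6)"
abbreviation "\<alpha>\<^sub>E y \<equiv> (y - t 2) * (y - t 3) * (y - t 6)"
abbreviation "\<alpha>\<^sub>B x \<equiv> (x - s 2) * (x - s 3) * (x - s 6)"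
abbreviation "\<alpha>\<^sub>C x \<equiv> (x - s 3) * (x - s 6) * (x - s 7)"

lemma cubics_nonzero:
  "\<alpha>\<^sub>A (t 4) \<noteq> 0" "\<alpha>\<^sub>A (t 5) \<noteq> 0" "\<alpha>\<^sub>B (s 4) \<noteq> 0" "\<alpha>\<^sub>B (s 5) \<noteq> 0"
  "\<alpha>\<^sub>E (t 4) \<noteq> 0" "\<alpha>\<^sub>E (t 5) \<noteq> 0" "\<alpha>\<^sub>C (s 4) \<noteq> 0" "\<alpha>\<^sub>C (s 5) \<noteq> 0"
  by (simp_all add: s_eq t_eq)

text \<open>
  Tested with these cubics, the weights on an edge of the CNDC leave a relation between its two
  multi-vertices.  The knots 4 and 5 have the basis indices 6 and 7.
\<close>

lemma multi_vertex_relations: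
  assumes c: "mesh_coefficients c"
  shows "c 6 6 * \<alpha>\<^sub>A (t 4) + c 6 7 * \<alpha>\<^sub>A (t 5) = 0" "c 7 6 * \<alpha>\<^sub>E (t 4) + c 7 7 * \<alpha>\<^sub>E (t 5) = 0"
    "c 6 7 * \<alpha>\<^sub>B (s 4) + c 7 7 * \<alpha>\<^sub>B (s 5) = 0" "c 6 6 * \<alpha>\<^sub>C (s 4) + c 7 6 * \<alpha>\<^sub>C (s 5) = 0"
proof -
  show "c 6 6 * \<alpha>\<^sub>A (t 4) + c 6 7 * \<alpha>\<^sub>A (t 5) = 0"
    using vline_coefficients(3)[OF c, of 4, OF _ cubic_roots_cubic[of "t 7" "t 3" "t 6"]]
    by (simp add: vspan_def interval_3_7 poly_cubic_roots)
  show "c 7 6 * \<alpha>\<^sub>E (t 4) + c 7 7 * \<alpha>\<^sub>E (t 5) = 0"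
    using vline_coefficients(3)[OF c, of 5, OF _ cubic_roots_cubic[of "t 2" "t 3" "t 6"]]
    by (simp add: vspan_def interval_2_6 poly_cubic_roots)
  show "c 6 7 * \<alpha>\<^sub>B (s 4) + c 7 7 * \<alpha>\<^sub>B (s 5) = 0"
    using hline_coefficients(3)[OF c, of 5, OF _ cubic_roots_cubic[of "s 2" "s 3" "s 6"]]
    by (simp add: hspan_def interval_2_6 poly_cubic_roots)
  show "c 6 6 * \<alpha>\<^sub>C (s 4) + c 7 6 * \<alpha>\<^sub>C (s 5) = 0"
    using hline_coefficients(3)[OF c, of 4, OF _ cubic_roots_cubic[of "s 3" "s 6" "s 7"]]
    by (simp add: hspan_def interval_3_7 poly_cubic_roots)
qed

lemma coefficient_times_D:
  assumes "mesh_coefficients c"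
  shows "c 6 7 * example_D s t = 0"
  unfolding example_D_def
  by (rule kernel_relation[OF cubics_nonzero multi_vertex_relations[OF assms]])

text \<open>
  The relations carry the zero round the cycle to all multi-vertices.  Then three weights remain
  on each edge of the CNDC, and after these four on the fifth T $l$-edge; so few weights
  annihilate the cubics only if they vanish.
\<close>

lemma T_coefficients_zero:
  assumes c: "mesh_coefficients c" and zero: "c 6 7 = 0"
    and ab: "a < 10" "b < 10" "a \<in> {6,7,8} \<or> b \<in> {6,7}"
  shows "c a b = 0"
proof -
  note R = multi_vertex_relations[OF c]
  have c66: "c 6 6 = 0" using R(1) cubics_nonzero(1) zero by simp
  have c77: "c 7 7 = 0" using R(3) cubics_nonzero(4) zero by simp
  have c76: "c 7 6 = 0" using R(2) cubics_nonzero(5) c77 by simp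
  have A: "c 6 b = 0" if "b < 10" for b
  proof -
    have "c (4 + 2) b = 0"
      by (rule vline_zero[OF c, of 4 "{3,6,7}"]) (use that zero c66 in \<open>auto simp: vspan_def interval_3_7\<close>)
    then show ?thesis by simp
  qed
  have E: "c 7 b = 0" if "b < 10" for b
  proof -
    have "c (5 + 2) b = 0"
      by (rule vline_zero[OF c, of 5 "{2,3,6}"]) (use that c76 c77 in \<open>auto simp: vspan_def interval_2_6\<close>)
    then show ?thesis by simp
  qed
  have C: "c a 6 = 0" if "a < 10" for a
  proof -
    have "c a (4 + 2) = 0"
      by (rule hline_zero[OF c, of 4 "{3,6,7}"]) (use that c66 c76 in \<open>auto simp: hspan_def interval_3_7\<close>)
    then show ?thesis by simp
  qed
  have B: "c a 7 = 0" if "a < 10" for a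
  proof -
    have "c a (5 + 2) = 0"
      by (rule hline_zero[OF c, of 5 "{2,3,6}"]) (use that zero c77 in \<open>auto simp: hspan_def interval_2_6\<close>)
    then show ?thesis by simp
  qed
  have F: "c 8 b = 0" if "b < 10" for b
  proof -
    have "c (6 + 2) b = 0"
      by (rule vline_zero[OF c, of 6 "{2,3,6,7}"]) (use that B[of 8] C[of 8] in \<open>auto simp: vspan_def interval_2_7\<close>)
    then show ?thesis by simp
  qed
  show ?thesis using ab A E F C B by auto
qed

text \<open>
  Start with weight 1 at the crossing of \<open>A\<close> and \<open>B\<close> and propagate the weights of \<open>A\<close> and \<open>B\<close>
  to \<open>C\<close> and \<open>E\<close>, which meet in a last multi-vertex; there \<open>D = 0\<close> makes the two values agree.
  On the fifth T $l$-edge, the weights prescribed by \<open>C\<close> and \<open>B\<close> are compensated at the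
  four vertices off the CNDC.
\<close>

lemma kernel_coefficients:
  assumes D: "example_D s t = 0"
  obtains c where "mesh_coefficients c" "c 6 7 = 1"
proof -
  have inj: "inj_on s {2..7}" "inj_on t {2..7}" using s_eq t_eq by (auto intro!: inj_onI)
  have sub: "inj_on s J" "inj_on t J" if "J \<subseteq> {2..7}" for J
    using inj that by (auto intro: inj_on_subset)
  obtain A where A: "A 5 = 1" "\<And>j. j \<notin> insert 5 {3,4,6,7} \<Longrightarrow> A j = 0"
      "\<And>r. r \<in> cubic_polys \<Longrightarrow> (\<Sum>j\<in>{3..7}. A j * poly r (t j)) = 0"
    by (rule five_weights[of "{3,4,6,7}" 5 "{3..7}" t]) (auto intro: sub)
  obtain B where B: "B 4 = 1" "\<And>j. j \<notin> insert 4 {2,3,5,6} \<Longrightarrow> B j = 0"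
      "\<And>r. r \<in> cubic_polys \<Longrightarrow> (\<Sum>j\<in>{2..6}. B j * poly r (s j)) = 0"
    by (rule five_weights[of "{2,3,5,6}" 4 "{2..6}" s]) (auto intro: sub)
  obtain E where E: "E 5 = 1" "\<And>j. j \<notin> insert 5 {2,3,4,6} \<Longrightarrow> E j = 0"
      "\<And>r. r \<in> cubic_polys \<Longrightarrow> (\<Sum>j\<in>{2..6}. E j * poly r (t j)) = 0"
    by (rule five_weights[of "{2,3,4,6}" 5 "{2..6}" t]) (auto intro: sub)
  obtain C where C: "C 4 = 1" "\<And>j. j \<notin> insert 4 {3,5,6,7} \<Longrightarrow> C j = 0"
      "\<And>r. r \<in> cubic_polys \<Longrightarrow> (\<Sum>j\<in>{3..7}. C j * poly r (s j)) = 0"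
    by (rule five_weights[of "{3,5,6,7}" 4 "{3..7}" s]) (auto intro: sub)
  obtain F4 where F4: "F4 4 = 1" "\<And>j. j \<notin> insert 4 {2,3,6,7} \<Longrightarrow> F4 j = 0"
      "\<And>r. r \<in> cubic_polys \<Longrightarrow> (\<Sum>j\<in>{2..7}. F4 j * poly r (t j)) = 0"
    by (rule five_weights[of "{2,3,6,7}" 4 "{2..7}" t]) (auto intro: sub)
  obtain F5 where F5: "F5 5 = 1" "\<And>j. j \<notin> insert 5 {2,3,6,7} \<Longrightarrow> F5 j = 0"
      "\<And>r. r \<in> cubic_polys \<Longrightarrow> (\<Sum>j\<in>{2..7}. F5 j * poly r (t j)) = 0"
    by (rule five_weights[of "{2,3,6,7}" 5 "{2..7}" t]) (auto intro: sub)
  have A4: "A 4 * \<alpha>\<^sub>A (t 4) + \<alpha>\<^sub>A (t 5) = 0"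
    using A(3)[OF cubic_roots_cubic[of "t 7" "t 3" "t 6"]] A(1) by (simp add: interval_3_7 poly_cubic_roots)
  have B5: "\<alpha>\<^sub>B (s 4) + B 5 * \<alpha>\<^sub>B (s 5) = 0"
    using B(3)[OF cubic_roots_cubic[of "s 2" "s 3" "s 6"]] B(1) by (simp add: interval_2_6 poly_cubic_roots)
  have E4: "E 4 * \<alpha>\<^sub>E (t 4) + \<alpha>\<^sub>E (t 5) = 0"
    using E(3)[OF cubic_roots_cubic[of "t 2" "t 3" "t 6"]] E(1) by (simp add: interval_2_6 poly_cubic_roots)
  have C5: "\<alpha>\<^sub>C (s 4) + C 5 * \<alpha>\<^sub>C (s 5) = 0"
    using C(3)[OF cubic_roots_cubic[of "s 3" "s 6" "s 7"]] C(1) by (simp add: interval_3_7 poly_cubic_roots)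
  have closing: "B 5 * E 4 = A 4 * C 5"
  proof -
    have alg: "B5 * E4 = A4 * C5"
      if "a4 \<noteq> 0" "a5 \<noteq> 0" "b4 \<noteq> 0" "b5 \<noteq> 0" "e4 \<noteq> 0" "e5 \<noteq> 0" "g4 \<noteq> 0" "g5 \<noteq> 0"
        and "A4 * a4 + a5 = 0" "b4 + B5 * b5 = 0" "E4 * e4 + e5 = 0" "g4 + C5 * g5 = 0"
        and "a4 / a5 - b5 / b4 * (e4 / e5) * (g4 / g5) = 0"
      for a4 a5 b4 b5 e4 e5 g4 g5 A4 B5 C5 E4 :: real
    proof -
      have A: "A4 = - a5 / a4" and B: "B5 = - b4 / b5" and E: "E4 = - e5 / e4" and C: "C5 = - g4 / g5"
        using that(1-12) by (simp_all add: field_simps add_eq_0_iff)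
      have 1: "B5 * E4 = (b4 * e5) / (b5 * e4)" by (subst B, subst E) simp
      have 2: "A4 * C5 = (a5 * g4) / (a4 * g5)" by (subst A, subst C) simp
      have "a4 / a5 = (b5 * e4 * g4) / (b4 * e5 * g5)" using that(13) by simp
      then have "a4 * (b4 * e5 * g5) = (b5 * e4 * g4) * a5" using that(1-8) by (simp add: frac_eq_eq)
      then show ?thesis unfolding 1 2 using that(1-8) by (simp add: frac_eq_eq mult_ac)
    qed
    show ?thesis
      by (rule alg[OF cubics_nonzero A4 B5 E4 C5]) (use D in \<open>simp only: example_D_def\<close>)
  qed
  define c where "c a b = (if a = 6 then A (b - 2) else if a = 7 then B 5 * E (b - 2)
    else if a = 8 then A 4 * C 6 * F4 (b - 2) + B 6 * F5 (b - 2)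
    else if b = 6 then A 4 * C (a - 2) else if b = 7 then B (a - 2) else 0)" for a b :: nat
  have row6: "c 6 = (\<lambda>b. A (b - 2))" and row7: "c 7 = (\<lambda>b. B 5 * E (b - 2))"
    and row8: "c 8 = (\<lambda>b. A 4 * C 6 * F4 (b - 2) + B 6 * F5 (b - 2))"
    by (simp_all add: c_def fun_eq_iff)
  have col6: "(\<lambda>a. c a 6) = (\<lambda>a. A 4 * C (a - 2))"
    using C(1) F4(1) F5(2)[of 4] closing by (simp add: c_def fun_eq_iff)
  have col7: "(\<lambda>a. c a 7) = (\<lambda>a. B (a - 2))"
    using A(1) B(1) E(1) F5(1) F4(2)[of 5] by (simp add: c_def fun_eq_iff)
  have scaled: "(\<Sum>j\<in>J. K * w j * poly r (f j)) = 0" if "(\<Sum>j\<in>J. w j * poly r (f j)) = 0"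
    for K w r and f :: "nat \<Rightarrow> real" and J :: "nat set"
    using that by (simp add: mult.assoc flip: sum_distrib_left)
  have out6: "spline_comb t (c 6) y = 0" if "y \<le> t 3 \<or> t 7 \<le> y" for y
    unfolding row6 by (rule weights_edge[OF t_mono _ _ _ A(2) A(3) that]) auto
  have out7: "spline_comb t (c 7) y = 0" if "y \<le> t 2 \<or> t 6 \<le> y" for y
    unfolding row7
    by (rule weights_edge[OF t_mono _ _ _ _ scaled[OF E(3)] that]) (auto simp: E(2))
  have out8: "spline_comb t (c 8) y = 0" if "y \<le> t 2 \<or> t 7 \<le> y" for y
    unfolding row8
  proof (rule weights_edge[OF t_mono _ _ _ _ _ that, where w = "\<lambda>j. A 4 * C 6 * F4 j + B 6 * F5 j"])
    show "(\<Sum>j\<in>{2..7}. (A 4 * C 6 * F4 j + B 6 * F5 j) * poly r (t j)) = 0" if r: "r \<in> cubic_polys" for r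
      unfolding distrib_right sum.distrib scaled[OF F4(3)[OF r]] scaled[OF F5(3)[OF r]] by simp
  qed (auto simp: F4(2) F5(2))
  have outh6: "spline_comb s (\<lambda>a. c a 6) x = 0" if "x \<le> s 3 \<or> s 7 \<le> x" for x
    unfolding col6
    by (rule weights_edge[OF s_mono _ _ _ _ scaled[OF C(3)] that]) (auto simp: C(2))
  have outh7: "spline_comb s (\<lambda>a. c a 7) x = 0" if "x \<le> s 2 \<or> s 6 \<le> x" for x
    unfolding col7 by (rule weights_edge[OF s_mono _ _ _ B(2) B(3) that]) auto
  have "mesh_coefficients c"
    unfolding mesh_coefficients_def using out6 out7 out8 outh6 outh7
    by (simp add: vspan_def hspan_def)
  moreover have "c 6 7 = 1" using A(1) by (simp add: c_def)
  ultimately show thesis by (rule that)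
qed

lemma tensor_comb_linear:
  "tensor_comb (\<lambda>a b. c a b + k * d a b) = (\<lambda>p. tensor_comb c p + k * tensor_comb d p)"
  by (rule ext) (simp add: tensor_comb_def algebra_simps sum.distrib sum_distrib_left)

lemma mesh_coefficients_linear:
  "mesh_coefficients c \<Longrightarrow> mesh_coefficients d \<Longrightarrow> mesh_coefficients (\<lambda>a b. c a b + k * d a b)"
  unfolding mesh_coefficients_def spline_comb_linear by simp

lemma mesh_coefficients_zero: "mesh_coefficients (\<lambda>a b. 0)"
  by (simp add: mesh_coefficients_def spline_comb_def)

lemma tensor_comb_zero_coefficients: "tensor_comb (\<lambda>a b. 0) = 0"
  by (rule ext) (simp add: tensor_comb_def)

lemma tensor_comb_inject:
  assumes "tensor_comb c = tensor_comb d" "a < 10" "b < 10"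
  shows "c a b = d a b"
proof -
  have "tensor_comb (\<lambda>a b. c a b + (-1) * d a b) p = 0" for p
    unfolding tensor_comb_linear using assms(1) by simp
  from tensor_comb_zero[OF this assms(2,3)] show ?thesis by simp
qed

lemma spline_space_iff: "f \<in> spline_space 3 \<M> \<longleftrightarrow> (\<exists>c. f = tensor_comb c \<and> mesh_coefficients c)"
  using spline_eq_tensor_comb[of f] tensor_comb_in_spline_space by metis

lemma subspace_spline_space: "fun_vs.subspace (spline_space 3 \<M>)"
proof (rule fun_vs.subspaceI)
  show "0 \<in> spline_space 3 \<M>"
    unfolding spline_space_iff using mesh_coefficients_zero tensor_comb_zero_coefficients by metis
next
  fix f g assume "f \<in> spline_space 3 \<M>" "g \<in> spline_space 3 \<M>"
  then obtain c d where cd: "f = tensor_comb c" "mesh_coefficients c" "g = tensor_comb d" "mesh_coefficients d"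
    unfolding spline_space_iff by blast
  have "f + g = tensor_comb (\<lambda>a b. c a b + 1 * d a b)"
    unfolding tensor_comb_linear cd by (simp add: fun_eq_iff)
  then show "f + g \<in> spline_space 3 \<M>"
    unfolding spline_space_iff using mesh_coefficients_linear[OF cd(2,4)] by blast
next
  fix k f assume "f \<in> spline_space 3 \<M>"
  then obtain c where c: "f = tensor_comb c" "mesh_coefficients c"
    unfolding spline_space_iff by blast
  have "(\<lambda>x. k * f x) = tensor_comb (\<lambda>a b. 0 + k * c a b)"
    unfolding tensor_comb_linear c by (simp add: fun_eq_iff tensor_comb_zero_coefficients)
  then show "(\<lambda>x. k * f x) \<in> spline_space 3 \<M>"
    unfolding spline_space_iff using mesh_coefficients_linear[OF mesh_coefficients_zero c(2)] by blast
qed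

definition tensor_basis :: "nat \<times> nat \<Rightarrow> real \<times> real \<Rightarrow> real" where
  "tensor_basis i p = (if p \<in> \<Omega> then spline_basis s (fst i) (fst p) * spline_basis t (snd i) (snd p) else 0)"

lemma tensor_comb_eq_sum:
  assumes "I \<subseteq> {..<10} \<times> {..<10}" "\<And>a b. a < 10 \<Longrightarrow> b < 10 \<Longrightarrow> (a, b) \<notin> I \<Longrightarrow> c a b = 0"
  shows "tensor_comb c = (\<Sum>i\<in>I. (\<lambda>p. c (fst i) (snd i) * tensor_basis i p))"
proof
  fix p
  show "tensor_comb c p = (\<Sum>i\<in>I. (\<lambda>p. c (fst i) (snd i) * tensor_basis i p)) p"
  proof (cases "p \<in> \<Omega>")
    case True
    have "tensor_comb c p = (\<Sum>i\<in>{..<10} \<times> {..<10}. c (fst i) (snd i) * tensor_basis i p)"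
      using True by (simp add: tensor_comb_def tensor_basis_def sum.cartesian_product case_prod_beta mult.assoc)
    also have "\<dots> = (\<Sum>i\<in>I. c (fst i) (snd i) * tensor_basis i p)"
      using assms by (intro sum.mono_neutral_right) auto
    finally show ?thesis by (simp only: sum_function_apply)
  next
    case False
    then show ?thesis by (simp add: sum_function_apply tensor_comb_def tensor_basis_def)
  qed
qed

definition unit_coefficients :: "nat \<times> nat \<Rightarrow> nat \<Rightarrow> nat \<Rightarrow> real" where
  "unit_coefficients i a b = (if (a, b) = i then 1 else 0)"

lemma tensor_basis_eq_comb:
  assumes "i \<in> {..<10} \<times> {..<10}"
  shows "tensor_basis i = tensor_comb (unit_coefficients i)"
proof -
  have "tensor_comb (unit_coefficients i) = (\<Sum>j\<in>{i}. (\<lambda>p. unit_coefficients i (fst j) (snd j) * tensor_basis j p))"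
    using assms by (intro tensor_comb_eq_sum) (auto simp: unit_coefficients_def)
  also have "\<dots> = tensor_basis i" by (simp add: unit_coefficients_def)
  finally show ?thesis ..
qed

lemma inj_tensor_basis: "inj_on tensor_basis ({..<10} \<times> {..<10})"
proof
  fix i j assume i: "i \<in> {..<10} \<times> {..<10}" and j: "j \<in> {..<10} \<times> {..<10}"
    and eq: "tensor_basis i = tensor_basis j"
  then have "tensor_comb (unit_coefficients i) = tensor_comb (unit_coefficients j)"
    by (simp only: tensor_basis_eq_comb)
  from tensor_comb_inject[OF this, of "fst i" "snd i"] i show "i = j"
    by (auto simp: unit_coefficients_def split: if_splits)
qed

lemma independent_tensor_basis:
  assumes I: "I \<subseteq> {..<10} \<times> {..<10}"
  shows "fun_vs.independent (tensor_basis ` I)"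
proof (rule fun_vs.independent_if_scalars_zero)
  show "finite (tensor_basis ` I)" using finite_subset[OF I] by simp
  fix u f assume zero: "(\<Sum>v\<in>tensor_basis ` I. (\<lambda>x. u v * v x)) = 0" and f: "f \<in> tensor_basis ` I"
  let ?c = "\<lambda>a b. if (a, b) \<in> I then u (tensor_basis (a, b)) else 0"
  have "tensor_comb ?c = (\<Sum>i\<in>I. (\<lambda>p. ?c (fst i) (snd i) * tensor_basis i p))"
    by (rule tensor_comb_eq_sum[OF I]) simp
  also have "\<dots> = (\<Sum>i\<in>I. (\<lambda>p. u (tensor_basis i) * tensor_basis i p))"
    by (rule sum.cong) auto
  also have "\<dots> = (\<Sum>v\<in>tensor_basis ` I. (\<lambda>x. u v * v x))"
    by (subst sum.reindex[OF inj_on_subset[OF inj_tensor_basis I]]) simp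
  finally have eq: "tensor_comb ?c = tensor_comb (\<lambda>a b. 0)" using zero tensor_comb_zero_coefficients by simp
  obtain a b where ab: "(a, b) \<in> I" "f = tensor_basis (a, b)" using f by auto
  have "a < 10" "b < 10" using ab(1) I by auto
  from tensor_comb_inject[OF eq this] show "u f = 0" using ab by simp
qed

text \<open>The indices of the tensor product splines on the grid of the cross-cuts.\<close>

definition free_indices :: "(nat \<times> nat) set" where
  "free_indices = ({..<10} - {6,7,8}) \<times> ({..<10} - {6,7})"

lemma free_indices_subset: "free_indices \<subseteq> {..<10} \<times> {..<10}"
  by (auto simp: free_indices_def)

lemma card_free_indices: "card (tensor_basis ` free_indices) = 56"
proof -
  have "card (tensor_basis ` free_indices) = card free_indices"
    by (rule card_image[OF inj_on_subset[OF inj_tensor_basis free_indices_subset]])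
  also have "\<dots> = 56"
    unfolding free_indices_def card_cartesian_product by (simp add: card_Diff_subset)
  finally show ?thesis .
qed

lemma free_tensor_basis_in_spline_space: "tensor_basis ` free_indices \<subseteq> spline_space 3 \<M>"
proof (rule image_subsetI)
  fix i assume i: "i \<in> free_indices"
  have "mesh_coefficients (unit_coefficients i)"
    using i unfolding mesh_coefficients_def free_indices_def unit_coefficients_def spline_comb_def
    by (auto intro!: sum.neutral)
  then show "tensor_basis i \<in> spline_space 3 \<M>"
    unfolding spline_space_iff using tensor_basis_eq_comb i free_indices_subset by blast
qed

lemma spline_in_free_span:
  assumes "mesh_coefficients c" "c 6 7 = 0"
  shows "tensor_comb c \<in> fun_vs.span (tensor_basis ` free_indices)"
proof -
  have eq: "tensor_comb c = (\<Sum>i\<in>free_indices. (\<lambda>p. c (fst i) (snd i) * tensor_basis i p))"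
  proof (rule tensor_comb_eq_sum[OF free_indices_subset])
    fix a b :: nat assume "a < 10" "b < 10" "(a, b) \<notin> free_indices"
    then show "c a b = 0" by (intro T_coefficients_zero[OF assms]) (auto simp: free_indices_def)
  qed
  show ?thesis
    unfolding eq
  proof (rule fun_vs.span_sum)
    fix i assume i: "i \<in> free_indices"
    show "(\<lambda>p. c (fst i) (snd i) * tensor_basis i p) \<in> fun_vs.span (tensor_basis ` free_indices)"
      by (rule fun_vs.span_scale[OF fun_vs.span_base[OF imageI[OF i]]])
  qed
qed

lemma dim_if_D_nonzero:
  assumes "example_D s t \<noteq> 0"
  shows "spline_dim 3 \<M> = 56"
proof -
  have "spline_space 3 \<M> = fun_vs.span (tensor_basis ` free_indices)"
  proof
    show "spline_space 3 \<M> \<subseteq> fun_vs.span (tensor_basis ` free_indices)"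
    proof
      fix f assume "f \<in> spline_space 3 \<M>"
      then obtain c where c: "f = tensor_comb c" "mesh_coefficients c" unfolding spline_space_iff by blast
      then have "c 6 7 = 0" using coefficient_times_D assms by simp
      then show "f \<in> fun_vs.span (tensor_basis ` free_indices)" using spline_in_free_span c by simp
    qed
    show "fun_vs.span (tensor_basis ` free_indices) \<subseteq> spline_space 3 \<M>"
      by (rule fun_vs.span_minimal[OF free_tensor_basis_in_spline_space subspace_spline_space])
  qed
  then show ?thesis
    unfolding spline_dim_def
    by (simp add: fun_vs.dim_eq_card_independent[OF independent_tensor_basis[OF free_indices_subset]] card_free_indices)
qed

text \<open>
  Every spline agrees, after subtraction of a multiple of the kernel spline, with one having
  coefficient 0 at the chosen multi-vertex, and such splines are spanned by the free products.
\<close>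

lemma dim_if_D_zero:
  assumes "example_D s t = 0"
  shows "spline_dim 3 \<M> = 57"
proof -
  obtain k where k: "mesh_coefficients k" "k 6 7 = 1" using kernel_coefficients[OF assms] by blast
  let ?U = "tensor_basis ` free_indices" and ?k = "tensor_comb k"
  have "?k \<notin> fun_vs.span ?U"
  proof
    let ?Z = "{tensor_comb c | c. c 6 7 = 0}"
    have Z: "fun_vs.subspace ?Z"
    proof (rule fun_vs.subspaceI)
      show "0 \<in> ?Z" using tensor_comb_zero_coefficients by (auto intro!: exI[of _ "\<lambda>a b. 0"])
    next
      fix f g assume "f \<in> ?Z" "g \<in> ?Z"
      then obtain c d where cd: "f = tensor_comb c" "c 6 7 = 0" "g = tensor_comb d" "d 6 7 = 0" by blast
      have "f + g = tensor_comb (\<lambda>a b. c a b + 1 * d a b)"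
        unfolding tensor_comb_linear cd by (simp add: fun_eq_iff)
      then show "f + g \<in> ?Z" using cd by (intro CollectI exI[of _ "\<lambda>a b. c a b + 1 * d a b"]) simp
    next
      fix m f assume "f \<in> ?Z"
      then obtain c where c: "f = tensor_comb c" "c 6 7 = 0" by blast
      have "(\<lambda>x. m * f x) = tensor_comb (\<lambda>a b. 0 + m * c a b)"
        unfolding tensor_comb_linear c by (simp add: fun_eq_iff tensor_comb_zero_coefficients)
      then show "(\<lambda>x. m * f x) \<in> ?Z" using c by (intro CollectI exI[of _ "\<lambda>a b. 0 + m * c a b"]) simp
    qed
    have "?U \<subseteq> ?Z"
    proof (rule image_subsetI)
      fix i assume i: "i \<in> free_indices"
      then have "unit_coefficients i 6 7 = 0" by (auto simp: free_indices_def unit_coefficients_def)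
      moreover have "tensor_basis i = tensor_comb (unit_coefficients i)"
        using tensor_basis_eq_comb i free_indices_subset by blast
      ultimately show "tensor_basis i \<in> ?Z" by blast
    qed
    then have "fun_vs.span ?U \<subseteq> ?Z" using Z by (rule fun_vs.span_minimal)
    moreover assume "?k \<in> fun_vs.span ?U"
    ultimately obtain c where "?k = tensor_comb c" "c 6 7 = 0" by blast
    then show False using tensor_comb_inject[of k c 6 7] k(2) by simp
  qed
  then have ind: "fun_vs.independent (insert ?k ?U)"
    by (rule fun_vs.independent_insertI[OF _ independent_tensor_basis[OF free_indices_subset]])
  have "?k \<notin> ?U" using \<open>?k \<notin> fun_vs.span ?U\<close> fun_vs.span_base by blast
  moreover have "finite ?U" using finite_subset[OF free_indices_subset] by simp
  ultimately have card: "card (insert ?k ?U) = 57" using card_free_indices by simp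
  have "spline_space 3 \<M> = fun_vs.span (insert ?k ?U)"
  proof
    show "spline_space 3 \<M> \<subseteq> fun_vs.span (insert ?k ?U)"
    proof
      fix f assume "f \<in> spline_space 3 \<M>"
      then obtain c where c: "f = tensor_comb c" "mesh_coefficients c" unfolding spline_space_iff by blast
      let ?d = "\<lambda>a b. c a b + (- c 6 7) * k a b"
      have "tensor_comb ?d \<in> fun_vs.span ?U"
        by (rule spline_in_free_span[OF mesh_coefficients_linear[OF c(2) k(1)]]) (simp add: k(2))
      then have d: "tensor_comb ?d \<in> fun_vs.span (insert ?k ?U)"
        using fun_vs.span_mono[of ?U "insert ?k ?U"] by blast
      have "?k \<in> fun_vs.span (insert ?k ?U)" by (rule fun_vs.span_base) simp
      from fun_vs.span_add[OF d fun_vs.span_scale[OF this, of "c 6 7"]]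
      have "tensor_comb ?d + (\<lambda>x. c 6 7 * ?k x) \<in> fun_vs.span (insert ?k ?U)" .
      moreover have "tensor_comb ?d + (\<lambda>x. c 6 7 * ?k x) = f"
        unfolding tensor_comb_linear c(1) by (simp add: fun_eq_iff)
      ultimately show "f \<in> fun_vs.span (insert ?k ?U)" by simp
    qed
    have "?k \<in> spline_space 3 \<M>" using k(1) by (simp add: tensor_comb_in_spline_space)
    then show "fun_vs.span (insert ?k ?U) \<subseteq> spline_space 3 \<M>"
      using free_tensor_basis_in_spline_space by (intro fun_vs.span_minimal[OF _ subspace_spline_space]) simp
  qed
  then show ?thesis
    unfolding spline_dim_def by (simp only: fun_vs.dim_span fun_vs.dim_eq_card_independent[OF ind] card)
qed

lemma example_mesh_properties:
  assumes "example_mesh s t \<T>"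
  shows "cross_cuts \<T> = example_cross_cuts s t \<and> T_l_edges \<T> = example_T_l_edges s t \<and>
    \<not> diagonalizable 3 \<T> \<and> (\<exists>!T1. complete_partition 3 \<T> T1) \<and> cndc 3 \<T> = example_cndc s t \<and>
    U_K 3 \<T> = L_K 3 \<T> + 1 \<and>
    (example_D s t \<noteq> 0 \<longrightarrow> int (spline_dim 3 \<T>) = L_K 3 \<T>) \<and>
    (example_D s t = 0 \<longrightarrow> int (spline_dim 3 \<T>) = U_K 3 \<T>)"
  unfolding example_mesh_unique[OF assms]
  using cross_cuts_example T_l_edges_example not_diagonalizable_example complete_partition_example
    cndc_example U_K_example L_K_example dim_if_D_nonzero dim_if_D_zero
  by (simp add: example_cross_cuts_eq example_T_l_edges_eq example_cndc_eq cross_cut_indices_def T_indices_def)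

end

text \<open>For \<open>s = t\<close> the two sides of the relation agree; bending one axis separates them.\<close>

lemma example_D_uniform: "example_D real real = 0"
  by (simp add: example_D_def)

lemma example_D_squares: "example_D real (\<lambda>i. real i ^ 2) \<noteq> 0"
  by (simp add: example_D_def)

lemma admissible_uniform: "admissible real real"
  and admissible_squares: "admissible real (\<lambda>i. real i ^ 2)"
  by (auto simp: admissible_def intro!: strict_mono_onI power_strict_mono)

theorem mainTheorem4:
  shows "(\<forall>s t. admissible s t \<longrightarrow> (\<exists>!\<T>. example_mesh s t \<T>)) \<and>
    (\<forall>s t \<T> s' t' \<T>'. admissible s t \<and> example_mesh s t \<T> \<and>
       admissible s' t' \<and> example_mesh s' t' \<T>' \<longrightarrow> same_topology \<T> \<T>') \<and>
    (\<forall>s t \<T>. admissible s t \<and> example_mesh s t \<T> \<longrightarrow>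
       cross_cuts \<T> = example_cross_cuts s t \<and>
       T_l_edges \<T> = example_T_l_edges s t \<and>
       \<not> diagonalizable 3 \<T> \<and> (\<exists>!T1. complete_partition 3 \<T> T1) \<and>
       cndc 3 \<T> = example_cndc s t \<and>
       U_K 3 \<T> = L_K 3 \<T> + 1 \<and>
       (example_D s t \<noteq> 0 \<longrightarrow> int (spline_dim 3 \<T>) = L_K 3 \<T>) \<and>
       (example_D s t = 0 \<longrightarrow> int (spline_dim 3 \<T>) = U_K 3 \<T>)) \<and>
    (\<exists>s t \<T> s' t' \<T>'. admissible s t \<and> example_mesh s t \<T> \<and>
       admissible s' t' \<and> example_mesh s' t' \<T>' \<and>
       example_D s t \<noteq> 0 \<and> int (spline_dim 3 \<T>) = L_K 3 \<T> \<and>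
       example_D s' t' = 0 \<and> int (spline_dim 3 \<T>') = U_K 3 \<T>' \<and>
       same_topology \<T> \<T>')"
proof (intro conjI)
  have exists: "example_mesh s t (example_cells s t)" if "admissible s t" for s t
    using grid.example_mesh_example_cells[OF grid.intro[OF that]] .
  have unique: "\<T> = example_cells s t" if "admissible s t" "example_mesh s t \<T>" for s t \<T>
    using grid.example_mesh_unique[OF grid.intro[OF that(1)] that(2)] .
  show "\<forall>s t. admissible s t \<longrightarrow> (\<exists>!\<T>. example_mesh s t \<T>)" using exists unique by blast
  show "\<forall>s t \<T> s' t' \<T>'. admissible s t \<and> example_mesh s t \<T> \<and>
       admissible s' t' \<and> example_mesh s' t' \<T>' \<longrightarrow> same_topology \<T> \<T>'"
  proof (intro allI impI, elim conjE)
    fix s t \<T> s' t' \<T>'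
    assume a: "admissible s t" "example_mesh s t \<T>" "admissible s' t'" "example_mesh s' t' \<T>'"
    show "same_topology \<T> \<T>'"
      unfolding unique[OF a(1,2)] unique[OF a(3,4)] by (rule same_topology_example_cells[OF a(1,3)])
  qed
  show all: "\<forall>s t \<T>. admissible s t \<and> example_mesh s t \<T> \<longrightarrow>
       cross_cuts \<T> = example_cross_cuts s t \<and>
       T_l_edges \<T> = example_T_l_edges s t \<and>
       \<not> diagonalizable 3 \<T> \<and> (\<exists>!T1. complete_partition 3 \<T> T1) \<and>
       cndc 3 \<T> = example_cndc s t \<and>
       U_K 3 \<T> = L_K 3 \<T> + 1 \<and>
       (example_D s t \<noteq> 0 \<longrightarrow> int (spline_dim 3 \<T>) = L_K 3 \<T>) \<and>
       (example_D s t = 0 \<longrightarrow> int (spline_dim 3 \<T>) = U_K 3 \<T>)"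
    by (intro allI impI, elim conjE) (rule grid.example_mesh_properties[OF grid.intro])
  show "\<exists>s t \<T> s' t' \<T>'. admissible s t \<and> example_mesh s t \<T> \<and>
       admissible s' t' \<and> example_mesh s' t' \<T>' \<and>
       example_D s t \<noteq> 0 \<and> int (spline_dim 3 \<T>) = L_K 3 \<T> \<and>
       example_D s' t' = 0 \<and> int (spline_dim 3 \<T>') = U_K 3 \<T>' \<and>
       same_topology \<T> \<T>'"
  proof (intro exI conjI)
    show "admissible real (\<lambda>i. real i ^ 2)" "admissible real real"
      by (rule admissible_squares admissible_uniform)+
    show "example_mesh real (\<lambda>i. real i ^ 2) (example_cells real (\<lambda>i. real i ^ 2))"
      "example_mesh real real (example_cells real real)"
      by (rule exists admissible_squares admissible_uniform)+
    show "example_D real (\<lambda>i. real i ^ 2) \<noteq> 0" "example_D real real = 0"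
      by (rule example_D_squares example_D_uniform)+
    show "int (spline_dim 3 (example_cells real (\<lambda>i. real i ^ 2))) = L_K 3 (example_cells real (\<lambda>i. real i ^ 2))"
      using grid.dim_if_D_nonzero[OF grid.intro[OF admissible_squares] example_D_squares]
        grid.L_K_example[OF grid.intro[OF admissible_squares]] by simp
    show "int (spline_dim 3 (example_cells real real)) = U_K 3 (example_cells real real)"
      using grid.dim_if_D_zero[OF grid.intro[OF admissible_uniform] example_D_uniform]
        grid.U_K_example[OF grid.intro[OF admissible_uniform]] by simp
    show "same_topology (example_cells real (\<lambda>i. real i ^ 2)) (example_cells real real)"
      by (rule same_topology_example_cells[OF admissible_squares admissible_uniform])
  qed
qed

end
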